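(* For every integer $k$ and every positive integer $n$, \[ \mathrm{roots}_k^{B_n}=\sum_{C\in\mathrm{Conj}(B_n)\,:\,C^k=\{1\}}\psi^C , \] where $C^k=\{x^k:x\in C\}$ and $\psi^C$ is the higher Lie character of type $B$ attached to the conjugacy class $C$ (defined below).
   Context: $\mathrm{roots}_k^G(g)=|\{h\in G:h^k=g\}|$. $B_n$ is the group of bijections $w$ of $\{\pm1,\dots,\pm n\}$ with $w(-i)=-w(i)$; $\mathrm{Conj}(B_n)$ is its set of conjugacy classes. Cycles: writing $w$ as a product of disjoint cycles on $\{\pm1,\dots,\pm n\}$, if $c=(a_1,\dots,a_\ell)$ is a cycle so is $\bar c=(-a_1,\dots,-a_\ell)$; if $c\neq\bar c$ then $c\bar c$ is called a cycle of $w$ of length $\ell$ and $\mathbb{Z}_2$-class $+1$; if $c=\bar c$ it is a cycle of length $\ell/2$ and class $-1$. Two elements are conjugate iff they have the same numbers of cycles of each length and class. Higher Lie characters: for $x\in B_n$ let $a_{i,\varepsilon}$ be the number of cycles of $x$ of length $i$ and class $\varepsilon\in\{\pm1\}$, and write $x=\prod_{i,\varepsilon}x_{i,\varepsilon}$, $x_{i,\varepsilon}$ the product of those cycles. Then $Z_{B_n}(x)=\prod_{i,\varepsilon}Z(x_{i,\varepsilon})$, where $Z(x_{i,\varepsilon})$ is the centralizer of $x_{i,\varepsilon}$ in the signed permutations of its support, and $Z(x_{i,\varepsilon})\cong G_{i,\varepsilon}\wr S_{a_{i,\varepsilon}}$; here $G_{i,+}\cong\mathbb{Z}_2\times\mathbb{Z}_i$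 is the centralizer in $B_i$ of one cycle of length $i$ and class $+1$ ($\mathbb Z_2$ generated by $w_0=[-1,\dots,-i]$, $\mathbb Z_i$ by the cycle), and $G_{i,-}\cong\mathbb{Z}_{2i}$ is the centralizer in $B_i$ of one cycle of length $i$ and class $-1$ (generated by that cycle). Let $\omega_{i,+}$ be the linear character of $G_{i,+}\wr S_{a}$ which on the base group $G_{i,+}^{a}$ is the product over the factors of (trivial on $\mathbb Z_2$)$\times$(a faithful linear character of $\mathbb Z_i$), and is trivial on the complement $S_a$; let $\omega_{i,-}$ be the linear character of $G_{i,-}\wr S_a$ which on the base group is the product of a faithful linear character of $\mathbb Z_{2i}$ over the factors and is trivial on $S_a$. Put $\omega^x=\bigotimes_{i,\varepsilon}\omega_{i,\varepsilon}$, a linear character of $Z_{B_n}(x)$, and $\psi^x=\mathrm{Ind}_{Z_{B_n}(x)}^{B_n}\omega^x$. This depends only on the conjugacy class $C$ of $x$ and is denoted $\psi^C$. *)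

theory Defs
  imports
    Complex_Main
    "HOL-Algebra.Generated_Groups"
    "HOL-Combinatorics.Orbits"
    "HOL-Combinatorics.Cycles"
begin

section \<open>Class functions on a finite group\<close>

definition roots :: "('a, 'b) monoid_scheme \<Rightarrow> int \<Rightarrow> 'a \<Rightarrow> nat" where
  "roots G k g = card {h \<in> carrier G. h [^]\<^bsub>G\<^esub> k = g}"

definition conj_class :: "('a, 'b) monoid_scheme \<Rightarrow> 'a \<Rightarrow> 'a set" where
  "conj_class G x = (\<lambda>h. h \<otimes>\<^bsub>G\<^esub> x \<otimes>\<^bsub>G\<^esub> inv\<^bsub>G\<^esub> h) ` carrier G"

definition conj_classes :: "('a, 'b) monoid_scheme \<Rightarrow> 'a set set" where
  "conj_classes G = conj_class G ` carrier G"

definition centralizer :: "('a, 'b) monoid_scheme \<Rightarrow> 'a \<Rightarrow> 'a set" where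
  "centralizer G x = {h \<in> carrier G. h \<otimes>\<^bsub>G\<^esub> x = x \<otimes>\<^bsub>G\<^esub> h}"

definition complex_units :: "complex monoid" where
  "complex_units = \<lparr>carrier = UNIV - {0}, monoid.mult = (*), one = 1\<rparr>"

definition linear_character :: "('a, 'b) monoid_scheme \<Rightarrow> 'a set \<Rightarrow> ('a \<Rightarrow> complex) \<Rightarrow> bool" where
  "linear_character G H \<chi> \<longleftrightarrow> \<chi> \<in> hom (G\<lparr>carrier := H\<rparr>) complex_units"

text \<open>The character of $G$ induced from a character of the subgroup $H$.\<close>

definition induced_char ::
    "('a, 'b) monoid_scheme \<Rightarrow> 'a set \<Rightarrow> ('a \<Rightarrow> complex) \<Rightarrow> 'a \<Rightarrow> complex" where
  "induced_char G H \<chi> g =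
     (\<Sum>t \<in> {t \<in> carrier G. inv\<^bsub>G\<^esub> t \<otimes>\<^bsub>G\<^esub> g \<otimes>\<^bsub>G\<^esub> t \<in> H}.
        \<chi> (inv\<^bsub>G\<^esub> t \<otimes>\<^bsub>G\<^esub> g \<otimes>\<^bsub>G\<^esub> t)) / of_nat (card H)"


section \<open>Signed permutations and their cycles\<close>

text \<open>
  The signed permutations of a finite set $S = -S$ of nonzero integers. They are represented by
  functions on all integers that are the identity outside $S$; hence for $D \subseteq S$ the
  group for $D$ is literally a subgroup of the group for $S$.
\<close>

definition signed_perm_group :: "int set \<Rightarrow> (int \<Rightarrow> int) monoid" where
  "signed_perm_group S =
     \<lparr>carrier = {w. w permutes S \<and> (\<forall>a. w (- a) = - w a)}, monoid.mult = (\<circ>), one = id\<rparr>"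

definition hyperoctahedral_group :: "nat \<Rightarrow> (int \<Rightarrow> int) monoid" where
  "hyperoctahedral_group n = signed_perm_group ({- int n..int n} - {0})"

text \<open>
  A cycle $c$ of $w$ on $\{\pm 1,\dots,\pm n\}$ is determined by its support, an orbit $O$ of $w$
  (a fixed point being a cycle of length one); $\bar c$ is then the cycle with support $-O$.
  The following three notions refer to the signed cycle through $a$, namely
  $c \bar c$ if $c \neq \bar c$ and $c$ if $c = \bar c$.
\<close>

definition cyc_supp :: "(int \<Rightarrow> int) \<Rightarrow> int \<Rightarrow> int set" where
  "cyc_supp w a = orbit w a \<union> uminus ` orbit w a"

definition cyc_class :: "(int \<Rightarrow> int) \<Rightarrow> int \<Rightarrow> int" where
  "cyc_class w a = (if uminus ` orbit w a = orbit w a then -1 else 1)"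

definition cyc_length :: "(int \<Rightarrow> int) \<Rightarrow> int \<Rightarrow> nat" where
  "cyc_length w a =
     (if uminus ` orbit w a = orbit w a then card (orbit w a) div 2 else card (orbit w a))"

text \<open>
  The support of $w_{i,\varepsilon}$, for $w \in B_n$; the element $w_{i,\varepsilon}$ itself is
  \<^term>\<open>perm_restrict w (cyc_part n w i \<epsilon>)\<close>.
\<close>

definition cyc_part :: "nat \<Rightarrow> (int \<Rightarrow> int) \<Rightarrow> nat \<Rightarrow> int \<Rightarrow> int set" where
  "cyc_part n w i \<epsilon> =
     {a \<in> {- int n..int n} - {0}. cyc_length w a = i \<and> cyc_class w a = \<epsilon>}"


section \<open>Higher Lie characters of type B\<close>

text \<open>
  Let $x$ be a signed permutation of $P$ all of whose cycles have class $\varepsilon$ and the same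
  length $i$. The predicate says that $\theta$ is a character $\omega_{i,\varepsilon}$ of
  $Z(x) \cong G_{i,\varepsilon} \wr S_a$. Inside $Z(x)$ the wreath product looks as follows.

  The factors of the base group are the centralizers of the single cycles $c$ of $x$ in the
  signed permutations of the support $D$ of $c$. For $\varepsilon = 1$ such a factor is the
  product of the group generated by $w_0$ (negation on $D$) and the one generated by $c$.
  Since $\theta$ is multiplicative, its value on the base group is the product of its values on
  the factors, and since it is moreover invariant under conjugation by $S_a$, it restricts to
  the same faithful character on all factors.

  The complement $S_a$ is given by a set $B$ of base points, one in each cycle: a permutation of
  the cycles is lifted to the element of $Z(x)$ that permutes the base points accordingly.
  So the complement is the setwise stabilizer of $B$ in $Z(x)$. Different sets $B$ have
  complements that are conjugate under the base group, so the condition does not depend on $B$.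
\<close>

definition wreath_char ::
    "int \<Rightarrow> int set \<Rightarrow> (int \<Rightarrow> int) \<Rightarrow> ((int \<Rightarrow> int) \<Rightarrow> complex) \<Rightarrow> bool" where
  "wreath_char \<epsilon> P x \<theta> \<longleftrightarrow>
     linear_character (signed_perm_group P) (centralizer (signed_perm_group P) x) \<theta> \<and>
     (\<forall>a\<in>P. let D = cyc_supp x a; c = perm_restrict x D in
        if \<epsilon> = 1
        then \<theta> (perm_restrict uminus D) = 1 \<and> inj_on \<theta> (generate (signed_perm_group D) {c})
        else inj_on \<theta> (centralizer (signed_perm_group D) c)) \<and>
     (\<exists>B\<subseteq>P. (\<forall>a\<in>P. \<exists>!b. b \<in> B \<inter> cyc_supp x a) \<and>
        (\<forall>z\<in>centralizer (signed_perm_group P) x. z ` B = B \<longrightarrow> \<theta> z = 1))"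

text \<open>
  $\omega^x = \bigotimes_{i,\varepsilon} \omega_{i,\varepsilon}$ on
  $Z_{B_n}(x) = \prod_{i,\varepsilon} Z(x_{i,\varepsilon})$, the components of $z$ in this product
  being its restrictions to the supports of the $x_{i,\varepsilon}$.
\<close>

definition omega_char :: "nat \<Rightarrow> (int \<Rightarrow> int) \<Rightarrow> ((int \<Rightarrow> int) \<Rightarrow> complex) \<Rightarrow> bool" where
  "omega_char n x \<omega> \<longleftrightarrow>
     (\<exists>\<theta>.
        (\<forall>i\<in>{1..n}. \<forall>\<epsilon>\<in>{1, -1}.
           wreath_char \<epsilon> (cyc_part n x i \<epsilon>) (perm_restrict x (cyc_part n x i \<epsilon>)) (\<theta> i \<epsilon>)) \<and>
        (\<forall>z\<in>centralizer (hyperoctahedral_group n) x.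
           \<omega> z = (\<Prod>i\<in>{1..n}. \<Prod>\<epsilon>\<in>{1, -1}. \<theta> i \<epsilon> (perm_restrict z (cyc_part n x i \<epsilon>)))))"

text \<open>
  $\psi = \psi^C$, with an arbitrary choice of the representative $x \in C$ and of the
  faithful characters and base points entering $\omega^x$.
\<close>

definition higher_lie_char ::
    "nat \<Rightarrow> (int \<Rightarrow> int) set \<Rightarrow> ((int \<Rightarrow> int) \<Rightarrow> complex) \<Rightarrow> bool" where
  "higher_lie_char n C \<psi> \<longleftrightarrow>
     (\<exists>x\<in>C. \<exists>\<omega>. omega_char n x \<omega> \<and>
        (\<forall>g\<in>carrier (hyperoctahedral_group n).
           \<psi> g = induced_char (hyperoctahedral_group n) (centralizer (hyperoctahedral_group n) x) \<omega> g))"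


section \<open>Existence of the higher Lie characters\<close>

lemma signed_perm_group_simps [simp]:
  "w \<in> carrier (signed_perm_group S) \<longleftrightarrow> w permutes S \<and> (\<forall>a. w (- a) = - w a)"
  "v \<otimes>\<^bsub>signed_perm_group S\<^esub> w = v \<circ> w"
  "\<one>\<^bsub>signed_perm_group S\<^esub> = id"
  by (auto simp: signed_perm_group_def)

lemma group_signed_perm_group: "group (signed_perm_group S)"
proof (rule groupI)
  fix w assume w: "w \<in> carrier (signed_perm_group S)"
  then have p: "w permutes S" and s: "w (- a) = - w a" for a
    by auto
  have "inv_into UNIV w (- a) = - inv_into UNIV w a" for a
    by (metis p s permutes_inverses)
  then show "\<exists>v\<in>carrier (signed_perm_group S). v \<otimes>\<^bsub>signed_perm_group S\<^esub> w = \<one>\<^bsub>signed_perm_group S\<^esub>"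
    using p by (intro bexI[of _ "inv_into UNIV w"]) (auto simp: permutes_inv permutes_inv_o)
qed (auto simp: permutes_compose permutes_id)

lemma mem_centralizer_iff:
  "z \<in> centralizer (signed_perm_group S) x \<longleftrightarrow>
     z permutes S \<and> (\<forall>a. z (- a) = - z a) \<and> (\<forall>a. z (x a) = x (z a))"
  by (auto simp: centralizer_def fun_eq_iff)

locale uniform_signed_perm =
  fixes P :: "int set" and x :: "int \<Rightarrow> int" and \<epsilon> :: int
  assumes fin: "finite P" and x_perm: "x permutes P" and x_neg: "\<And>a. x (- a) = - x a"
    and neg_P: "\<And>a. a \<in> P \<Longrightarrow> - a \<in> P"
    and cls: "\<And>a. a \<in> P \<Longrightarrow> cyc_class x a = \<epsilon>"
begin

text \<open>
  A character $\theta$ as required is obtained from a function $\varphi$ on $P$ that is $1$ at the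
  base points, is multiplied by a primitive root of unity along $x$ and, for $\varepsilon = 1$,
  is even: put $\theta(z) = \prod_{b \in B} \varphi(z(b))$.
\<close>

lemma perm: "permutation x"
  using fin x_perm permutation_permutes by blast

lemma pow_neg: "(x ^^ r) (- a) = - (x ^^ r) a"
  by (induction r) (auto simp: x_neg)

lemma orbit_iff: "b \<in> orbit x a \<longleftrightarrow> (\<exists>r. b = (x ^^ r) a)"
  by (auto simp: orbit_altdef_permutation[OF perm])

lemma orbit_refl: "a \<in> orbit x a"
  by (rule permutation_self_in_orbit[OF perm])

lemma orbit_sym: "b \<in> orbit x a \<Longrightarrow> a \<in> orbit x b"
  using orbit_refl orbit_swap by metis

lemma orbit_eq: "b \<in> orbit x a \<Longrightarrow> orbit x b = orbit x a"
  using orbit_trans[of _ x b a] orbit_trans[of _ x a b] orbit_sym[of b a] by blast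

lemma orbit_uminus: "orbit x (- a) = uminus ` orbit x a"
  by (force simp: orbit_iff pow_neg image_iff)

lemma supp_iff: "b \<in> cyc_supp x a \<longleftrightarrow> b \<in> orbit x a \<or> - b \<in> orbit x a"
  by (force simp: cyc_supp_def image_iff)

lemma supp_iff2: "b \<in> cyc_supp x a \<longleftrightarrow> b \<in> orbit x a \<or> b \<in> orbit x (- a)"
  by (auto simp: cyc_supp_def orbit_uminus)

lemma supp_refl: "a \<in> cyc_supp x a"
  by (simp add: supp_iff orbit_refl)

lemma supp_sym: "b \<in> cyc_supp x a \<Longrightarrow> a \<in> cyc_supp x b"
  by (metis supp_iff supp_iff2 orbit_sym)

lemma supp_trans: "c \<in> cyc_supp x b \<Longrightarrow> b \<in> cyc_supp x a \<Longrightarrow> c \<in> cyc_supp x a"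
  by (smt (verit, best) supp_iff supp_iff2 orbit_trans)

lemma supp_eq: "b \<in> cyc_supp x a \<Longrightarrow> cyc_supp x b = cyc_supp x a"
  using supp_sym supp_trans by blast

lemma pow_P: "(x ^^ r) a \<in> P \<longleftrightarrow> a \<in> P"
  by (induction r) (auto simp: permutes_in_image[OF x_perm])

lemma supp_P: "b \<in> cyc_supp x a \<Longrightarrow> b \<in> P \<longleftrightarrow> a \<in> P"
  using supp_iff orbit_iff pow_P neg_P by (metis minus_minus)

abbreviation (input) "m a \<equiv> least_power x a"

lemma pow_eq_iff: "(x ^^ r) a = (x ^^ s) a \<longleftrightarrow> r mod m a = s mod m a"
proof -
  have *: "(x ^^ r) a = (x ^^ s) a \<longleftrightarrow> r mod m a = s mod m a" if "r \<le> s" for r s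
  proof -
    have "(x ^^ s) a = (x ^^ r) ((x ^^ (s - r)) a)"
      using that by (metis funpow_add le_add_diff_inverse o_apply)
    moreover have "inj (x ^^ r)"
      by (simp add: perm permutation_bijective bij_is_inj inj_fn)
    ultimately have "(x ^^ r) a = (x ^^ s) a \<longleftrightarrow> (x ^^ (s - r)) a = a"
      by (metis injD)
    then show ?thesis
      using that by (metis least_power_dvd[OF perm] mod_eq_dvd_iff_nat)
  qed
  show ?thesis
    using *[of r s] *[of s r] by (metis nat_le_linear)
qed

lemma m_pos: "m a > 0"
  by (rule least_power_of_permutation(2)[OF perm])

definition "\<zeta> a = cis (2 * pi / real (least_power x a))"

lemma zeta_pow_eq_iff: "\<zeta> a ^ r = \<zeta> a ^ s \<longleftrightarrow> (x ^^ r) a = (x ^^ s) a"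
proof -
  have *: "\<zeta> a ^ r = cis (2 * pi * real (r mod m a) / real (m a))" for r
  proof -
    have "\<zeta> a ^ m a = 1"
      using m_pos[of a] by (simp add: \<zeta>_def DeMoivre)
    then have "\<zeta> a ^ r = \<zeta> a ^ (r mod m a)"
      by (metis mult_div_mod_eq power_add power_mult power_one mult_1)
    also have "\<dots> = cis (2 * pi * real (r mod m a) / real (m a))"
      by (simp add: \<zeta>_def DeMoivre mult_ac)
    finally show ?thesis .
  qed
  have "inj_on (\<lambda>k. cis (2 * pi * real k / real (m a))) {..<m a}"
    using bij_betw_roots_unity[OF m_pos[of a]] by (rule bij_betw_imp_inj_on)
  then have "\<zeta> a ^ r = \<zeta> a ^ s \<longleftrightarrow> r mod m a = s mod m a"
    unfolding * using m_pos[of a] by (auto dest: inj_onD)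
  then show ?thesis
    by (simp add: pow_eq_iff)
qed

lemma m_cong:
  assumes "z permutes P" "\<And>a. z (x a) = x (z a)"
  shows "m (z a) = m a"
proof -
  have "(x ^^ r) (z a) = z ((x ^^ r) a)" for r
    by (induction r) (auto simp: assms(2))
  then have "(x ^^ r) (z a) = z a \<longleftrightarrow> (x ^^ r) a = a" for r
    using permutes_inj[OF assms(1)] by (metis injD)
  then show ?thesis
    by (simp add: least_power_def)
qed

definition "\<beta> a = (SOME b. b \<in> cyc_supp x a)"

lemma beta_supp: "\<beta> a \<in> cyc_supp x a"
  unfolding \<beta>_def using supp_refl by (rule someI)

lemma beta_eq: "b \<in> cyc_supp x a \<Longrightarrow> \<beta> b = \<beta> a"
  by (simp add: \<beta>_def supp_eq)

definition "rel a r \<longleftrightarrow> a = (x ^^ r) (\<beta> a) \<or> \<epsilon> = 1 \<and> - a = (x ^^ r) (\<beta> a)"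

lemma class_cases: "a \<in> P \<Longrightarrow> \<epsilon> = 1 \<and> - a \<notin> orbit x a \<or> \<epsilon> = -1 \<and> - a \<in> orbit x a"
proof -
  assume a: "a \<in> P"
  have "uminus ` orbit x a = orbit x a \<longleftrightarrow> - a \<in> orbit x a"
  proof
    assume "- a \<in> orbit x a"
    then have "orbit x (- a) = orbit x a"
      by (rule orbit_eq)
    then show "uminus ` orbit x a = orbit x a"
      by (simp add: orbit_uminus)
  next
    assume "uminus ` orbit x a = orbit x a"
    then show "- a \<in> orbit x a"
      using orbit_refl by blast
  qed
  then show ?thesis
    using cls[OF a] by (auto simp: cyc_class_def split: if_splits)
qed

lemma rel_ex: 
  assumes "a \<in> P" shows "\<exists>r. rel a r"
proof -
  have "a \<in> cyc_supp x (\<beta> a)"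
    using beta_supp supp_sym by blast
  then have "a \<in> orbit x (\<beta> a) \<or> - a \<in> orbit x (\<beta> a)"
    by (simp add: supp_iff)
  moreover have "\<beta> a \<in> P"
    using beta_supp supp_P assms by blast
  ultimately have "a \<in> orbit x (\<beta> a) \<or> \<epsilon> = 1 \<and> - a \<in> orbit x (\<beta> a)"
    using class_cases[of a] assms by (metis orbit_trans orbit_sym)
  then show ?thesis
    by (auto simp: rel_def orbit_iff)
qed

lemma rel_unique:
  assumes "a \<in> P" "rel a r" "rel a s" shows "(x ^^ r) (\<beta> a) = (x ^^ s) (\<beta> a)"
proof -
  have "\<not> (a \<in> orbit x (\<beta> a) \<and> - a \<in> orbit x (\<beta> a))" if "\<epsilon> = 1"
    using class_cases[OF assms(1)] orbit_eq[of a "\<beta> a"] that by auto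
  then show ?thesis
    using assms(2,3) unfolding rel_def orbit_iff by auto
qed

definition "\<phi> a = \<zeta> (\<beta> a) ^ (SOME r. rel a r)"

lemma phi_eq: 
  assumes "a \<in> P" "rel a r" shows "\<phi> a = \<zeta> (\<beta> a) ^ r"
  unfolding \<phi>_def zeta_pow_eq_iff using rel_unique[OF assms(1)] assms(2) someI[of "rel a" r] by blast

lemma phi_nonzero: "\<phi> a \<noteq> 0"
  by (simp add: \<phi>_def \<zeta>_def)

lemma phi_beta: "a \<in> P \<Longrightarrow> \<phi> (\<beta> a) = 1"
  using phi_eq[of "\<beta> a" 0] beta_eq[OF beta_supp] beta_supp supp_P by (auto simp: rel_def)

lemma m_uminus: "m (- a) = m a"
  by (simp add: least_power_def pow_neg)

lemma m_x: "m (x a) = m a"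
  by (rule m_cong[OF x_perm]) simp

lemma m_supp: "b \<in> cyc_supp x a \<Longrightarrow> m b = m a"
proof -
  have *: "m ((x ^^ r) a) = m a" for r a
    by (induction r) (auto simp: m_x)
  show "b \<in> cyc_supp x a \<Longrightarrow> m b = m a"
    by (auto simp: supp_iff2 orbit_iff * m_uminus)
qed

lemma x_supp: "x a \<in> cyc_supp x a"
  by (simp add: supp_iff orbit.base)

lemma phi_x: 
  assumes "a \<in> P" shows "\<phi> (x a) = \<zeta> a * \<phi> a"
proof -
  obtain r where r: "rel a r" using rel_ex[OF assms] by blast
  have b: "\<beta> (x a) = \<beta> a" by (rule beta_eq[OF x_supp])
  have "rel (x a) (Suc r)"
    using r unfolding rel_def b by (auto simp: x_neg[symmetric])
  then have "\<phi> (x a) = \<zeta> (\<beta> a) ^ Suc r"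
    using phi_eq[of "x a" "Suc r"] assms b by (simp add: permutes_in_image[OF x_perm])
  moreover have "\<zeta> (\<beta> a) = \<zeta> a"
    by (simp add: \<zeta>_def m_supp[OF beta_supp])
  ultimately show ?thesis
    using phi_eq[OF assms r] by simp
qed

lemma phi_pow: 
  assumes "a \<in> P" shows "\<phi> ((x ^^ r) a) = \<zeta> a ^ r * \<phi> a"
proof (induction r)
  case (Suc r)
  have "\<zeta> ((x ^^ r) a) = \<zeta> a"
    using m_supp[of "(x ^^ r) a" a] unfolding \<zeta>_def supp_iff orbit_iff by metis
  then show ?case
    using Suc phi_x[of "(x ^^ r) a"] assms by (simp add: pow_P)
qed auto

lemma phi_uminus: 
  assumes "a \<in> P" "\<epsilon> = 1" shows "\<phi> (- a) = \<phi> a"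
proof -
  obtain r where r: "rel a r" using rel_ex[OF assms(1)] by blast
  have b: "\<beta> (- a) = \<beta> a" by (rule beta_eq) (simp add: supp_iff orbit_refl)
  have "rel (- a) r"
    using r assms(2) unfolding rel_def b by auto
  then show ?thesis
    using phi_eq[OF assms(1) r] phi_eq[of "- a" r] assms neg_P b by simp
qed

lemma phi_ratio:
  assumes z: "z permutes P" "\<And>a. z (- a) = - z a" "\<And>a. z (x a) = x (z a)"
    and a: "a \<in> P" "a' \<in> cyc_supp x a"
  shows "\<phi> (z a') * \<phi> a = \<phi> (z a) * \<phi> a'"
proof -
  have zx: "z ((x ^^ r) a) = (x ^^ r) (z a)" for r a
    by (induction r) (auto simp: z(3))
  have zP: "z a \<in> P \<longleftrightarrow> a \<in> P" for a
    by (rule permutes_in_image[OF z(1)])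
  have zz: "\<zeta> (z a) = \<zeta> a" for a
    using m_cong[OF z(1,3)] by (simp add: \<zeta>_def)
  have *: "\<phi> (z ((x ^^ r) a)) * \<phi> a = \<phi> (z a) * \<phi> ((x ^^ r) a)" if "a \<in> P" for a r
    using that by (simp add: zx phi_pow zP zz)
  have "a' \<in> orbit x a \<or> \<epsilon> = 1 \<and> - a' \<in> orbit x a"
  proof (cases "\<epsilon> = 1")
    case True
    then show ?thesis using a(2) by (simp add: supp_iff)
  next
    case False
    then have "- a \<in> orbit x a" using class_cases[OF a(1)] by blast
    then show ?thesis using a(2) orbit_eq[of "- a" a] by (simp add: supp_iff2)
  qed
  then obtain r where "a' = (x ^^ r) a \<or> \<epsilon> = 1 \<and> - a' = (x ^^ r) a"
    unfolding orbit_iff by blast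
  then show ?thesis
  proof (elim disjE conjE)
    assume "a' = (x ^^ r) a"
    then show ?thesis using *[OF a(1), of r] by (simp only:)
  next
    assume e: "\<epsilon> = 1" and "- a' = (x ^^ r) a"
    then have a': "a' = - ((x ^^ r) a)" by linarith
    define c where "c = (x ^^ r) a"
    have "c \<in> P" using a(1) by (simp add: c_def pow_P)
    then have "\<phi> (- z c) = \<phi> (z c)" "\<phi> (- c) = \<phi> c"
      using phi_uminus[OF _ e] zP by blast+
    then show ?thesis
      using *[OF a(1), of r] unfolding a' c_def[symmetric] z(2) by (simp only:)
  qed
qed

definition "B = \<beta> ` P"

lemma B_P: "B \<subseteq> P"
  using beta_supp supp_P by (auto simp: B_def)

lemma B_beta: "b \<in> B \<Longrightarrow> \<beta> b = b"
  using beta_eq[OF beta_supp] by (auto simp: B_def)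

lemma phi_B: "b \<in> B \<Longrightarrow> \<phi> b = 1"
  by (auto simp: B_def phi_beta)

definition "\<theta> z = (\<Prod>b\<in>B. \<phi> (z b))"

lemma theta_mult:
  assumes z: "z permutes P" "\<And>a. z (- a) = - z a" "\<And>a. z (x a) = x (z a)"
    and y: "y permutes P" "\<And>a. y (- a) = - y a" "\<And>a. y (x a) = x (y a)"
  shows "\<theta> (z \<circ> y) = \<theta> z * \<theta> y"
proof -
  have yP: "y a \<in> P \<longleftrightarrow> a \<in> P" for a
    by (rule permutes_in_image[OF y(1)])
  have yx: "y ((x ^^ r) a) = (x ^^ r) (y a)" for r a
    by (induction r) (auto simp: y(3))
  have finB: "finite B"
    using fin B_P finite_subset by blast
  have "inj_on (\<lambda>b. \<beta> (y b)) B"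
  proof (rule inj_onI)
    fix b c assume bc: "b \<in> B" "c \<in> B" "\<beta> (y b) = \<beta> (y c)"
    have "y b \<in> cyc_supp x (y c)"
      using bc(3) beta_supp supp_sym supp_trans by metis
    then obtain r where "y b = (x ^^ r) (y c) \<or> y b = (x ^^ r) (y (- c))"
      unfolding supp_iff2 orbit_iff by (auto simp: y(2))
    then have "b = (x ^^ r) c \<or> b = (x ^^ r) (- c)"
      unfolding yx[symmetric] using permutes_inj[OF y(1)] by (metis injD)
    then have "b \<in> cyc_supp x c"
      unfolding supp_iff2 orbit_iff by blast
    then show "b = c"
      using beta_eq B_beta bc by metis
  qed
  moreover have "(\<lambda>b. \<beta> (y b)) ` B \<subseteq> B"
    using B_P yP by (auto simp: B_def)
  ultimately have bij: "bij_betw (\<lambda>b. \<beta> (y b)) B B"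
    using finB by (simp add: bij_betw_def endo_inj_surj)
  have "\<theta> (z \<circ> y) = (\<Prod>b\<in>B. \<phi> (z (\<beta> (y b))) * \<phi> (y b))"
    unfolding \<theta>_def
  proof (rule prod.cong)
    fix b assume b: "b \<in> B"
    then have yb: "y b \<in> P" using B_P yP by blast
    show "\<phi> ((z \<circ> y) b) = \<phi> (z (\<beta> (y b))) * \<phi> (y b)"
      using phi_ratio[OF z yb beta_supp] phi_beta[OF yb] by simp
  qed simp
  also have "\<dots> = (\<Prod>b\<in>B. \<phi> (z (\<beta> (y b)))) * \<theta> y"
    by (simp add: prod.distrib \<theta>_def)
  also have "(\<Prod>b\<in>B. \<phi> (z (\<beta> (y b)))) = \<theta> z"
    unfolding \<theta>_def by (rule prod.reindex_bij_betw[OF bij])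
  finally show ?thesis .
qed

lemma theta_single:
  assumes a: "a \<in> P" and z: "z permutes cyc_supp x a"
  shows "\<theta> z = \<phi> (z (\<beta> a))"
proof -
  have "\<phi> (z b) = 1" if "b \<in> B" "b \<noteq> \<beta> a" for b
  proof -
    have "b \<notin> cyc_supp x a"
      using that beta_eq B_beta by metis
    then show ?thesis
      using z that phi_B by (simp add: permutes_not_in)
  qed
  moreover have "\<beta> a \<in> B" "finite B"
    using a fin by (auto simp: B_def)
  ultimately show ?thesis
    unfolding \<theta>_def by (subst prod.remove[of _ "\<beta> a"]) auto
qed

lemma theta_faithful:
  assumes a: "a \<in> P"
    and z: "z \<in> centralizer (signed_perm_group (cyc_supp x a)) (perm_restrict x (cyc_supp x a))"
    and y: "y \<in> centralizer (signed_perm_group (cyc_supp x a)) (perm_restrict x (cyc_supp x a))"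
    and zb: "z (\<beta> a) \<in> orbit x (\<beta> a)" and yb: "y (\<beta> a) \<in> orbit x (\<beta> a)"
    and eq: "\<theta> z = \<theta> y"
  shows "z = y"
proof -
  let ?D = "cyc_supp x a" and ?b = "\<beta> a"
  have bP: "?b \<in> P" using beta_supp supp_P a by blast
  obtain r s where rs: "z ?b = (x ^^ r) ?b" "y ?b = (x ^^ s) ?b"
    using zb yb by (auto simp: orbit_iff)
  have "\<theta> z = \<zeta> ?b ^ r" "\<theta> y = \<zeta> ?b ^ s"
    using theta_single[OF a] z y rs phi_pow[OF bP] phi_beta[OF a]
    by (auto simp: mem_centralizer_iff)
  then have zy: "z ?b = y ?b"
    using eq rs zeta_pow_eq_iff by simp
  have D: "(x ^^ r) ?b \<in> ?D" for r
    by (metis beta_supp orbit_iff supp_iff supp_trans)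
  have *: "v ((x ^^ r) ?b) = (x ^^ r) (v ?b)"
    if v: "v \<in> centralizer (signed_perm_group ?D) (perm_restrict x ?D)" for v r
  proof (induction r)
    case (Suc r)
    have vp: "v permutes ?D" using v by (simp add: mem_centralizer_iff)
    have "v (perm_restrict x ?D ((x ^^ r) ?b)) = perm_restrict x ?D (v ((x ^^ r) ?b))"
      using v by (simp add: mem_centralizer_iff)
    then show ?case
      using Suc D[of r] permutes_in_image[OF vp, of "(x ^^ r) ?b"] by (simp add: perm_restrict_def)
  qed auto
  have "z d = y d" for d
  proof (cases "d \<in> ?D")
    case False
    have "z permutes ?D" "y permutes ?D"
      using z y unfolding mem_centralizer_iff by blast+
    then show ?thesis using False by (metis permutes_not_in)
  next
    case True
    then have "d \<in> cyc_supp x ?b"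
      using beta_supp supp_eq by blast
    then obtain r where "d = (x ^^ r) ?b \<or> d = - ((x ^^ r) ?b)"
      unfolding supp_iff2 orbit_iff by (auto simp: pow_neg)
    moreover have "z (- d) = - z d" "y (- d) = - y d" for d
      using z y by (auto simp: mem_centralizer_iff)
    ultimately show ?thesis
      using *[OF z] *[OF y] zy by auto
  qed
  then show ?thesis by blast
qed

lemma restrict_x_mem:
  "perm_restrict x (cyc_supp x a) \<in> carrier (signed_perm_group (cyc_supp x a))"
proof -
  let ?D = "cyc_supp x a"
  have neg: "- d \<in> ?D \<longleftrightarrow> d \<in> ?D" for d
    by (auto simp: supp_iff)
  have "x ` ?D \<subseteq> ?D"
    using supp_trans[OF x_supp] by (intro image_subsetI)
  moreover have "inj_on x ?D"
    using permutes_inj[OF x_perm] inj_on_subset by blast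
  moreover have "finite ?D"
    unfolding cyc_supp_def using permutation_self_in_orbit[OF perm]
    by (auto intro: finite_orbit)
  ultimately have "bij_betw x ?D ?D"
    by (simp add: bij_betw_def endo_inj_surj)
  then have "bij_betw (perm_restrict x ?D) ?D ?D"
    by (rule bij_betw_cong[THEN iffD1, rotated]) (simp add: perm_restrict_def)
  then have "perm_restrict x ?D permutes ?D"
    by (rule bij_imp_permutes) (simp add: perm_restrict_def)
  then show ?thesis
    by (auto simp: perm_restrict_def neg x_neg)
qed

lemma wreath_char_theta: "wreath_char \<epsilon> P x \<theta>"
proof -
  let ?Z = "centralizer (signed_perm_group P) x"
  have "linear_character (signed_perm_group P) ?Z \<theta>"
    unfolding linear_character_def
  proof (rule homI)
    fix z assume "z \<in> carrier (signed_perm_group P\<lparr>carrier := ?Z\<rparr>)"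
    have "finite B" using fin by (simp add: B_def)
    then show "\<theta> z \<in> carrier complex_units"
      by (simp add: complex_units_def \<theta>_def phi_nonzero)
  next
    fix z y
    assume "z \<in> carrier (signed_perm_group P\<lparr>carrier := ?Z\<rparr>)"
      and "y \<in> carrier (signed_perm_group P\<lparr>carrier := ?Z\<rparr>)"
    then show "\<theta> (z \<otimes>\<^bsub>signed_perm_group P\<lparr>carrier := ?Z\<rparr>\<^esub> y) = \<theta> z \<otimes>\<^bsub>complex_units\<^esub> \<theta> y"
      using theta_mult by (simp add: complex_units_def mem_centralizer_iff)
  qed
  moreover have "let D = cyc_supp x a; c = perm_restrict x D in
        if \<epsilon> = 1
        then \<theta> (perm_restrict uminus D) = 1 \<and> inj_on \<theta> (generate (signed_perm_group D) {c})
        else inj_on \<theta> (centralizer (signed_perm_group D) c)" if a: "a \<in> P" for a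
  proof -
    define D where "D = cyc_supp x a"
    define c where "c = perm_restrict x D"
    define b where "b = \<beta> a"
    let ?G = "signed_perm_group D"
    interpret G: group ?G by (rule group_signed_perm_group)
    have bD: "b \<in> D" unfolding b_def D_def by (rule beta_supp)
    have bP: "b \<in> P" using bD a supp_P by (simp add: D_def)
    have D_eq: "D = cyc_supp x b" using supp_eq[OF beta_supp] by (simp add: b_def D_def)
    have neg: "- d \<in> D \<longleftrightarrow> d \<in> D" for d
      by (auto simp: supp_iff D_def)
    have oD: "orbit x b \<subseteq> D" unfolding D_eq by (auto simp: cyc_supp_def)
    have c: "c \<in> carrier ?G"
      using restrict_x_mem by (simp add: c_def D_def)
    show ?thesis
    proof (cases "\<epsilon> = 1")
      case True
      have "bij_betw (perm_restrict uminus D) D D"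
        by (rule bij_betw_byWitness[of _ "perm_restrict uminus D"])
           (auto simp: perm_restrict_def neg)
      then have "perm_restrict uminus D permutes D"
        by (rule bij_imp_permutes) (simp add: perm_restrict_def)
      then have "\<theta> (perm_restrict uminus D) = \<phi> (- b)"
        using theta_single[OF a] bD by (simp add: D_def[symmetric] b_def perm_restrict_def)
      then have 1: "\<theta> (perm_restrict uminus D) = 1"
        using phi_uminus[OF bP True] phi_beta[OF a] by (simp add: b_def)
      have gen: "y \<in> centralizer ?G c \<and> y ` orbit x b \<subseteq> orbit x b" if "y \<in> generate ?G {c}" for y
        using that
      proof (induction rule: generate.induct)
        case one
        show ?case by (simp add: mem_centralizer_iff permutes_id permutes_id[unfolded id_def])
      next
        case (incl h)
        have "c ` orbit x b \<subseteq> orbit x b"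
          using oD by (auto simp: c_def perm_restrict_def intro: orbit.step)
        then show ?case using c incl by (auto simp: mem_centralizer_iff)
      next
        case (inv h)
        then have h: "h = c" by simp
        have i: "inv\<^bsub>?G\<^esub> c \<in> carrier ?G" using c by (rule G.inv_closed)
        have i1: "(inv\<^bsub>?G\<^esub> c) (c d) = d" and i2: "c ((inv\<^bsub>?G\<^esub> c) d) = d" for d
          using G.l_inv[OF c] G.r_inv[OF c] by (simp_all add: fun_eq_iff)
        have "(inv\<^bsub>?G\<^esub> c) o' \<in> orbit x b" if o': "o' \<in> orbit x b" for o'
        proof -
          define d where "d = (inv\<^bsub>?G\<^esub> c) o'"
          have cd: "c d = o'" using i2 by (simp add: d_def)
          have "d \<in> D"
            using i o' oD permutes_in_image[of "inv\<^bsub>?G\<^esub> c" D] by (auto simp: d_def)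
          then have "x d = o'"
            using cd by (simp add: c_def perm_restrict_def)
          then have "o' \<in> orbit x d" using orbit.base by metis
          then show ?thesis
            using orbit_sym orbit_trans o' by (metis d_def)
        qed
        then show ?case unfolding h using i i1 i2 by (auto simp: mem_centralizer_iff)
      next
        case (eng y1 y2)
        then show ?case by (auto simp: mem_centralizer_iff permutes_compose[unfolded comp_def] image_subset_iff)
      qed
      have "inj_on \<theta> (generate ?G {c})"
      proof (rule inj_onI)
        fix z y assume zy: "z \<in> generate ?G {c}" "y \<in> generate ?G {c}" "\<theta> z = \<theta> y"
        show "z = y"
          using theta_faithful[OF a, of z y] gen[OF zy(1)] gen[OF zy(2)] zy(3) orbit_refl[of b]
          unfolding c_def D_def b_def by blast
      qed
      then show ?thesis
        using True 1 by (simp add: D_def c_def Let_def)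
    next
      case False
      then have "- b \<in> orbit x b" using class_cases[OF bP] by auto
      then have "orbit x (- b) = orbit x b" by (rule orbit_eq)
      then have "D \<subseteq> orbit x b"
        unfolding D_eq supp_iff2 subset_iff by simp
      have "inj_on \<theta> (centralizer ?G c)"
      proof (rule inj_onI)
        fix z y assume zy: "z \<in> centralizer ?G c" "y \<in> centralizer ?G c" "\<theta> z = \<theta> y"
        then have "z b \<in> D" "y b \<in> D"
          using bD by (auto simp: mem_centralizer_iff permutes_in_image)
        then show "z = y"
          using theta_faithful[OF a, of z y] zy \<open>D \<subseteq> orbit x b\<close>
          unfolding c_def D_def b_def by blast
      qed
      then show ?thesis
        using False by (simp add: D_def c_def Let_def)
    qed
  qed
  moreover have "\<exists>!b. b \<in> B \<inter> cyc_supp x a" if "a \<in> P" for a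
  proof (rule ex1I[of _ "\<beta> a"])
    show "\<beta> a \<in> B \<inter> cyc_supp x a" using that beta_supp by (simp add: B_def)
    show "b = \<beta> a" if "b \<in> B \<inter> cyc_supp x a" for b
      using that B_beta beta_eq by (metis IntE)
  qed
  moreover have "\<theta> z = 1" if "z ` B = B" for z
    unfolding \<theta>_def using that phi_B by (intro prod.neutral) blast
  ultimately show ?thesis
    unfolding wreath_char_def using B_P by (intro conjI ballI exI[of _ B]) simp_all
qed

end

lemma cyc_cong:
  assumes "orbit v a = orbit w b"
  shows "cyc_class v a = cyc_class w b" "cyc_length v a = cyc_length w b"
  using assms by (simp_all add: cyc_class_def cyc_length_def)

lemma wreath_char_exists:
  assumes x: "x \<in> carrier (hyperoctahedral_group n)"
  shows "\<exists>\<theta>. wreath_char \<epsilon> (cyc_part n x i \<epsilon>) (perm_restrict x (cyc_part n x i \<epsilon>)) \<theta>"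
proof -
  let ?S = "{- int n..int n} - {0}" and ?P = "cyc_part n x i \<epsilon>"
  let ?y = "perm_restrict x ?P"
  have xS: "x permutes ?S" and neg: "\<And>a. x (- a) = - x a"
    using x by (auto simp: hyperoctahedral_group_def)
  have perm: "permutation x"
    using xS permutation_permutes by blast
  have on: "orbit x (- a) = uminus ` orbit x a" for a
  proof -
    have "(x ^^ r) (- a) = - (x ^^ r) a" for r
      by (induction r) (auto simp: neg)
    then show ?thesis
      by (force simp: orbit_altdef image_iff)
  qed
  have ox: "orbit x (x a) = orbit x a" for a
    by (rule permutation_orbit_step[OF perm])
  have inv: "cyc_class x (- a) = cyc_class x a" "cyc_length x (- a) = cyc_length x a" for a
  proof -
    have "uminus ` uminus ` orbit x a = uminus ` orbit x a \<longleftrightarrow> uminus ` orbit x a = orbit x a"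
      by (auto simp: image_image)
    moreover have "card (uminus ` orbit x a) = card (orbit x a)"
      by (rule card_image) simp
    ultimately show "cyc_class x (- a) = cyc_class x a" "cyc_length x (- a) = cyc_length x a"
      by (simp_all add: cyc_class_def cyc_length_def on)
  qed
  have nP: "- a \<in> ?P" if "a \<in> ?P" for a
    using that inv[of a] by (auto simp: cyc_part_def)
  have xP: "x a \<in> ?P" if "a \<in> ?P" for a
    using that cyc_cong[OF ox[of a]] permutes_in_image[OF xS, of a] unfolding cyc_part_def by simp
  have finP: "finite ?P"
    by (rule finite_subset[of _ ?S]) (auto simp: cyc_part_def)
  have "x ` ?P = ?P"
    using endo_inj_surj[OF finP] xP permutes_inj[OF xS] inj_on_subset by blast
  then have "bij_betw x ?P ?P"
    using inj_on_subset[OF permutes_inj[OF xS] subset_UNIV] by (simp add: bij_betw_def)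
  then have "bij_betw ?y ?P ?P"
    by (rule bij_betw_cong[THEN iffD1, rotated]) (simp add: perm_restrict_def)
  then have yP: "?y permutes ?P"
    by (rule bij_imp_permutes) (simp add: perm_restrict_def)
  have yn: "?y (- a) = - ?y a" for a
    using nP[of a] nP[of "- a"] by (auto simp: perm_restrict_def neg)
  have "cyc_class ?y a = \<epsilon>" if a: "a \<in> ?P" for a
  proof -
    have *: "(?y ^^ r) a = (x ^^ r) a \<and> (x ^^ r) a \<in> ?P" for r
      by (induction r) (use a xP in \<open>auto simp: perm_restrict_def\<close>)
    then have "orbit ?y a = orbit x a"
      by (simp add: orbit_altdef)
    then have "cyc_class ?y a = cyc_class x a" by (rule cyc_cong)
    then show ?thesis using a by (simp add: cyc_part_def)
  qed
  then show ?thesis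
    using uniform_signed_perm.wreath_char_theta[OF uniform_signed_perm.intro[OF finP yP yn nP]] by blast
qed

lemma omega_char_exists:
  assumes x: "x \<in> carrier (hyperoctahedral_group n)"
  shows "\<exists>\<omega>. omega_char n x \<omega>"
proof -
  have "\<exists>\<theta>. \<forall>i \<epsilon>.
      wreath_char \<epsilon> (cyc_part n x i \<epsilon>) (perm_restrict x (cyc_part n x i \<epsilon>)) (\<theta> i \<epsilon>)"
    by (rule choice, rule allI, rule choice, rule allI) (rule wreath_char_exists[OF x])
  then obtain \<theta> where \<theta>: "\<forall>i \<epsilon>.
      wreath_char \<epsilon> (cyc_part n x i \<epsilon>) (perm_restrict x (cyc_part n x i \<epsilon>)) (\<theta> i \<epsilon>)" ..
  show ?thesis
    unfolding omega_char_def
  proof (rule exI, rule exI[of _ \<theta>], rule conjI)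
    show "\<forall>z\<in>centralizer (hyperoctahedral_group n) x.
        (\<lambda>z. \<Prod>i\<in>{1..n}. \<Prod>\<epsilon>\<in>{1, -1}. \<theta> i \<epsilon> (perm_restrict z (cyc_part n x i \<epsilon>))) z =
        (\<Prod>i\<in>{1..n}. \<Prod>\<epsilon>\<in>{1, -1}. \<theta> i \<epsilon> (perm_restrict z (cyc_part n x i \<epsilon>)))"
      by simp
  qed (use \<theta> in simp)
qed

theorem higher_lie_char_exists:
  assumes "C \<in> conj_classes (hyperoctahedral_group n)"
  shows "\<exists>\<psi>. higher_lie_char n C \<psi>"
proof -
  let ?G = "hyperoctahedral_group n"
  interpret group ?G
    unfolding hyperoctahedral_group_def by (rule group_signed_perm_group)
  obtain x where x: "x \<in> carrier ?G" "C = conj_class ?G x"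
    using assms by (auto simp: conj_classes_def)
  have xC: "x \<in> C"
    unfolding x(2) conj_class_def using x(1) by (intro image_eqI[of _ _ "\<one>\<^bsub>?G\<^esub>"]) auto
  obtain \<omega> where "omega_char n x \<omega>"
    using omega_char_exists[OF x(1)] ..
  then show ?thesis
    unfolding higher_lie_char_def using xC
    by (intro exI[of _ "induced_char ?G (centralizer ?G x) \<omega>"] bexI[of _ x] exI[of _ \<omega>]) simp
qed

end

theory Submission
  imports Defs "HOL-Number_Theory.Cong" "HOL-Algebra.Multiplicative_Group"
begin

text \<open>
  Grouping the terms of the induced characters, the right-hand side becomes a sum of
  $\omega^y(g)$ over all $y$ commuting with $g$ with $y^k = 1$. Such a value is a product over the
  orbits of $\langle y, g, -1\rangle$: if $g^s$ is the first power of $g$ returning a point $a$ to its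
  signed cycle under $y$ and $g^s a = \pm y^j a$, then the orbit of $a$ contributes the $j$-th power
  of the chosen root of unity. Elements $h$ with $h^k = g$ also commute with $g$, so both sides are
  sums over the centralizer of $g$ of a product over orbits.

  The orbitwise factors need not agree for a single $y$, but they agree on average when $y$ is
  multiplied by the powers of one cycle of $g$ inside the orbit. This averaged statement concerns a
  cyclic group of order $M$ and reduces to the fact that the $d$-th roots of unity sum to $0$
  unless $d = 1$, with $d = \gcd(M, q)$ for a quotient $q$ of $k$.
\<close>


text \<open>The factor of an orbit is read off from the cycles of \<open>y\<close>, whereas twisting
  by a cycle of \<open>g\<close> controls the opposite data: if \<open>y^r\<close> is the first
  power bringing \<open>a\<close> back to its signed cycle under \<open>g\<close>, and it maps
  \<open>a\<close> to \<open>g^i a\<close> up to sign, then the twists let \<open>i\<close> run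
  through all residues modulo the period \<open>M\<close> of \<open>a\<close> under
  \<open>g\<close>. Changing sides inverts \<open>i\<close>: the factor is a primitive root of unity
  of order \<open>M / gcd(i, M)\<close> raised to some \<open>l\<close> with \<open>i * l\<close>
  congruent to \<open>gcd(i, M)\<close> modulo \<open>M\<close>. The obstacle is the sign. It is
  invisible on a cycle of class +1 and part of the exponent on a cycle of class -1, and periods and
  return times change by factors of 2 according to whether \<open>-a\<close> is reached by
  \<open>g\<close> or by \<open>y\<close>. All these cases end in the same shape and differ only in
  which primitive root occurs. The averaging tolerates this because, during one average, the
  primitive root depends only on its order. The freedom in the faithful characters is moved into the
  group: \<open>x\<close> is replaced by a conjugate with the same centralizer at which the values
  are standard, so that a single function of commuting pairs, invariant under conjugation, describes
  all classes.\<close>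

inductive_set reach :: "('a \<Rightarrow> 'a) set \<Rightarrow> 'a \<Rightarrow> 'a set" for F a where
  base: "a \<in> reach F a"
| step: "b \<in> reach F a \<Longrightarrow> f \<in> F \<Longrightarrow> f b \<in> reach F a"

lemma reach_trans: "c \<in> reach F b \<Longrightarrow> b \<in> reach F a \<Longrightarrow> c \<in> reach F a"
  by (induction rule: reach.induct) (auto intro: reach.step)

lemma reach_subset:
  assumes "\<And>f. f \<in> F \<Longrightarrow> f ` S \<subseteq> S" "a \<in> S"
  shows "reach F a \<subseteq> S"
proof
  fix b assume "b \<in> reach F a"
  then show "b \<in> S" by induction (use assms in auto)
qed

text \<open>Inverses are not among the steps; finiteness supplies them. An injective map of the
  finite set \<open>reach F (f b)\<close> into itself is onto, so \<open>f b\<close> has a preimage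
  in this set, and that preimage can only be \<open>b\<close>.\<close>

lemma reach_sym:
  assumes S: "finite S" "\<And>f. f \<in> F \<Longrightarrow> f ` S \<subseteq> S" "\<And>f. f \<in> F \<Longrightarrow> inj_on f S"
    and a: "a \<in> S" and b: "b \<in> reach F a"
  shows "a \<in> reach F b"
  using b
proof induction
  case base
  show ?case by (rule reach.base)
next
  case (step b f)
  let ?R = "reach F (f b)"
  have b: "b \<in> S" using reach_subset[OF S(2) a] step by blast
  then have R: "?R \<subseteq> S" using S(2)[OF step(2)] by (intro reach_subset[OF S(2)]) auto
  then have "f ` ?R = ?R"
    using step(2) S finite_subset[OF R]
    by (intro endo_inj_surj) (auto intro: reach.step inj_on_subset[OF _ R])
  then obtain c where "c \<in> ?R" "f c = f b"
    using reach.base[of "f b" F] by (metis imageE)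
  then have "b \<in> ?R" using S(3)[OF step(2)] R b by (metis inj_onD subsetD)
  then show ?case using step.IH reach_trans by metis
qed

lemma reach_mono:
  assumes "\<And>f b. f \<in> F \<Longrightarrow> b \<in> S \<Longrightarrow> f b \<in> reach F' b" "\<And>f. f \<in> F' \<Longrightarrow> f ` S \<subseteq> S" "a \<in> S"
  shows "reach F a \<subseteq> reach F' a"
proof
  fix b assume "b \<in> reach F a"
  then show "b \<in> reach F' a"
  proof induction
    case (step b f)
    then show ?case using assms(1)[OF step(2)] reach_subset[OF assms(2,3)] reach_trans by fast
  qed (rule reach.base)
qed

lemma reach_funpow: "f \<in> F \<Longrightarrow> (f ^^ i) a \<in> reach F a"
  by (induction i) (auto intro: reach.intros)

lemma funpow_commute:
  assumes "\<And>a. z (x a) = x (z a)"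
  shows "(z ^^ i) ((x ^^ j) a) = (x ^^ j) ((z ^^ i) a)"
proof -
  have *: "z ((x ^^ j) a) = (x ^^ j) (z a)" for j a
    by (induction j) (auto simp: assms)
  show ?thesis by (induction i) (auto simp: *)
qed

lemma funpow_intertwine:
  assumes "\<And>a. t (x a) = y (t a)"
  shows "t ((x ^^ j) a) = (y ^^ j) (t a)"
  by (induction j) (auto simp: assms)

section \<open>Signed permutations of a symmetric set\<close>

locale signed_set =
  fixes S :: "int set"
  assumes fin: "finite S" and neg: "\<And>a. a \<in> S \<Longrightarrow> - a \<in> S" and nz: "0 \<notin> S"
begin

abbreviation "G \<equiv> signed_perm_group S"
abbreviation pinv :: "(int \<Rightarrow> int) \<Rightarrow> int \<Rightarrow> int" where "pinv \<equiv> inv_into UNIV"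
abbreviation "Z \<equiv> centralizer (signed_perm_group S)"

sublocale G: group G
  by (rule group_signed_perm_group)

definition "signed_perm w \<longleftrightarrow> w permutes S \<and> (\<forall>a. w (- a) = - w a)"

lemma carrier_G: "carrier G = Collect signed_perm"
  by (auto simp: signed_perm_def)

lemma Z_iff: "z \<in> Z x \<longleftrightarrow> signed_perm z \<and> (\<forall>a. z (x a) = x (z a))"
  by (auto simp: mem_centralizer_iff signed_perm_def)

lemma neg_iff: "- a \<in> S \<longleftrightarrow> a \<in> S"
  using neg[of a] neg[of "- a"] by auto

lemma neq_neg: "a \<in> S \<Longrightarrow> a \<noteq> - a"
  using nz by auto

lemma sp_neg: "signed_perm w \<Longrightarrow> w (- a) = - w a"
  by (simp add: signed_perm_def)

lemma sp_permutes: "signed_perm w \<Longrightarrow> w permutes S"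
  by (simp add: signed_perm_def)

lemma sp_in: "signed_perm w \<Longrightarrow> w a \<in> S \<longleftrightarrow> a \<in> S"
  using permutes_in_image by (fastforce simp: signed_perm_def)

lemma sp_inj: "signed_perm w \<Longrightarrow> w a = w b \<longleftrightarrow> a = b"
  using permutes_inj by (fastforce simp: signed_perm_def dest: injD)

lemma sp_perm: "signed_perm w \<Longrightarrow> permutation w"
  using fin permutation_permutes by (fastforce simp: signed_perm_def)

lemma sp_comp: "signed_perm v \<Longrightarrow> signed_perm w \<Longrightarrow> signed_perm (v \<circ> w)"
  by (simp add: signed_perm_def permutes_compose)

lemma sp_id: "signed_perm id"
  by (simp add: signed_perm_def permutes_id)

lemma sp_pow: "signed_perm w \<Longrightarrow> signed_perm (w ^^ i)"
proof (induction i)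
  case 0 show ?case unfolding funpow.simps(1) by (rule sp_id)
next
  case (Suc i) then show ?case unfolding funpow.simps(2) by (intro sp_comp)
qed

lemma sp_pow_neg: "signed_perm w \<Longrightarrow> (w ^^ i) (- a) = - (w ^^ i) a"
  by (rule sp_neg[OF sp_pow])

lemma finite_sp: "finite (Collect signed_perm)"
  by (rule finite_subset[OF _ finite_permutations[OF fin]]) (auto simp: signed_perm_def)

lemma finite_Z: "finite (Z x)"
  by (rule finite_subset[OF _ finite_sp]) (auto simp: Z_iff)

lemma sp_intro:
  assumes "\<And>a. a \<in> S \<Longrightarrow> w a \<in> S" "\<And>a b. a \<in> S \<Longrightarrow> b \<in> S \<Longrightarrow> w a = w b \<Longrightarrow> a = b"
    "\<And>a. a \<notin> S \<Longrightarrow> w a = a" "\<And>a. a \<in> S \<Longrightarrow> w (- a) = - w a"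
  shows "signed_perm w"
proof -
  have "inj_on w S" by (rule inj_onI) (use assms(2) in blast)
  moreover have "w ` S \<subseteq> S" using assms(1) by blast
  ultimately have "bij_betw w S S" using endo_inj_surj[OF fin] by (simp add: bij_betw_def)
  then have "w permutes S" using assms(3) by (rule bij_imp_permutes)
  moreover have "w (- a) = - w a" for a
    using assms(3)[of a] assms(3)[of "- a"] assms(4)[of a] neg_iff[of a] by (cases "a \<in> S") auto
  ultimately show ?thesis by (simp add: signed_perm_def)
qed

lemma sp_inv: 
  assumes "signed_perm w" 
  shows "signed_perm (pinv w)" "pinv w (w a) = a" "w (pinv w a) = a"
proof -
  have b: "bij w" using assms permutes_bij by (auto simp: signed_perm_def)
  show 1: "pinv w (w a) = a" "w (pinv w a) = a" for a
    using b by (simp_all add: bij_is_inj bij_is_surj surj_f_inv_f)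
  have "pinv w (- a) = - pinv w a" for a
    using sp_neg[OF assms, of "pinv w a"] 1 by metis
  then show "signed_perm (pinv w)" using assms permutes_inv by (auto simp: signed_perm_def)
qed

lemma Z_comp: "v \<in> Z x \<Longrightarrow> w \<in> Z x \<Longrightarrow> v \<circ> w \<in> Z x"
  by (auto simp: Z_iff sp_comp)

lemma Z_pow: "v \<in> Z x \<Longrightarrow> v ^^ i \<in> Z x"
  using funpow_commute[of v x i 1] by (auto simp: Z_iff sp_pow)

lemma Z_inv: 
  assumes "v \<in> Z x" shows "pinv v \<in> Z x"
proof -
  have v: "signed_perm v" "v (x a) = x (v a)" for a using assms by (auto simp: Z_iff)
  have "pinv v (x a) = x (pinv v a)" for a
    using v(2)[of "pinv v a"] sp_inv[OF v(1)] by metis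
  then show ?thesis using sp_inv(1)[OF v(1)] by (simp add: Z_iff)
qed

lemma Z_self: "signed_perm x \<Longrightarrow> x \<in> Z x"
  by (simp add: Z_iff)

lemma Z_sym: "signed_perm x \<Longrightarrow> z \<in> Z x \<Longrightarrow> x \<in> Z z"
  by (simp add: Z_iff)

lemma lp_dvd: "signed_perm x \<Longrightarrow> (x ^^ n) a = a \<longleftrightarrow> least_power x a dvd n"
  using least_power_dvd sp_perm by metis

lemma lp_pos: "signed_perm x \<Longrightarrow> least_power x a > 0"
  by (rule least_power_of_permutation(2)[OF sp_perm])

lemma pow_eq_iff:
  assumes "signed_perm x"
  shows "(x ^^ i) a = (x ^^ j) a \<longleftrightarrow> i mod least_power x a = j mod least_power x a"
proof -
  have *: "(x ^^ r) a = (x ^^ s) a \<longleftrightarrow> r mod least_power x a = s mod least_power x a" if "r \<le> s" for r s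
  proof -
    have "(x ^^ s) a = (x ^^ r) ((x ^^ (s - r)) a)"
      using that by (metis funpow_add le_add_diff_inverse o_apply)
    then have "(x ^^ r) a = (x ^^ s) a \<longleftrightarrow> (x ^^ (s - r)) a = a"
      using sp_inj[OF sp_pow[OF assms]] by metis
    then show ?thesis
      using that by (metis lp_dvd[OF assms] mod_eq_dvd_iff_nat)
  qed
  show ?thesis using *[of i j] *[of j i] by (metis nat_le_linear)
qed

lemma orbit_iff: "signed_perm x \<Longrightarrow> b \<in> orbit x a \<longleftrightarrow> (\<exists>i. b = (x ^^ i) a)"
  by (auto simp: orbit_altdef_permutation[OF sp_perm])

lemma orbit_uminus: "signed_perm x \<Longrightarrow> uminus ` orbit x a = orbit x (- a)"
  by (force simp: orbit_iff sp_pow_neg image_iff)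

lemma supp_iff: "signed_perm x \<Longrightarrow> b \<in> cyc_supp x a \<longleftrightarrow> (\<exists>i. b = (x ^^ i) a \<or> b = - (x ^^ i) a)"
  by (force simp: cyc_supp_def orbit_iff image_iff)

lemma supp_reach: "signed_perm x \<Longrightarrow> cyc_supp x a = reach {x, uminus} a"
proof (intro equalityI subsetI)
  fix b assume x: "signed_perm x" and "b \<in> cyc_supp x a"
  then obtain i where "b = (x ^^ i) a \<or> b = - (x ^^ i) a" by (auto simp: supp_iff)
  then show "b \<in> reach {x, uminus} a"
    using reach_funpow[of x "{x, uminus}" i a] reach.step[of _ "{x, uminus}" a uminus] by auto
next
  fix b assume x: "signed_perm x" and "b \<in> reach {x, uminus} a"
  from this(2) show "b \<in> cyc_supp x a"
  proof induction
    case base show ?case using x by (auto simp: supp_iff intro!: exI[of _ 0])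
  next
    case (step b f)
    then obtain i where "b = (x ^^ i) a \<or> b = - (x ^^ i) a" using x by (auto simp: supp_iff)
    then have "x b = (x ^^ Suc i) a \<or> x b = - (x ^^ Suc i) a"
      "- b = (x ^^ i) a \<or> - b = - (x ^^ i) a"
      using sp_neg[OF x] by auto
    then show ?case using step(2) x unfolding supp_iff[OF x] by blast
  qed
qed

lemma gens_S: "\<lbrakk>f \<in> {x, g, uminus}; signed_perm x; signed_perm g\<rbrakk> \<Longrightarrow> f ` S \<subseteq> S"
  "\<lbrakk>f \<in> {x, g, uminus}; signed_perm x; signed_perm g\<rbrakk> \<Longrightarrow> inj_on f S"
  using sp_in neg sp_inj by (auto simp: inj_on_def)

section \<open>Orbits of the group generated by two signed permutations and negation\<close>

definition block :: "(int \<Rightarrow> int) \<Rightarrow> (int \<Rightarrow> int) \<Rightarrow> int \<Rightarrow> int set" where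
  "block x g a = reach {x, g, uminus} a"

lemma block_refl: "a \<in> block x g a"
  by (simp add: block_def reach.base)

lemma block_trans: "c \<in> block x g b \<Longrightarrow> b \<in> block x g a \<Longrightarrow> c \<in> block x g a"
  unfolding block_def by (rule reach_trans)

lemma block_subset: "signed_perm x \<Longrightarrow> signed_perm g \<Longrightarrow> a \<in> S \<Longrightarrow> block x g a \<subseteq> S"
  unfolding block_def by (rule reach_subset) (rule gens_S)

lemma block_sym: "signed_perm x \<Longrightarrow> signed_perm g \<Longrightarrow> a \<in> S \<Longrightarrow> b \<in> block x g a \<Longrightarrow> a \<in> block x g b"
  unfolding block_def by (rule reach_sym[OF fin]) (use gens_S in blast)+

lemma block_eq: "signed_perm x \<Longrightarrow> signed_perm g \<Longrightarrow> a \<in> S \<Longrightarrow> b \<in> block x g a \<Longrightarrow> block x g b = block x g a"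
  using block_sym block_trans by blast

lemma block_step: "b \<in> block x g a \<Longrightarrow> x b \<in> block x g a" "b \<in> block x g a \<Longrightarrow> g b \<in> block x g a"
  "b \<in> block x g a \<Longrightarrow> - b \<in> block x g a"
  unfolding block_def using reach.step[of b "{x, g, uminus}" a] by auto

lemma block_pow: "b \<in> block x g a \<Longrightarrow> (x ^^ i) b \<in> block x g a" "b \<in> block x g a \<Longrightarrow> (g ^^ i) b \<in> block x g a"
  by (induction i) (auto intro: block_step)

lemma supp_eq_block: "signed_perm x \<Longrightarrow> cyc_supp x a = block x x a"
  by (simp add: supp_reach block_def)

lemma supp_refl: "signed_perm x \<Longrightarrow> a \<in> cyc_supp x a"
  by (simp add: supp_eq_block block_refl)

lemma supp_sym: "signed_perm x \<Longrightarrow> a \<in> S \<Longrightarrow> b \<in> cyc_supp x a \<Longrightarrow> a \<in> cyc_supp x b"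
  using block_sym by (simp add: supp_eq_block)

lemma supp_trans: "signed_perm x \<Longrightarrow> c \<in> cyc_supp x b \<Longrightarrow> b \<in> cyc_supp x a \<Longrightarrow> c \<in> cyc_supp x a"
  using block_trans by (simp add: supp_eq_block)

lemma supp_eq: "signed_perm x \<Longrightarrow> a \<in> S \<Longrightarrow> b \<in> cyc_supp x a \<Longrightarrow> cyc_supp x b = cyc_supp x a"
  using block_eq by (simp add: supp_eq_block)

lemma supp_subset: "signed_perm x \<Longrightarrow> a \<in> S \<Longrightarrow> cyc_supp x a \<subseteq> S"
  using block_subset by (simp add: supp_eq_block)

lemma supp_step: "signed_perm x \<Longrightarrow> b \<in> cyc_supp x a \<Longrightarrow> x b \<in> cyc_supp x a"
  "signed_perm x \<Longrightarrow> b \<in> cyc_supp x a \<Longrightarrow> - b \<in> cyc_supp x a"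
  using block_step by (simp_all add: supp_eq_block)

lemma supp_pow: "signed_perm x \<Longrightarrow> b \<in> cyc_supp x a \<Longrightarrow> (x ^^ i) b \<in> cyc_supp x a"
  using block_pow by (simp add: supp_eq_block)

lemma supp_intertwine:
  assumes "signed_perm x" "signed_perm y" "\<And>a. t (x a) = y (t a)" "\<And>a. t (- a) = - t a" "b \<in> cyc_supp x a"
  shows "t b \<in> cyc_supp y (t a)"
proof -
  obtain i where "b = (x ^^ i) a \<or> b = - (x ^^ i) a" using assms(1,5) by (auto simp: supp_iff)
  then have "t b = (y ^^ i) (t a) \<or> t b = - (y ^^ i) (t a)"
    using funpow_intertwine[of t x y, OF assms(3)] assms(4) by metis
  then show ?thesis using assms(2) by (auto simp: supp_iff)
qed

lemma supp_Z: 
  assumes "signed_perm x" "z \<in> Z x"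
  shows "z b \<in> cyc_supp x (z a) \<longleftrightarrow> b \<in> cyc_supp x a"
proof
  show "b \<in> cyc_supp x a \<Longrightarrow> z b \<in> cyc_supp x (z a)"
    by (rule supp_intertwine[of x x z]) (use assms in \<open>auto simp: Z_iff sp_neg\<close>)
  have i: "pinv z \<in> Z x" and z: "signed_perm z" using Z_inv assms by (auto simp: Z_iff)
  have "pinv z (z b) \<in> cyc_supp x (pinv z (z a))" if "z b \<in> cyc_supp x (z a)"
    by (rule supp_intertwine[of x x "pinv z"]) (use i assms that in \<open>auto simp: Z_iff sp_neg\<close>)
  then show "z b \<in> cyc_supp x (z a) \<Longrightarrow> b \<in> cyc_supp x a" using sp_inv(2)[OF z] by metis
qed

text \<open>Commutation and oddness allow every word in the three kinds of steps to be sorted into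
  this normal form.\<close>

lemma block_explicit:
  assumes "signed_perm x" "signed_perm g" "g \<in> Z x" "b \<in> block x g a"
  shows "\<exists>i j. b = (x ^^ i) ((g ^^ j) a) \<or> b = - (x ^^ i) ((g ^^ j) a)"
  using assms(4) unfolding block_def
proof induction
  case base
  show ?case by (intro exI[of _ 0]) simp
next
  case (step b f)
  obtain i j where "b = (x ^^ i) ((g ^^ j) a) \<or> b = - (x ^^ i) ((g ^^ j) a)"
    using step.IH by blast
  moreover have "g ((x ^^ i) ((g ^^ j) a)) = (x ^^ i) ((g ^^ Suc j) a)"
    using funpow_commute[of g x 1 i] assms(3) by (simp add: Z_iff)
  ultimately have "x b = (x ^^ Suc i) ((g ^^ j) a) \<or> x b = - (x ^^ Suc i) ((g ^^ j) a)"
    "g b = (x ^^ i) ((g ^^ Suc j) a) \<or> g b = - (x ^^ i) ((g ^^ Suc j) a)"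
    "- b = (x ^^ i) ((g ^^ j) a) \<or> - b = - (x ^^ i) ((g ^^ j) a)"
    using sp_neg[OF assms(1)] sp_neg[OF assms(2)] by auto
  then show ?case using step(2) by blast
qed

end

text \<open>
  In the following definitions $p_i = x^i a$ and $q_i = z^i a$ for commuting $x$ and $z$. Working
  with the two sequences makes it evident that the value depends only on the orbit of $a$ and is
  invariant under conjugation.
\<close>

definition period :: "(nat \<Rightarrow> int) \<Rightarrow> nat" where
  "period p = (LEAST n. p n = p 0 \<and> n > 0)"

definition return_time :: "(nat \<Rightarrow> int) \<Rightarrow> (nat \<Rightarrow> int) \<Rightarrow> nat" where
  "return_time p q = (LEAST s. s > 0 \<and> (\<exists>i. q s = p i \<or> q s = - p i))"

text \<open>
  A minus sign is ignored only for a cycle of class $+1$, where the character is trivial on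
  $w_0$; for class $-1$ it is absorbed in the exponent.
\<close>

definition shift_of :: "(nat \<Rightarrow> int) \<Rightarrow> (nat \<Rightarrow> int) \<Rightarrow> nat" where
  "shift_of p q = (SOME j. q (return_time p q) = p j \<or>
     q (return_time p q) = - p j \<and> (\<forall>i. p i \<noteq> - p 0))"

definition cycle_value :: "(nat \<Rightarrow> int) \<Rightarrow> (nat \<Rightarrow> int) \<Rightarrow> complex" where
  "cycle_value p q = cis (2 * pi / real (period p)) ^ shift_of p q"

text \<open>All ingredients of the value are defined through equalities, up to sign, between terms
  of the two sequences. An injective odd map preserves and reflects every one of them.\<close>

lemma cycle_value_transport:
  assumes "inj t" "\<And>a. t (- a) = - t a"
  shows "cycle_value (\<lambda>i. t (p i)) (\<lambda>i. t (q i)) = cycle_value p q"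
proof -
  have "t a = t b \<longleftrightarrow> a = b" "t a = - t b \<longleftrightarrow> a = - b" for a b
    using assms by (metis injD)+
  then show ?thesis by (simp add: cycle_value_def period_def return_time_def shift_of_def)
qed

context signed_set
begin

abbreviation "Cval x z a \<equiv> cycle_value (\<lambda>i. (x ^^ i) a) (\<lambda>i. (z ^^ i) a)"

text \<open>One representative of each orbit. Taking minima makes the selection depend on the blocks
  alone, so modifications of \<open>x\<close> that preserve the blocks preserve the index set of the
  product.\<close>

definition "mins x z = {a \<in> S. a = Min (block x z a)}"

definition "Omega x z = (\<Prod>a\<in>mins x z. Cval x z a)"

lemma period_lp: "period (\<lambda>i. (x ^^ i) a) = least_power x a"
  by (simp add: period_def least_power_def)

lemma Cval_intertwine:
  assumes "inj t" "\<And>a. t (- a) = - t a" "\<And>a. t (x a) = y (t a)" "\<And>a. t (z a) = w (t a)"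
  shows "Cval y w (t a) = Cval x z a"
  using cycle_value_transport[OF assms(1,2), of "\<lambda>i. (x ^^ i) a" "\<lambda>i. (z ^^ i) a"]
    funpow_intertwine[of t x y, OF assms(3)] funpow_intertwine[of t z w, OF assms(4)]
  by simp

text \<open>\<open>x\<close>, \<open>z\<close> and negation commute with one another, so each step
  inside a block is an injective odd map that intertwines the pair \<open>x\<close>,
  \<open>z\<close> with itself. Hence \<open>Omega\<close> does not depend on the
  representatives.\<close>

lemma Cval_block:
  assumes "signed_perm x" "z \<in> Z x" "b \<in> block x z a"
  shows "Cval x z b = Cval x z a"
  using assms(3) unfolding block_def
proof induction
  case (step b f)
  have z: "signed_perm z" "\<And>a. z (x a) = x (z a)" using assms(2) by (auto simp: Z_iff)
  have i: "inj x" "inj z" using sp_inj[OF assms(1)] sp_inj[OF z(1)] by (auto simp: inj_def)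
  note n = sp_neg[OF assms(1)] sp_neg[OF z(1)]
  have "Cval x z (f b) = Cval x z b"
    by (rule Cval_intertwine[of f x x z z b]) (use step(2) i z n in auto)
  then show ?case using step by simp
qed simp

lemma Cval_spec:
  assumes x: "signed_perm x" and z: "z \<in> Z x"
  obtains s j where "s > 0" "\<And>s'. s' > 0 \<Longrightarrow> (z ^^ s') a \<in> cyc_supp x a \<Longrightarrow> s \<le> s'"
    "(z ^^ s) a \<in> cyc_supp x a"
    "(z ^^ s) a = (x ^^ j) a \<or> (z ^^ s) a = - (x ^^ j) a \<and> (\<forall>i. (x ^^ i) a \<noteq> - a)"
    "Cval x z a = cis (2 * pi / real (least_power x a)) ^ j"
    "s = return_time (\<lambda>i. (x ^^ i) a) (\<lambda>i. (z ^^ i) a)"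
    "j = shift_of (\<lambda>i. (x ^^ i) a) (\<lambda>i. (z ^^ i) a)"
proof -
  define p where "p = (\<lambda>i. (x ^^ i) a)"
  define q where "q = (\<lambda>i. (z ^^ i) a)"
  define s where "s = return_time p q"
  define j where "j = shift_of p q"
  have zs: "signed_perm z" using z by (simp add: Z_iff)
  let ?P = "\<lambda>s. s > 0 \<and> (\<exists>i. q s = p i \<or> q s = - p i)"
  have P: "?P s \<longleftrightarrow> s > 0 \<and> (z ^^ s) a \<in> cyc_supp x a" for s
    using x by (simp add: supp_iff p_def q_def)
  have "?P (least_power z a)"
    unfolding P using lp_pos[OF zs] lp_dvd[OF zs, of "least_power z a" a] supp_refl[OF x] by simp
  then have s: "?P s" unfolding s_def return_time_def by (rule LeastI)
  have le: "s \<le> s'" if "?P s'" for s' unfolding s_def return_time_def using that by (rule Least_le)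
  have "\<exists>j. q s = p j \<or> q s = - p j \<and> (\<forall>i. p i \<noteq> - p 0)"
  proof (cases "\<forall>i. p i \<noteq> - p 0")
    case True then show ?thesis using s by blast
  next
    case False
    then obtain h where h: "p h = - p 0" by blast
    \<comment> \<open>Once \<open>-a\<close> occurs in the cycle of \<open>a\<close>, a minus sign
      is a shift by \<open>h\<close>; the strict alternative in \<open>shift_of\<close> can
      therefore always be met.\<close>
    have "- p i = p (i + h)" for i
      using h sp_pow_neg[OF x] by (simp add: p_def funpow_add)
    then show ?thesis using s by metis
  qed
  then have "q s = p j \<or> q s = - p j \<and> (\<forall>i. p i \<noteq> - p 0)"
    unfolding j_def shift_of_def s_def by (rule someI_ex)
  moreover have "cycle_value p q = cis (2 * pi / real (least_power x a)) ^ j"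
    by (simp add: cycle_value_def p_def q_def j_def period_lp)
  ultimately show ?thesis
    using s le P by (intro that[of s j]) (auto simp: p_def q_def s_def j_def)
qed

section \<open>Base points in the signed cycles, and extension of maps given on base points\<close>

definition "transversal x B \<longleftrightarrow> B \<subseteq> S \<and> (\<forall>a\<in>S. \<exists>!b. b \<in> B \<inter> cyc_supp x a)"

lemma transversal_unique:
  "signed_perm x \<Longrightarrow> transversal x B \<Longrightarrow> b \<in> B \<Longrightarrow> c \<in> B \<Longrightarrow> b \<in> cyc_supp x c \<Longrightarrow> b = c"
  unfolding transversal_def using supp_refl by blast

text \<open>Carrying the sign as a Boolean lets all points of a signed cycle be named by one
  expression, so that well-definedness and injectivity below need no separate treatment of
  signs.\<close>

definition spow :: "bool \<Rightarrow> (int \<Rightarrow> int) \<Rightarrow> nat \<Rightarrow> int \<Rightarrow> int" where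
  "spow e w i b = (if e then (w ^^ i) b else - (w ^^ i) b)"

text \<open>Every point of \<open>S\<close> is \<open>x^i b\<close> up to sign for exactly one
  \<open>b\<close> in \<open>B\<close>, though for many \<open>i\<close>. It is sent to the same
  expression in \<open>y\<close> and \<open>f b\<close>; \<open>pos\<close> and \<open>minus\<close>
  say that the same expressions coincide on both sides, which gives well-definedness and injectivity
  at once. The lemma serves to move one transversal to another inside a centralizer and to conjugate
  \<open>x\<close> to \<open>x_std\<close>.\<close>

lemma extension:
  assumes x: "signed_perm x" and y: "signed_perm y" and B: "transversal x B"
    and fS: "f ` B \<subseteq> S"
    and f: "\<And>b c. b \<in> B \<Longrightarrow> c \<in> B \<Longrightarrow> f b \<in> cyc_supp y (f c) \<Longrightarrow> b = c"
    and pos: "\<And>b i j. b \<in> B \<Longrightarrow> (x ^^ i) b = (x ^^ j) b \<longleftrightarrow> (y ^^ i) (f b) = (y ^^ j) (f b)"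
    and minus: "\<And>b i j. b \<in> B \<Longrightarrow> (x ^^ i) b = - (x ^^ j) b \<longleftrightarrow> (y ^^ i) (f b) = - (y ^^ j) (f b)"
  obtains t where "signed_perm t" "\<And>a. t (x a) = y (t a)" "\<And>b. b \<in> B \<Longrightarrow> t b = f b"
proof -
  have ceq: "spow e x i b = spow e' x i' b' \<longleftrightarrow> b = b' \<and> spow e y i (f b) = spow e' y i' (f b)"
    if b: "b \<in> B" "b' \<in> B" for e i b e' i' b'
  proof -
    have "b = b'" if "spow e x i b = spow e' x i' b'"
    proof -
      have mem: "spow e x i b \<in> cyc_supp x b" for e i b using x by (auto simp: supp_iff spow_def)
      have 1: "spow e x i b \<in> cyc_supp x b'" "spow e x i b \<in> cyc_supp x b"
        using mem[of e' i' b'] that mem[of e i b] by simp_all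
      have "b \<in> S" using b B by (auto simp: transversal_def)
      then have "b \<in> cyc_supp x b'" using 1 supp_sym[OF x] supp_trans[OF x] by blast
      then show ?thesis using transversal_unique[OF x B] b by blast
    qed
    moreover have "spow e x i b = spow e' x i' b \<longleftrightarrow> spow e y i (f b) = spow e' y i' (f b)"
      using pos[OF b(1), of i i'] minus[OF b(1), of i i'] minus[OF b(1), of i' i]
        eq_commute[of "- (x ^^ i) b"] eq_commute[of "- (y ^^ i) (f b)"]
      by (cases e; cases e') (simp_all add: spow_def)
    ultimately show ?thesis by blast
  qed
  have ex: "\<exists>e i b. b \<in> B \<and> a = spow e x i b" if a: "a \<in> S" for a
  proof -
    obtain b where b: "b \<in> B" "b \<in> cyc_supp x a" using B a unfolding transversal_def by blast
    then have "a \<in> cyc_supp x b" using supp_sym[OF x a] by blast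
    then obtain i where "a = (x ^^ i) b \<or> a = - (x ^^ i) b" using x by (auto simp: supp_iff)
    then have "a = spow True x i b \<or> a = spow False x i b" by (simp add: spow_def)
    then show ?thesis using b by blast
  qed
  define t where "t a = (if a \<in> S then THE d. \<exists>e i b. b \<in> B \<and> a = spow e x i b \<and> d = spow e y i (f b) else a)" for a
  have cS: "spow e w i b \<in> S" if "b \<in> S" "signed_perm w" for e w i b
    using that sp_in[OF sp_pow] neg_iff by (simp add: spow_def)
  have BS: "b \<in> S" if "b \<in> B" for b using that B by (auto simp: transversal_def)
  have t: "t (spow e x i b) = spow e y i (f b)" if b: "b \<in> B" for e i b
  proof -
    have "(THE d. \<exists>e' i' b'. b' \<in> B \<and> spow e x i b = spow e' x i' b' \<and> d = spow e' y i' (f b')) = spow e y i (f b)"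
    proof (rule the_equality)
      fix d assume "\<exists>e' i' b'. b' \<in> B \<and> spow e x i b = spow e' x i' b' \<and> d = spow e' y i' (f b')"
      then obtain e' i' b' where d: "b' \<in> B" "spow e x i b = spow e' x i' b'" "d = spow e' y i' (f b')"
        by blast
      then show "d = spow e y i (f b)" using ceq[OF b d(1), of e i e' i'] by metis
    qed (use b in blast)
    then show ?thesis using cS[OF BS[OF b] x] unfolding t_def by simp
  qed
  have fS': "f b \<in> S" if "b \<in> B" for b using fS that by blast
  have "signed_perm t"
  proof (rule sp_intro)
    fix a assume "a \<in> S"
    then obtain e i b where a: "b \<in> B" "a = spow e x i b" using ex by blast
    show "t a \<in> S" unfolding a(2) t[OF a(1)] by (rule cS[OF fS'[OF a(1)] y])
    have na: "- a = spow (\<not> e) x i b" using a by (simp add: spow_def)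
    show "t (- a) = - t a" unfolding na t[OF a(1)] unfolding a(2) t[OF a(1)] by (simp add: spow_def)
  next
    fix a a' assume aa: "a \<in> S" "a' \<in> S" "t a = t a'"
    obtain e i b where a: "b \<in> B" "a = spow e x i b" using ex aa by blast
    obtain e' i' b' where a': "b' \<in> B" "a' = spow e' x i' b'" using ex aa by blast
    have eq: "spow e y i (f b) = spow e' y i' (f b')" using aa(3) unfolding a a' t[OF a(1)] t[OF a'(1)] .
    have mem: "spow e y i (f b) \<in> cyc_supp y (f b)" for e i b using y by (auto simp: supp_iff spow_def)
    have 1: "spow e y i (f b) \<in> cyc_supp y (f b)" "spow e y i (f b) \<in> cyc_supp y (f b')"
      using mem[of e' i' b'] eq mem[of e i b] by simp_all
    then have "f b \<in> cyc_supp y (f b')"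
      using supp_sym[OF y] supp_trans[OF y] fS' a(1) by blast
    then have "b = b'" using f a(1) a'(1) by blast
    then show "a = a'" unfolding a a' using ceq[OF a(1) a'(1), of e i e' i'] eq by blast
  qed (simp add: t_def)
  moreover have "t (x a) = y (t a)" for a
  proof (cases "a \<in> S")
    case True
    then obtain e i b where a: "b \<in> B" "a = spow e x i b" using ex by blast
    have xa: "x a = spow e x (Suc i) b" using a(2) sp_neg[OF x] by (simp add: spow_def)
    show ?thesis unfolding xa t[OF a(1)] unfolding a(2) t[OF a(1)] using sp_neg[OF y] by (simp add: spow_def)
  next
    case False
    then have "x a = a" "y a = a" using x y sp_permutes permutes_not_in by metis+
    then show ?thesis using False by (simp add: t_def)
  qed
  moreover have "t b = f b" if "b \<in> B" for b using t[OF that, of True 0] by (simp add: spow_def)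
  ultimately show thesis using that by blast
qed

lemma restrict_Z:
  assumes x: "signed_perm x" and z: "z \<in> Z x" and A: "\<And>a. a \<in> A \<Longrightarrow> a \<in> S"
    and zA: "\<And>a. a \<in> A \<Longrightarrow> z a \<in> A" and sA: "\<And>a. a \<in> A \<Longrightarrow> cyc_supp x a \<subseteq> A"
  shows "perm_restrict z A \<in> Z x"
proof -
  have zs: "signed_perm z" using z by (simp add: Z_iff)
  have fA: "finite A" by (rule finite_subset[OF _ fin]) (use A in blast)
  have xA: "x a \<in> A \<longleftrightarrow> a \<in> A" for a
  proof
    assume "x a \<in> A"
    moreover have "a \<in> S" using A[OF \<open>x a \<in> A\<close>] sp_in[OF x] by blast
    then have "a \<in> cyc_supp x (x a)" using supp_sym[OF x] supp_step(1)[OF x supp_refl[OF x]] by blast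
    ultimately show "a \<in> A" using sA by blast
  qed (use supp_step(1)[OF x supp_refl[OF x]] sA in blast)
  have nA1: "- a \<in> A" if "a \<in> A" for a
    using supp_step(2)[OF x supp_refl[OF x], of a] sA[OF that] by blast
  have nA: "- a \<in> A \<longleftrightarrow> a \<in> A" for a
    using nA1[of a] nA1[of "- a"] unfolding minus_minus by blast
  have "inj_on z A" using sp_inj[OF zs] by (simp add: inj_on_def)
  then have "z ` A = A" using zA by (intro endo_inj_surj[OF fA]) blast+
  then have zA': "z a \<in> A \<longleftrightarrow> a \<in> A" for a
    using sp_inj[OF zs, of a] zA[of a] imageE[of "z a" z A] by metis
  have "signed_perm (perm_restrict z A)"
  proof (rule sp_intro)
    fix a b assume "perm_restrict z A a = perm_restrict z A b"
    then show "a = b"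
      using sp_inj[OF zs, of a b] zA'[of a] zA'[of b] by (auto simp: perm_restrict_def split: if_splits)
  next
    fix a assume "a \<in> S" then show "perm_restrict z A a \<in> S"
      using sp_in[OF zs, of a] by (simp add: perm_restrict_def)
  next
    fix a assume "a \<notin> S" then show "perm_restrict z A a = a"
      using A[of a] by (auto simp: perm_restrict_def)
  next
    fix a show "perm_restrict z A (- a) = - perm_restrict z A a"
      using nA[of a] sp_neg[OF zs] by (simp add: perm_restrict_def)
  qed
  then show ?thesis
    unfolding Z_iff
  proof (intro conjI allI)
    fix a show "perm_restrict z A (x a) = x (perm_restrict z A a)"
      using xA[of a] z by (simp add: Z_iff perm_restrict_def)
  qed
qed

end

section \<open>The averaged identity for one cycle\<close>

lemma primitive_root_pow_eq_iff:
  fixes w :: complex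
  assumes "\<And>l. w ^ l = 1 \<longleftrightarrow> D dvd l" "w \<noteq> 0"
  shows "w ^ i = w ^ j \<longleftrightarrow> [i = j] (mod D)"
proof -
  have *: "w ^ i = w ^ j \<longleftrightarrow> [j = i] (mod D)" if "i \<le> j" for i j
  proof -
    have "w ^ j = w ^ i * w ^ (j - i)" using that by (simp flip: power_add)
    then have "w ^ i = w ^ j \<longleftrightarrow> w ^ (j - i) = 1" using assms(2) by auto
    then show ?thesis using assms(1) that by (simp add: cong_altdef_nat)
  qed
  show ?thesis using *[of i j] *[of j i] by (metis cong_sym_eq nat_le_linear)
qed

text \<open>The congruence places \<open>s\<close> in the subgroup generated by \<open>i\<close> and
  \<open>M\<close>, whose least positive element is the gcd. In this way return times become
  gcds.\<close>

lemma least_cong_multiple: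
  fixes i l s M :: nat
  assumes "M > 0" "s > 0" "[s = i * l] (mod M)"
    and min: "\<And>s' l'. s' > 0 \<Longrightarrow> [s' = i * l'] (mod M) \<Longrightarrow> s \<le> s'"
  shows "s = gcd i M"
proof (rule antisym)
  obtain l' where "[i * l' = gcd i M] (mod M)" using cong_solve_nat assms by blast
  then show "s \<le> gcd i M" using min[of "gcd i M" l'] assms(1) by (simp add: cong_sym_eq)
  have "gcd i M dvd s" using assms(3) 
    by (metis cong_dvd_iff cong_dvd_modulus_nat dvd_mult2 gcd_dvd1 gcd_dvd2)
  then show "gcd i M \<le> s" using assms(2) by (simp add: dvd_imp_le)
qed

lemma cong_multiple_div:
  fixes i l M :: nat
  assumes "M > 0" "[i * l = gcd i M] (mod M)"
  shows "[i div gcd i M * l = 1] (mod (M div gcd i M))"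
proof -
  define d where "d = gcd i M"
  have d: "d > 0" "d * (i div d) = i" "d * (M div d) = M" using assms(1) by (auto simp: d_def)
  have "d * (i div d * l) mod (d * (M div d)) = d * 1 mod (d * (M div d))"
    unfolding d(3) mult.assoc[symmetric] d(2) using assms(2) by (simp add: cong_def d_def)
  then show ?thesis using d(1) unfolding mult_mod_right[symmetric] d_def[symmetric]
    by (simp add: cong_def)
qed

text \<open>The summands that are present run exactly once through all $\gcd(M, q)$-th roots of unity.\<close>

lemma sum_of_roots_parametrized:
  fixes M q :: nat and v w :: "nat \<Rightarrow> complex"
  assumes M: "M > 0"
    and w: "\<And>D l. D dvd M \<Longrightarrow> w D ^ l = 1 \<longleftrightarrow> D dvd l"
    and v: "\<And>i. i < M \<Longrightarrow> \<exists>l. [i * l = gcd i M] (mod M) \<and> v i = w (M div gcd i M) ^ l"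
  shows "(\<Sum>i<M. if M dvd i * q then v i else 0) = (if coprime M q then 1 else 0)"
proof -
  define G where "G = gcd M q"
  define A where "A = {i\<in>{..<M}. M dvd i * q}"
  have G: "G > 0" using M by (simp add: G_def)
  obtain m where m: "M = m * G" unfolding G_def by (metis dvdE gcd_dvd1 mult.commute)
  obtain p where p: "q = p * G" unfolding G_def by (metis dvdE gcd_dvd2 mult.commute)
  have mp: "coprime m p" using m p G M gcd_coprime[of M q m p] unfolding G_def by auto
  \<comment> \<open>After cancelling \<open>G\<close> the condition says that \<open>m\<close>
    divides \<open>i\<close>, which leaves exactly \<open>G\<close> indices below
    \<open>M\<close>.\<close>
  have "A = (\<lambda>k. k * m) ` {..<G}"
  proof -
    have "M dvd i * q \<longleftrightarrow> m dvd i" for i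
      using G mp by (simp add: m p coprime_dvd_mult_left_iff mult.assoc[symmetric])
    then show ?thesis using M m by (auto simp: A_def elim!: dvdE)
  qed
  moreover have "inj_on (\<lambda>k. k * m) {..<G}" using M m by (auto simp: inj_on_def)
  ultimately have cA: "card A = G" by (simp add: card_image)
  have w0: "w D \<noteq> 0" if "D dvd M" for D
    using w[OF that, of D] M that by (metis dvd_refl power_0_left zero_neq_one dvd_0_left_iff neq0_conv)
  \<comment> \<open>\<open>l\<close> is an inverse of \<open>i div gcd i M\<close> modulo the order,
    hence coprime to it, and \<open>v i\<close> is again primitive. Its order therefore determines
    \<open>gcd i M\<close>.\<close>
  have prim: "v i ^ n = 1 \<longleftrightarrow> M div gcd i M dvd n" if i: "i < M" for i n
  proof -
    define D where "D = M div gcd i M"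
    have D: "D dvd M" unfolding D_def by (metis dvd_div_mult_self dvd_triv_left gcd_dvd2)
    obtain l where l: "[i * l = gcd i M] (mod M)" "v i = w D ^ l" using v[OF i] unfolding D_def by blast
    have "[i div gcd i M * l = 1] (mod D)" unfolding D_def by (rule cong_multiple_div[OF M l(1)])
    then have "coprime D l" using coprime_iff_invertible_nat[of l D] by (metis coprime_commute mult.commute One_nat_def)
    then show ?thesis using w[OF D, of "l * n"] 
      unfolding l(2) D_def[symmetric] by (simp add: coprime_dvd_mult_right_iff power_mult)
  qed
  have inj: "inj_on v A"
  proof (rule inj_onI)
    fix i j assume ij: "i \<in> A" "j \<in> A" "v i = v j"
    then have lt: "i < M" "j < M" by (auto simp: A_def)
    define d where "d = gcd i M"
    define D where "D = M div d"
    have "M div gcd j M = D" using prim[OF lt(1)] prim[OF lt(2)] ij(3) unfolding D_def d_def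
      by (metis dvd_antisym dvd_refl)
    then have d': "gcd j M = d" unfolding D_def d_def using M
      by (metis dvd_div_eq_mult dvd_mult_div_cancel gcd_dvd2 mult_cancel2 mult_is_0 neq0_conv)
    have D: "D dvd M" "M = d * D"
      unfolding D_def d_def by (simp_all) (metis dvd_div_mult_self dvd_triv_left gcd_dvd2)
    obtain l where l: "[i * l = gcd i M] (mod M)" "v i = w D ^ l" using v[OF lt(1)] unfolding D_def d_def by blast
    obtain k where k: "[j * k = gcd j M] (mod M)" "v j = w D ^ k" using v[OF lt(2)] unfolding D_def d' by blast
    have il: "[i div d * l = 1] (mod D)" using cong_multiple_div[OF M l(1)] by (simp add: D_def d_def)
    have jk: "[j div d * k = 1] (mod D)" using cong_multiple_div[OF M k(1)] by (simp add: D_def d')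
    have "w D ^ l = w D ^ k" using ij(3) l(2) k(2) by simp
    then have lk: "[l = k] (mod D)"
      by (subst (asm) primitive_root_pow_eq_iff[where D = D]) (use w[OF D(1)] w0[OF D(1)] in auto)
    \<comment> \<open>The exponents \<open>l\<close> and \<open>k\<close> agree modulo
      \<open>D\<close>, and \<open>i div d\<close> and \<open>j div d\<close> are their inverses, so
      these agree as well.\<close>
    have "[i div d = i div d * (j div d * k)] (mod D)" using cong_sym[OF cong_scalar_left[OF jk, of "i div d"]] unfolding mult_1_right .
    also have "[i div d * (j div d * k) = (i div d * l) * (j div d)] (mod D)"
      using cong_sym[OF cong_scalar_left[OF lk, of "i div d * (j div d)"]] by (simp add: mult_ac)
    also have "[(i div d * l) * (j div d) = 1 * (j div d)] (mod D)" by (rule cong_scalar_right[OF il])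
    finally have "[i div d = j div d] (mod D)" by simp
    then have "[d * (i div d) = d * (j div d)] (mod (d * D))" by (simp add: cong_def)
    moreover have "d * (i div d) = i" "d * (j div d) = j" unfolding d_def using d' by (simp_all add: d_def) (metis dvd_mult_div_cancel gcd_dvd1)
    ultimately have "[i = j] (mod M)" using D(2) by simp
    then show "i = j" using lt by (simp add: cong_def)
  qed
  have "v i ^ G = 1" if "i \<in> A" for i
  proof -
    have i: "i < M" "M dvd i * q" using that by (auto simp: A_def)
    define d where "d = gcd i M"
    have d: "d > 0" "i = d * (i div d)" "M = d * (M div d)" using M by (auto simp: d_def)
    have "coprime (i div d) (M div d)" unfolding d_def using M by (intro div_gcd_coprime) simp
    moreover have "M div d dvd i div d * q" using i(2) d by (metis mult.assoc nat_mult_dvd_cancel_disj neq0_conv)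
    ultimately have "M div d dvd q" by (metis coprime_commute coprime_dvd_mult_right_iff)
    moreover have "M div d dvd M" using d(3) by (metis dvd_triv_right)
    ultimately show ?thesis using prim[OF i(1)] unfolding G_def d_def by simp
  qed
  then have "v ` A \<subseteq> {z. z ^ G = 1}" by blast
  moreover have "card (v ` A) = card {z::complex. z ^ G = 1}"
    using card_image[OF inj] cA card_roots_unity_eq[OF G] by simp
  moreover have "finite {z::complex. z ^ G = 1}" using finite_roots_unity[of G] G by simp
  ultimately have img: "v ` A = {z. z ^ G = 1}" by (metis card_subset_eq)
  have "(\<Sum>i<M. if M dvd i * q then v i else 0) = (\<Sum>i\<in>A. v i)"
    unfolding A_def by (subst sum.inter_filter) auto
  also have "\<dots> = \<Sum>(v ` A)" by (simp add: sum.reindex[OF inj])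
  also have "\<dots> = (if G = 1 then 1 else 0)"
    unfolding img using sum_roots_unity[of G] G by (auto simp: not_less le_Suc_eq)
  finally show ?thesis by (simp add: G_def coprime_iff_gcd_eq_1)
qed

lemma cis_primitive: 
  assumes "D > 0"
  shows "cis (2 * pi / real D) ^ l = 1 \<longleftrightarrow> D dvd l"
proof -
  have "cis (2 * pi / real D) ^ l = cis (2 * pi * (real l / real D))" by (simp add: DeMoivre mult_ac)
  also have "\<dots> = 1 \<longleftrightarrow> real l / real D \<in> \<int>"
  proof
    assume "cis (2 * pi * (real l / real D)) = 1"
    then have "cos (2 * pi * (real l / real D)) = 1" by (simp add: complex_eq_iff)
    then show "real l / real D \<in> \<int>" 
      unfolding cos_one_2pi_int by (metis Ints_of_int mult.commute mult_cancel_right mult_eq_0_iff pi_neq_zero zero_neq_numeral mult.assoc)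
  next
    assume "real l / real D \<in> \<int>"
    then show "cis (2 * pi * (real l / real D)) = 1" by (rule cis_multiple_2pi)
  qed
  also have "\<dots> \<longleftrightarrow> D dvd l"
  proof
    assume "real l / real D \<in> \<int>"
    then obtain k :: int where "real l / real D = of_int k" by (auto elim: Ints_cases)
    then have "real l = of_int k * real D" using assms by (simp add: field_simps)
    then have "int l = k * int D" by (metis of_int_eq_iff of_int_mult of_int_of_nat_eq)
    then show "D dvd l" by (metis dvd_triv_right int_dvd_int_iff)
  qed (use assms in auto)
  finally show ?thesis .
qed

text \<open>The exponent $(D + 1) / 2$ is the inverse of $2$ modulo the odd number $D$.\<close>

definition prim_root :: "bool \<Rightarrow> nat \<Rightarrow> complex" where
  "prim_root e D = (if e \<and> odd D then cis (2 * pi / real D) ^ ((D + 1) div 2) else cis (2 * pi / real D))"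

lemma prim_root:
  assumes "D > 0"
  shows "prim_root e D ^ l = 1 \<longleftrightarrow> D dvd l"
proof (cases "e \<and> odd D")
  case True
  then have "even (D + 1)" by simp
  then have "(D + 1) div 2 * 2 = D + 1" by (rule dvd_div_mult_self)
  then have "coprime D ((D + 1) div 2)"
    by (metis coprime_add_one_right coprime_mult_right_iff)
  then have "cis (2 * pi / real D) ^ ((D + 1) div 2 * l) = 1 \<longleftrightarrow> D dvd l"
    using cis_primitive[OF assms] by (simp only: coprime_dvd_mult_right_iff)
  moreover have "prim_root e D = cis (2 * pi / real D) ^ ((D + 1) div 2)"
    using True unfolding prim_root_def by simp
  ultimately show ?thesis by (simp only: power_mult)
next
  case False
  then have "prim_root e D = cis (2 * pi / real D)" by (auto simp: prim_root_def)
  then show ?thesis using cis_primitive[OF assms] by simp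
qed

lemma prim_root_double:
  assumes "D > 0" "odd D"
  shows "prim_root True D ^ (2 * l) = cis (2 * pi / real D) ^ l"
proof -
  have "(D + 1) div 2 * 2 = D + 1" using assms(2) by (intro dvd_div_mult_self) simp
  then have m: "(D + 1) div 2 * (2 * l) = D * l + l" by (simp only: mult.assoc[symmetric]) simp
  have "prim_root True D = cis (2 * pi / real D) ^ ((D + 1) div 2)"
    using assms(2) unfolding prim_root_def by simp
  then have "prim_root True D ^ (2 * l) = cis (2 * pi / real D) ^ (D * l + l)"
    by (simp only: m flip: power_mult)
  also have "\<dots> = cis (2 * pi / real D) ^ l"
    using cis_primitive[OF assms(1), of "D * l"] by (simp add: power_add)
  finally show ?thesis .
qed

lemma cis_cancel_pow: "c > 0 \<Longrightarrow> cis (2 * pi / real (c * D)) ^ (c * l) = cis (2 * pi / real D) ^ l"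
  by (simp add: DeMoivre field_simps)

lemma dvd_mult_iff_div_gcd:
  fixes i M l :: nat
  assumes "M > 0"
  shows "M dvd i * l \<longleftrightarrow> M div gcd i M dvd l"
proof -
  have c: "coprime (M div gcd i M) (i div gcd i M)" 
    using assms div_gcd_coprime[of i M] by (simp add: coprime_commute)
  have d: "gcd i M > 0" "gcd i M * (i div gcd i M) = i" "gcd i M * (M div gcd i M) = M"
    using assms by auto
  have "M dvd i * l \<longleftrightarrow> gcd i M * (M div gcd i M) dvd gcd i M * (i div gcd i M * l)"
    using d(2,3) by (simp add: mult.assoc[symmetric])
  also have "\<dots> \<longleftrightarrow> M div gcd i M dvd i div gcd i M * l" using d(1) by (simp only: nat_mult_dvd_cancel1)
  also have "\<dots> \<longleftrightarrow> M div gcd i M dvd l" using c by (rule coprime_dvd_mult_right_iff)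
  finally show ?thesis .
qed

lemma least_power_eqI: 
  assumes "\<And>n. (x ^^ n) a = a \<longleftrightarrow> N dvd n" "N > 0" shows "least_power x a = N"
  unfolding least_power_def by (rule Least_equality) (use assms in \<open>auto intro: dvd_imp_le\<close>)

context signed_set
begin

lemma sp_sign: "signed_perm w \<Longrightarrow> e = 1 \<or> e = -1 \<Longrightarrow> w (e * a) = e * w a"
  using sp_neg[of w a] by auto

lemma pow_sign: "signed_perm w \<Longrightarrow> e = 1 \<or> e = -1 \<Longrightarrow> (w ^^ i) (e * a) = e * (w ^^ i) a"
  by (rule sp_sign[OF sp_pow])

text \<open>
  If $-a$ is in the cycle of $a$ under $g$, the sign $e$ can be absorbed in the exponent $i$;
  this is what the last assumption normalizes.
\<close>

lemma local_value:
  assumes x: "signed_perm x" and g: "signed_perm g" and xg: "x \<in> Z g" and a: "a \<in> S" and r: "r > 0"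
    and nb: "\<And>l. 0 < l \<Longrightarrow> l < r \<Longrightarrow> (x ^^ l) a \<notin> cyc_supp g a"
    and e: "e = 1 \<or> e = -1" and xr: "(x ^^ r) a = e * (g ^^ i) a"
    and en: "e = -1 \<Longrightarrow> \<forall>i. (g ^^ i) a \<noteq> - a"
  shows local_pow: "(x ^^ (r * l)) a = e ^ l * (g ^^ (i * l)) a"
    and local_return: "(x ^^ l) a \<in> cyc_supp g a \<longleftrightarrow> r dvd l"
    and local_Cval: "\<exists>l. [i * l = gcd i (least_power g a)] (mod least_power g a) \<and>
      Cval x g a = prim_root (e = -1 \<or> (\<exists>i. (g ^^ i) a = - a)) (least_power g a div gcd i (least_power g a)) ^ l"
proof -
  let ?M = "least_power g a"
  define D where "D = ?M div gcd i ?M"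
  have M: "?M > 0" by (rule lp_pos[OF g])
  have D: "D > 0" unfolding D_def using M by (simp add: div_greater_zero_iff gcd_le2_nat)
  have gx: "g \<in> Z x" using Z_sym[OF g xg] .
  have comm: "(x ^^ j) ((g ^^ k) b) = (g ^^ k) ((x ^^ j) b)" for j k b
    by (rule funpow_commute) (use xg in \<open>simp add: Z_iff\<close>)
  have e': "e ^ l = 1 \<or> e ^ l = -1" for l using e by (induction l) auto
  have ee: "e ^ l * (e ^ l * b) = b" for l b using e'[of l] by auto
  show pow: "(x ^^ (r * l)) a = e ^ l * (g ^^ (i * l)) a" for l
  proof (induction l)
    case (Suc l)
    have "(x ^^ (r * Suc l)) a = (x ^^ r) ((x ^^ (r * l)) a)" by (simp add: funpow_add)
    also have "\<dots> = e ^ l * (g ^^ (i * l)) ((x ^^ r) a)" using Suc e' x by (simp add: pow_sign comm)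
    also have "\<dots> = e ^ Suc l * (g ^^ (i * Suc l)) a" unfolding xr using e g 
      by (simp add: pow_sign funpow_add add.commute[of i] mult_ac)
    finally show ?case .
  qed simp
  have B: "t * (g ^^ j) a \<in> cyc_supp g a" if "t = 1 \<or> t = -1" for t j
    using that g by (auto simp: supp_iff)
  show ret: "(x ^^ l) a \<in> cyc_supp g a \<longleftrightarrow> r dvd l" for l
  proof
    assume l: "(x ^^ l) a \<in> cyc_supp g a"
    \<comment> \<open>Division with remainder by \<open>r\<close>: the full returns act inside the
      signed cycle of \<open>a\<close>, so a nonzero remainder would be an earlier return, contrary
      to \<open>nb\<close>.\<close>
    define c where "c = l div r"
    have "(x ^^ l) a = (x ^^ (l mod r)) ((x ^^ (r * c)) a)" unfolding c_def
      by (metis add.commute funpow_add mult_div_mod_eq o_apply)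
    also have "\<dots> = e ^ c * (g ^^ (i * c)) ((x ^^ (l mod r)) a)"
      unfolding pow using e' x by (simp add: pow_sign comm)
    finally have "e ^ c * (g ^^ (i * c)) ((x ^^ (l mod r)) a) \<in> cyc_supp g a" using l by simp
    then have "(g ^^ (i * c)) ((x ^^ (l mod r)) a) \<in> cyc_supp g a"
      using e'[of c] supp_step(2)[OF g, of "- ((g ^^ (i * c)) ((x ^^ (l mod r)) a))"] by auto
    moreover have "cyc_supp g ((g ^^ (i * c)) a) = cyc_supp g a"
      using supp_eq[OF g a] B[of 1 "i * c"] by simp
    ultimately have "(x ^^ (l mod r)) a \<in> cyc_supp g a"
      using supp_Z[OF g Z_pow[OF Z_self[OF g]], of "i * c" _ a] by blast
    then have "\<not> 0 < l mod r" using nb[of "l mod r"] r by auto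
    then show "r dvd l" by (simp add: dvd_eq_mod_eq_0)
  next
    assume "r dvd l"
    then obtain c where "l = r * c" by blast
    then show "(x ^^ l) a \<in> cyc_supp g a" using pow B e' by simp
  qed
  obtain s j where s: "s > 0" and min: "\<And>s'. s' > 0 \<Longrightarrow> (g ^^ s') a \<in> cyc_supp x a \<Longrightarrow> s \<le> s'"
    and sj: "(g ^^ s) a = (x ^^ j) a \<or> (g ^^ s) a = - (x ^^ j) a \<and> (\<forall>i. (x ^^ i) a \<noteq> - a)"
    and L: "Cval x g a = cis (2 * pi / real (least_power x a)) ^ j"
    by (rule Cval_spec[OF x gx, of a]) blast
  \<comment> \<open>The point where \<open>g\<close> returns lies in both signed cycles, so
    \<open>j\<close> consists of full returns of \<open>x\<close>. The quotient \<open>l\<close> is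
    the exponent sought, except for a factor 2 in the last case below.\<close>
  have "(x ^^ j) a = 1 * (g ^^ s) a \<or> (x ^^ j) a = -1 * (g ^^ s) a" using sj by auto
  then have "(x ^^ j) a \<in> cyc_supp g a" using B by metis
  then obtain l where j: "j = r * l" using ret by blast
  have min': "s \<le> s'" if "s' > 0" "t = 1 \<or> t = -1" "(g ^^ s') a = t * (g ^^ (i * l')) a" for s' t l'
  proof (rule min[OF that(1)])
    have "(g ^^ s') a = (t * e ^ l') * (x ^^ (r * l')) a" unfolding pow that(3) using ee[of l' "(g ^^ (i * l')) a"] by (simp add: mult.assoc)
    moreover have "t * e ^ l' = 1 \<or> t * e ^ l' = -1" using that(2) e'[of l'] by auto
    ultimately show "(g ^^ s') a \<in> cyc_supp x a" using x by (auto simp: supp_iff)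
  qed
  have geq: "(g ^^ i) a = (g ^^ j) a \<longleftrightarrow> [i = j] (mod ?M)" for i j
    using pow_eq_iff[OF g] by (simp add: cong_def)
  \<comment> \<open>The period under \<open>x\<close> is \<open>r\<close> times the period of
    \<open>a\<close> under the return map, which acts as \<open>g^i\<close> together with the sign
    \<open>e\<close>.\<close>
  have lpx: "least_power x a = r * N" if "\<And>n. e ^ n * (g ^^ (i * n)) a = a \<longleftrightarrow> N dvd n" "N > 0" for N
  proof (rule least_power_eqI)
    fix n
    have "r dvd n" if "(x ^^ n) a = a" using that ret[of n] supp_refl[OF g, of a] by simp
    then show "(x ^^ n) a = a \<longleftrightarrow> r * N dvd n" using that(1) pow r
      by (metis dvdE dvd_mult_left nat_mult_dvd_cancel1)
  qed (use that r in simp)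
  have gD: "(g ^^ (i * n)) a = a \<longleftrightarrow> D dvd n" for n
    using lp_dvd[OF g, of "i * n" a] dvd_mult_iff_div_gcd[OF M] by (simp add: D_def)
  let ?F = "e = -1 \<or> (\<exists>i. (g ^^ i) a = - a)"
  have "\<exists>l. [i * l = gcd i ?M] (mod ?M) \<and> Cval x g a = prim_root ?F D ^ l"
  proof (cases "\<exists>i. (g ^^ i) a = - a")
    case False
    have neg: "(g ^^ i) a \<noteq> - (g ^^ j) a" for i j
    proof
      assume eq: "(g ^^ i) a = - (g ^^ j) a"
      define k where "k = j * (?M - 1)"
      have jk: "k + j = ?M * j" using M by (simp add: k_def algebra_simps)
      have "(g ^^ (k + i)) a = (g ^^ k) ((g ^^ i) a)" by (simp add: funpow_add)
      also have "\<dots> = - (g ^^ (k + j)) a" unfolding eq sp_pow_neg[OF g] by (simp add: funpow_add)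
      also have "(g ^^ (k + j)) a = a" using lp_dvd[OF g, of "?M * j" a] by (simp add: jk)
      finally show False using False by blast
    qed
    obtain t where t: "t = 1 \<or> t = -1" "(g ^^ s) a = t * (x ^^ j) a" 
      "t = 1 \<or> (\<forall>i. (x ^^ i) a \<noteq> - a)" using sj by (metis mult_1 mult_minus1)
    have gs: "(g ^^ s) a = (t * e ^ l) * (g ^^ (i * l)) a" using t(2) unfolding j pow by (simp add: mult.assoc)
    have te: "t * e ^ l = 1"
    proof (rule ccontr)
      assume "t * e ^ l \<noteq> 1"
      then have "t * e ^ l = -1" using t(1) e'[of l] by auto
      then show False using gs neg by simp
    qed
    have sl: "[s = i * l] (mod ?M)" using gs te geq by simp
    have sg: "s = gcd i ?M"
      using M s sl
    proof (rule least_cong_multiple)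
      fix s' l' assume "s' > 0" "[s' = i * l'] (mod ?M)"
      then show "s \<le> s'" using min'[of s' 1 l'] geq by simp
    qed
    have il: "[i * l = gcd i ?M] (mod ?M)" using cong_sym[OF sl] sg by simp
    have en1: "e ^ n * (g ^^ (i * n)) a = a \<longleftrightarrow> e ^ n = 1 \<and> D dvd n" for n
      using e'[of n] gD[of n] neg[of 0 "i * n"] neg[of "i * n" 0] by auto
    \<comment> \<open>For \<open>e = -1\<close> and odd \<open>D\<close>, the power
      \<open>x^(r * D)\<close> sends \<open>a\<close> to \<open>-a\<close>. This doubles the period,
      but it also forces the sign \<open>t\<close> to be absorbed in \<open>j\<close>, so
      \<open>l\<close> is even; halving \<open>l\<close> compensates for the doubled period. In all
      other cases the period is just \<open>r * D\<close>.\<close>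
    show ?thesis
    proof (cases "e = -1 \<and> odd D")
      case True
      have "e ^ n * (g ^^ (i * n)) a = a \<longleftrightarrow> 2 * D dvd n" for n
      proof -
        have "e ^ n = 1 \<longleftrightarrow> even n" using True by (simp add: uminus_power_if)
        moreover have "coprime 2 D" using True by simp
        ultimately show ?thesis unfolding en1 by (metis divides_mult dvd_mult_left dvd_mult_right)
      qed
      then have N: "least_power x a = r * (2 * D)" using D by (intro lpx) auto
      have "t = 1"
      proof (rule ccontr)
        assume "t \<noteq> 1"
        then have "(x ^^ (r * D)) a \<noteq> - a" using t(3) by blast
        moreover have "(g ^^ (i * D)) a = a" using gD by simp
        ultimately show False using True by (simp add: pow)
      qed
      then have "even l" using te True by (simp add: uminus_power_if split: if_splits)
      then obtain k where k: "l = 2 * k" by blast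
      have "Cval x g a = cis (2 * pi / real D) ^ k"
        unfolding L N j k using cis_cancel_pow[of "r * 2" D k] r by (simp add: mult_ac)
      also have "\<dots> = prim_root ?F D ^ l" using prim_root_double[OF D, of k] True by (simp add: k)
      finally show ?thesis using il by blast
    next
      case F: False
      have "e ^ n * (g ^^ (i * n)) a = a \<longleftrightarrow> D dvd n" for n
      proof -
        have "e ^ n = 1" if "D dvd n"
        proof (cases "e = 1")
          case False
          then have "even n" using F e that by (metis dvd_trans)
          then show ?thesis using e by auto
        qed simp
        then show ?thesis unfolding en1 by blast
      qed
      then have N: "least_power x a = r * D" using D by (intro lpx) auto
      have "Cval x g a = cis (2 * pi / real D) ^ l" unfolding L N j using r by (rule cis_cancel_pow)
      also have "\<dots> = prim_root ?F D ^ l" using F False by (auto simp: prim_root_def)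
      finally show ?thesis using il by blast
    qed
  next
    case True
    then have e1: "e = 1" using e en by blast
    obtain h where h: "(g ^^ h) a = - a" using True by blast
    have "(g ^^ (2 * h)) a = a" using h sp_pow_neg[OF g] by (simp add: mult_2 funpow_add)
    then have h2: "?M dvd 2 * h" using lp_dvd[OF g] by blast
    have hM: "\<not> ?M dvd h" using h lp_dvd[OF g, of h a] neq_neg[OF a] by auto
    have evM: "even ?M"
    proof (rule ccontr)
      assume "odd ?M" then have "coprime ?M 2" by simp
      then show False using h2 hM by (simp add: coprime_dvd_mult_right_iff)
    qed
    \<comment> \<open>Half the period: \<open>h\<close> turns out to be an odd multiple of
      \<open>H\<close>, so already \<open>g^H\<close> sends \<open>a\<close> to
      \<open>-a\<close>.\<close>
    then obtain H where H: "?M = 2 * H" by blast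
    have "H dvd h" using h2 H by simp
    then obtain c where c: "h = H * c" by blast
    have "odd c" using hM H c by auto
    then obtain c' where "c = 2 * c' + 1" by (rule oddE)
    then have "h = H + c' * (2 * H)" using c by (simp add: algebra_simps)
    then have "[h = H] (mod ?M)" unfolding H cong_def by (simp only: mod_mult_self1)
    then have gH: "(g ^^ H) a = - a" using geq h by metis
    have H0: "H > 0" using M H by simp
    have gHk: "(g ^^ (k + H)) a = - (g ^^ k) a" for k using gH sp_pow_neg[OF g] by (simp add: funpow_add)
    have pow1: "(x ^^ (r * l)) a = (g ^^ (i * l)) a" for l using pow e1 by simp
    have N: "least_power x a = r * D" using D gD e1 by (intro lpx) auto
    have LL: "Cval x g a = cis (2 * pi / real D) ^ l" unfolding L N j using r by (rule cis_cancel_pow)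
    show ?thesis
    proof (cases "even D")
      case evD: True
      \<comment> \<open>For even \<open>D\<close> the number \<open>H\<close> is a multiple of
        \<open>gcd i M\<close>, so \<open>x\<close> reaches \<open>-a\<close> as well. Then
        \<open>shift_of\<close> may not ignore a sign, and the congruence holds modulo the full
        period.\<close>
      obtain l0 where l0: "[i * l0 = gcd i ?M] (mod ?M)" using cong_solve_nat by blast
      have "gcd i ?M * D = 2 * H" using H[symmetric] by (simp add: D_def)
      then have "2 * (gcd i ?M * (D div 2)) = 2 * H" using evD by (auto elim!: evenE)
      then have "gcd i ?M * (D div 2) = H" by simp
      moreover have "[i * (l0 * (D div 2)) = gcd i ?M * (D div 2)] (mod ?M)"
        using cong_scalar_right[OF l0, of "D div 2"] by (simp add: mult.assoc)
      ultimately have "(x ^^ (r * (l0 * (D div 2)))) a = - a" unfolding pow1 gH[symmetric] geq by simp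
      then have "(g ^^ s) a = (g ^^ (i * l)) a" using sj pow1 j by metis
      then have sl: "[s = i * l] (mod ?M)" using geq by simp
      have sg: "s = gcd i ?M"
        using M s sl
      proof (rule least_cong_multiple)
        fix s' l' assume "s' > 0" "[s' = i * l'] (mod ?M)"
        then show "s \<le> s'" using min'[of s' 1 l'] geq by simp
      qed
      have "[i * l = gcd i ?M] (mod ?M)" using cong_sym[OF sl] sg by simp
      moreover have "Cval x g a = prim_root ?F D ^ l" using LL evD by (simp add: prim_root_def)
      ultimately show ?thesis by blast
    next
      case odD: False
      \<comment> \<open>For odd \<open>D\<close> only equality up to sign is available, which is
        congruence modulo the half period \<open>H\<close>. The return time becomes
        \<open>gcd i H\<close>, half of \<open>gcd i M\<close>, and doubling the congruence yields
        the exponent \<open>2 * l\<close>. This is the origin of the halved exponent in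
        \<open>prim_root\<close>.\<close>
      have modH: "[u = v] (mod H) \<longleftrightarrow> (g ^^ u) a = (g ^^ v) a \<or> (g ^^ u) a = - (g ^^ v) a" for u v
      proof -
        have "[u = v] (mod H) \<longleftrightarrow> [u = v] (mod 2 * H) \<or> [u = v + H] (mod 2 * H)"
        proof -
          have m: "u mod (2 * H) = u mod H \<or> u mod (2 * H) = u mod H + H" for u
            using mod_mult2_eq[of u H 2] by (cases "even (u div H)") (auto simp: mult.commute odd_iff_mod_2_eq_one)
          have "(v + H) mod (2 * H) = (if v mod (2 * H) = v mod H then v mod H + H else v mod H)"
          proof -
            have "(v + H) mod (2 * H) = (v mod (2 * H) + H) mod (2 * H)" by (simp add: mod_add_left_eq)
            moreover have lt: "v mod H < H" using H0 by simp
            moreover have "(v mod H + H + H) mod (2 * H) = v mod H"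
              using lt mod_add_self2[of "v mod H" "2 * H"] by (simp add: mult_2 add.assoc)
            ultimately show ?thesis using m[of v] H0 by auto
          qed
          moreover have "[u = v] (mod H)" if "[u = v] (mod 2 * H) \<or> [u = v + H] (mod 2 * H)"
          proof -
            have "[u = v] (mod H) \<or> [u = v + H] (mod H)" using that cong_modulus_mult_nat[of _ _ H 2] by (auto simp: mult.commute)
            then show ?thesis by (simp add: cong_def)
          qed
          ultimately show ?thesis using m[of u] m[of v] by (auto simp: cong_def)
        qed
        then show ?thesis using geq[of u v] geq[of u "v + H"] by (simp add: H gHk)
      qed
      have sl: "[s = i * l] (mod H)" using sj modH pow1 j by metis
      have sg: "s = gcd i H"
        using H0 s sl
      proof (rule least_cong_multiple)
        fix s' l' assume "s' > 0" "[s' = i * l'] (mod H)"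
        then have "(g ^^ s') a = 1 * (g ^^ (i * l')) a \<or> (g ^^ s') a = -1 * (g ^^ (i * l')) a" using modH by simp
        then show "s \<le> s'" using min'[of s'] \<open>s' > 0\<close> by metis
      qed
      have "2 * s = gcd i ?M"
      proof -
        define d where "d = gcd i ?M"
        have d: "d > 0" "i = d * (i div d)" "?M = d * D" using M by (simp_all add: d_def D_def)
        have "2 * s = gcd (2 * i) ?M" using sg H by (simp add: gcd_mult_distrib_nat)
        also have "\<dots> = gcd (d * (2 * (i div d))) (d * D)" using d(2,3) by (metis mult.left_commute)
        also have "\<dots> = d * gcd (2 * (i div d)) D" by (simp add: gcd_mult_distrib_nat)
        also have "gcd (2 * (i div d)) D = 1"
        proof -
          have "coprime (i div d) D" unfolding d_def D_def using M by (intro div_gcd_coprime) simp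
          then show ?thesis using odD by simp
        qed
        finally show ?thesis by (simp add: d_def)
      qed
      moreover have "[2 * (i * l) = 2 * s] (mod (2 * H))" using sl by (simp add: cong_def)
      ultimately have "[i * (2 * l) = gcd i ?M] (mod ?M)" unfolding H by (simp add: mult_ac)
      moreover have "Cval x g a = prim_root ?F D ^ (2 * l)" using LL prim_root_double[OF D odD] True by simp
      ultimately show ?thesis by blast
    qed
  qed
  then show "\<exists>l. [i * l = gcd i ?M] (mod ?M) \<and> Cval x g a = prim_root ?F (?M div gcd i ?M) ^ l"
    unfolding D_def .
qed

section \<open>Twisting by one cycle of \<open>g\<close> and exchanging the local factors\<close>

definition root_ind :: "nat \<Rightarrow> (int \<Rightarrow> int) \<Rightarrow> (int \<Rightarrow> int) \<Rightarrow> int \<Rightarrow> complex" where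
  "root_ind K g y c = (if (y ^^ K) c = g c then 1 else 0)"

text \<open>Multiplied over \<open>mins y g\<close>, the factors \<open>root_ind\<close> give the
  indicator of \<open>y^K = g\<close>, and the factors \<open>lie_val\<close> give
  \<open>Omega y g\<close> if \<open>y^K = id\<close> and 0 otherwise.\<close>

definition lie_val :: "nat \<Rightarrow> (int \<Rightarrow> int) \<Rightarrow> (int \<Rightarrow> int) \<Rightarrow> int \<Rightarrow> complex" where
  "lie_val K g y c = (if (y ^^ K) c = c then Cval y g c else 0)"

definition "twist g a = perm_restrict g (cyc_supp g a)"

lemma g_supp_iff:
  assumes "signed_perm g" "a \<in> S"
  shows "g b \<in> cyc_supp g a \<longleftrightarrow> b \<in> cyc_supp g a"
proof
  assume *: "g b \<in> cyc_supp g a"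
  then have "b \<in> S" using supp_subset[OF assms] sp_in[OF assms(1)] by blast
  then have "b \<in> cyc_supp g (g b)"
    using supp_sym[OF assms(1)] supp_step(1)[OF assms(1) supp_refl[OF assms(1)]] by blast
  then show "b \<in> cyc_supp g a" using * supp_trans[OF assms(1)] by blast
qed (rule supp_step(1)[OF assms(1)])

lemma twist_Z:
  assumes "signed_perm g" "a \<in> S"
  shows "twist g a \<in> Z g"
  unfolding twist_def
proof (rule restrict_Z)
  show "b \<in> cyc_supp g a \<Longrightarrow> b \<in> S" for b using supp_subset[OF assms] by blast
  show "b \<in> cyc_supp g a \<Longrightarrow> cyc_supp g b \<subseteq> cyc_supp g a" for b using supp_eq[OF assms] by blast
qed (use assms Z_self supp_step in auto)

lemma twist_pow:
  assumes "signed_perm g" "a \<in> S"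
  shows "(twist g a ^^ i) b = (if b \<in> cyc_supp g a then (g ^^ i) b else b)"
proof -
  have "(twist g a ^^ i) b = (if b \<in> cyc_supp g a then (g ^^ i) b else b) \<and>
    ((g ^^ i) b \<in> cyc_supp g a \<longleftrightarrow> b \<in> cyc_supp g a)"
    by (induction i) (auto simp: twist_def perm_restrict_def g_supp_iff[OF assms])
  then show ?thesis by blast
qed

text \<open>The \<open>i\<close>-th twist adds \<open>i\<close> to the exponent of \<open>g\<close>
  at the first return of \<open>a\<close>, so this exponent \<open>p\<close> runs once through all
  residues modulo the period \<open>M\<close>. Writing \<open>K = r * q\<close>, and apart from
  cases where both sums vanish, the root condition reads that \<open>p * q\<close> is 1 modulo
  \<open>M\<close>: it has one solution if \<open>M\<close> and \<open>q\<close> are coprime and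
  none otherwise. The other condition is that \<open>p * q\<close> is 0 modulo \<open>M\<close>, and
  the roots of unity attached to its solutions have the same sum.\<close>

lemma local_sum:
  assumes g: "signed_perm g" and y: "y \<in> Z g" and a: "a \<in> S"
  shows "(\<Sum>i<least_power g a. root_ind K g (y \<circ> twist g a ^^ i) a) =
    (\<Sum>i<least_power g a. lie_val K g (y \<circ> twist g a ^^ i) a)"
proof -
  let ?M = "least_power g a" and ?B = "cyc_supp g a"
  define X where "X i = y \<circ> twist g a ^^ i" for i
  have ys: "signed_perm y" using y by (simp add: Z_iff)
  have M: "?M > 0" by (rule lp_pos[OF g])
  have XZ: "X i \<in> Z g" for i
    unfolding X_def by (rule Z_comp[OF y Z_pow[OF twist_Z[OF g a]]])
  then have Xs: "signed_perm (X i)" for i by (simp add: Z_iff)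
  have comm: "(y ^^ j) ((g ^^ k) b) = (g ^^ k) ((y ^^ j) b)" for j k b
    by (rule funpow_commute) (use y in \<open>simp add: Z_iff\<close>)
  define r where "r = (LEAST r. r > 0 \<and> (y ^^ r) a \<in> ?B)"
  have "least_power y a > 0 \<and> (y ^^ least_power y a) a \<in> ?B"
    using lp_pos[OF ys] lp_dvd[OF ys, of "least_power y a" a] supp_refl[OF g] by simp
  then have r: "r > 0 \<and> (y ^^ r) a \<in> ?B" unfolding r_def by (rule LeastI)
  have nb: "(y ^^ l) a \<notin> ?B" if "0 < l" "l < r" for l
    using not_less_Least[of l] that unfolding r_def by blast
  obtain i0 e where i0: "(y ^^ r) a = e * (g ^^ i0) a" "e = 1 \<or> e = -1"
    "e = -1 \<Longrightarrow> \<forall>i. (g ^^ i) a \<noteq> - a"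
  proof -
    obtain i where i: "(y ^^ r) a = (g ^^ i) a \<or> (y ^^ r) a = - (g ^^ i) a"
      using r g by (auto simp: supp_iff)
    show thesis
    proof (cases "\<exists>k. (g ^^ k) a = - a")
      case False
      then show ?thesis using i that[of 1 i] that[of "-1" i] by auto
    next
      case True
      then obtain k where "(g ^^ k) a = - a" by blast
      then have "- (g ^^ i) a = (g ^^ (i + k)) a" using sp_pow_neg[OF g] by (simp add: funpow_add)
      then show ?thesis using i that[of 1 i] that[of 1 "i + k"] by auto
    qed
  qed
  have gB: "(g ^^ i) b \<in> ?B \<longleftrightarrow> b \<in> ?B" for i b
    by (induction i) (simp_all add: g_supp_iff[OF g a])
  have aB: "a \<in> ?B" by (rule supp_refl[OF g])
  have X1: "X i b = y (if b \<in> ?B then (g ^^ i) b else b)" for i b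
    by (simp add: X_def twist_pow[OF g a])
  \<comment> \<open>The twist acts at the first step only: the points reached before the return lie
    outside the signed cycle of \<open>a\<close>, where it is the identity.\<close>
  have Xl: "(X i ^^ l) a = (g ^^ i) ((y ^^ l) a)" if "0 < l" "l \<le> r" for i l
    using that
  proof (induction l)
    case (Suc l)
    show ?case
    proof (cases "l = 0")
      case True
      then show ?thesis using aB comm[of 1 i a] by (simp add: X1)
    next
      case False
      then have "(X i ^^ l) a = (g ^^ i) ((y ^^ l) a)" "(g ^^ i) ((y ^^ l) a) \<notin> ?B"
        using Suc nb gB by auto
      then show ?thesis using comm[of 1 i] X1[of i "(g ^^ i) ((y ^^ l) a)"] by simp
    qed
  qed simp
  define p where "p i = (i0 + i) mod ?M" for i
  have gp: "(g ^^ p i) a = (g ^^ (i0 + i)) a" for i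
    using pow_eq_iff[OF g] by (simp add: p_def)
  have Xr: "(X i ^^ r) a = e * (g ^^ p i) a" for i
    using Xl[of r i] r i0 pow_sign[OF g, of e i] unfolding gp
    by (simp add: add.commute[of i0] funpow_add)
  have Xnb: "(X i ^^ l) a \<notin> ?B" if "0 < l" "l < r" for i l
    using Xl[of l i] that nb gB by simp
  note loc = local_pow[OF Xs g XZ a _ Xnb i0(2) Xr i0(3)] local_return[OF Xs g XZ a _ Xnb i0(2) Xr i0(3)]
    local_Cval[OF Xs g XZ a _ Xnb i0(2) Xr i0(3)]
  have gaB: "g a \<in> ?B" using aB g_supp_iff[OF g a] by simp
  have "(\<Sum>i<?M. root_ind K g (X i) a) = (\<Sum>i<?M. lie_val K g (X i) a)"
  proof (cases "r dvd K")
    case False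
    then have "(X i ^^ K) a \<notin> ?B" for i using loc(2) r by blast
    then have "(X i ^^ K) a \<noteq> a" "(X i ^^ K) a \<noteq> g a" for i using aB gaB by metis+
    then show ?thesis by (simp add: root_ind_def lie_val_def)
  next
    case True
    then obtain q where q: "K = r * q" by blast
    have XK: "(X i ^^ K) a = e ^ q * (g ^^ (p i * q)) a" for i
      unfolding q using loc(1) r by blast
    have e1: "e ^ q = 1 \<or> e ^ q = -1" using i0(2) by (induction q) auto
    show ?thesis
    proof (cases "e ^ q = 1")
      case False
      \<comment> \<open>Here \<open>X i ^^ K\<close> sends \<open>a\<close> to a negative of its
        \<open>g\<close>-orbit. As \<open>e = -1\<close> excludes \<open>-a\<close> from that orbit,
        neither \<open>a\<close> nor \<open>g a\<close> is hit, and both sums are 0.\<close>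
      then have eq: "e ^ q = -1" "e = -1" using e1 i0(2) by auto
      have neg: "- (g ^^ k) a \<noteq> (g ^^ j) a" for k j
      proof
        assume *: "- (g ^^ k) a = (g ^^ j) a"
        have "j * ?M - j + j = ?M * j" using M by (simp add: Suc_leI)
        then have "(g ^^ (j * ?M - j + j)) a = a" using lp_dvd[OF g, of "?M * j" a] by simp
        then have "(g ^^ (j * ?M - j)) ((g ^^ j) a) = a" by (simp add: funpow_add)
        then have "(g ^^ (j * ?M - j)) (- (g ^^ k) a) = a" using * by simp
        then have "(g ^^ (j * ?M - j + k)) a = - a" using sp_pow_neg[OF g] by (simp add: funpow_add)
        then show False using i0(3) eq(2) by blast
      qed
      have "(X i ^^ K) a \<noteq> a" "(X i ^^ K) a \<noteq> g a" for i
        using neg[of "p i * q" 0] neg[of "p i * q" 1] unfolding XK eq(1) by simp_all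
      then show ?thesis by (simp add: root_ind_def lie_val_def)
    next
      case True
      define F where "F \<longleftrightarrow> e = -1 \<or> (\<exists>i. (g ^^ i) a = - a)"
      have "inj_on p {..<?M}"
      proof (rule inj_onI)
        fix i j assume "i \<in> {..<?M}" "j \<in> {..<?M}" "p i = p j"
        then have "[i0 + i = i0 + j] (mod ?M)" by (simp add: p_def cong_def)
        then have "[i = j] (mod ?M)" by (simp only: cong_add_lcancel_nat)
        then show "i = j" using \<open>i \<in> _\<close> \<open>j \<in> _\<close> by (simp add: cong_def)
      qed
      moreover have "p ` {..<?M} \<subseteq> {..<?M}" using M by (auto simp: p_def)
      ultimately have bij: "bij_betw p {..<?M} {..<?M}" by (simp add: bij_betw_def endo_inj_surj)
      define p' where "p' = inv_into {..<?M} p"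
      have p'p: "p' (p i) = i" if "i < ?M" for i using bij that by (simp add: p'_def bij_betw_inv_into_left)
      have pp': "p (p' i) = i" "p' i < ?M" if "i < ?M" for i
        using bij that bij_betw_apply[OF bij_betw_inv_into[OF bij], of i] 
        by (simp_all add: p'_def bij_betw_inv_into_right)
      define v where "v i = Cval (X (p' i)) g a" for i
      have "(\<Sum>i<?M. root_ind K g (X i) a) = (\<Sum>i<?M. if [p i * q = 1] (mod ?M) then 1 else 0)"
        using pow_eq_iff[OF g, of _ a 1] True
        by (intro sum.cong) (auto simp: root_ind_def XK cong_def)
      also have "\<dots> = (\<Sum>i<?M. if [i * q = 1] (mod ?M) then 1 else 0)"
        by (rule sum.reindex_bij_betw[OF bij])
      also have "\<dots> = (if coprime ?M q then 1 else 0)"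
      proof (cases "coprime ?M q")
        case cop: True
        then obtain x where x: "[q * x = 1] (mod ?M)" using cong_solve_coprime_nat[of q ?M] by (auto simp: coprime_commute)
        have "[i * q = 1] (mod ?M) \<longleftrightarrow> i = x mod ?M" if "i < ?M" for i
        proof
          assume i: "[i * q = 1] (mod ?M)"
          have "[i * 1 = i * (q * x)] (mod ?M)" by (rule cong_sym[OF cong_scalar_left[OF x]])
          also have "[i * (q * x) = 1 * x] (mod ?M)" using cong_scalar_right[OF i, of x] by (simp add: mult.assoc)
          finally show "i = x mod ?M" using that by (simp add: cong_def)
        next
          assume "i = x mod ?M"
          then have "i * q mod ?M = q * x mod ?M" by (simp add: mod_mult_right_eq mult.commute)
          then show "[i * q = 1] (mod ?M)" using x by (simp add: cong_def)
        qed
        then have "(\<Sum>i<?M. if [i * q = 1] (mod ?M) then 1 else 0) = (\<Sum>i<?M. if i = x mod ?M then 1 else (0::complex))"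
          by (intro sum.cong) auto
        then show ?thesis using cop M by simp
      next
        case False
        then have "\<not> [i * q = 1] (mod ?M)" for i
          using coprime_iff_invertible_nat[of q ?M] by (metis One_nat_def coprime_commute mult.commute)
        then show ?thesis using False by simp
      qed
      also have "\<dots> = (\<Sum>i<?M. if ?M dvd i * q then v i else 0)"
      proof (rule sum_of_roots_parametrized[OF M, symmetric])
        show "prim_root F D ^ l = 1 \<longleftrightarrow> D dvd l" if "D dvd ?M" for D l
          using that M by (intro prim_root) (rule dvd_pos_nat)
        show "\<exists>l. [i * l = gcd i ?M] (mod ?M) \<and> v i = prim_root F (?M div gcd i ?M) ^ l" if "i < ?M" for i
          using loc(3)[of "p' i"] r pp'[OF that] unfolding F_def v_def by simp
      qed
      also have "\<dots> = (\<Sum>i<?M. if ?M dvd p i * q then v (p i) else 0)"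
        by (rule sum.reindex_bij_betw[OF bij, symmetric])
      also have "\<dots> = (\<Sum>i<?M. lie_val K g (X i) a)"
        using lp_dvd[OF g, of _ a] True p'p
        by (intro sum.cong) (auto simp: lie_val_def XK v_def)
      finally show ?thesis .
    qed
  qed
  then show ?thesis by (simp add: X_def)
qed

text \<open>A step of the twisted map is a step of \<open>y\<close>, possibly preceded by one of
  \<open>g\<close>. Conversely a step of \<open>y\<close> is a twisted step taken from the preimage
  of the point under the twist, and that preimage lies in the same block by symmetry.\<close>

lemma block_twist:
  assumes g: "signed_perm g" and y: "signed_perm y" and a: "a \<in> S" and c: "c \<in> S"
  shows "block (y \<circ> twist g a) g c = block y g c"
proof -
  have t: "signed_perm (twist g a)" using twist_Z[OF g a] by (simp add: Z_iff)
  have yt: "signed_perm (y \<circ> twist g a)" by (rule sp_comp[OF y t])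
  have tw: "twist g a b = (if b \<in> cyc_supp g a then g b else b)" for b
    by (simp add: twist_def perm_restrict_def)
  have g1: "g b \<in> block v g b" for v b by (rule block_step(2)[OF block_refl])
  show ?thesis
  proof (intro equalityI)
    show "block (y \<circ> twist g a) g c \<subseteq> block y g c"
      unfolding block_def
    proof (rule reach_mono[OF _ _ c])
      fix f b assume f: "f \<in> {y \<circ> twist g a, g, uminus}" and "b \<in> S"
      have "twist g a b \<in> block y g b" using g1 block_refl by (simp add: tw)
      then have "(y \<circ> twist g a) b \<in> block y g b" by (auto intro: block_step)
      then show "f b \<in> reach {y, g, uminus} b"
        using f block_step(2,3)[OF block_refl] unfolding block_def by auto
    qed (rule gens_S(1)[OF _ y g])
    show "block y g c \<subseteq> block (y \<circ> twist g a) g c"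
      unfolding block_def
    proof (rule reach_mono[OF _ _ c])
      fix f b assume f: "f \<in> {y, g, uminus}" and b: "b \<in> S"
      let ?b = "pinv (twist g a) b"
      have tb: "twist g a ?b = b" by (rule sp_inv(3)[OF t])
      then have bS: "?b \<in> S" using sp_in[OF t] b by metis
      have "b \<in> block (y \<circ> twist g a) g ?b" using tb tw[of ?b] g1 block_refl by metis
      then have "?b \<in> block (y \<circ> twist g a) g b" by (rule block_sym[OF yt g bS])
      then have "(y \<circ> twist g a) ?b \<in> block (y \<circ> twist g a) g b" by (rule block_step)
      then have "y b \<in> block (y \<circ> twist g a) g b" by (simp add: tb)
      then show "f b \<in> reach {y \<circ> twist g a, g, uminus} b"
        using f block_step(2,3)[OF block_refl] unfolding block_def by auto
    qed (rule gens_S(1)[OF _ yt g])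
  qed
qed

lemma mins_block_unique:
  assumes "signed_perm y" "signed_perm g" "a \<in> mins y g" "c \<in> mins y g" "b \<in> block y g a" "b \<in> block y g c"
  shows "a = c"
  using assms block_eq[of y g a b] block_eq[of y g c b] unfolding mins_def by auto

text \<open>The twist moves only points of the block of \<open>a\<close>, and the powers of
  \<open>y\<close> never leave the different block of \<open>c\<close>.\<close>

lemma twist_local:
  assumes g: "signed_perm g" and y: "signed_perm y" and ac: "a \<in> mins y g" "c \<in> mins y g" "a \<noteq> c"
  shows "((y \<circ> twist g a ^^ i) ^^ l) c = (y ^^ l) c"
proof (induction l)
  case (Suc l)
  have a: "a \<in> S" using ac by (simp add: mins_def)
  have "(y ^^ l) c \<in> block y g c" by (rule block_pow[OF block_refl])
  moreover have "cyc_supp g a \<subseteq> block y g a"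
    unfolding supp_reach[OF g] block_def
    by (rule reach_mono[of _ S]) (use a gens_S[OF _ y g] in \<open>auto intro: reach.intros\<close>)
  ultimately have "(y ^^ l) c \<notin> cyc_supp g a" using mins_block_unique[OF y g ac(1,2)] ac(3) by blast
  then show ?case using Suc twist_pow[OF g a, of i "(y ^^ l) c"] by simp
qed simp

text \<open>
  The factors are exchanged one orbit at a time. Composing $y$ with powers of a cycle of $g$ through
  the orbit's minimum permutes the summands and changes only the factor of that orbit.
\<close>

lemma sum_root_ind_eq_sum_lie_val:
  assumes g: "signed_perm g"
  shows "(\<Sum>y\<in>Z g. \<Prod>c\<in>mins y g. root_ind K g y c) = (\<Sum>y\<in>Z g. \<Prod>c\<in>mins y g. lie_val K g y c)"
proof -
  \<comment> \<open>Interpolates between the two products: \<open>J\<close> holds the points at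
    which the factor has already been exchanged. Adding \<open>a\<close> to \<open>J\<close> matters
    only for those \<open>y\<close> that have \<open>a\<close> as a minimum, collected in
    \<open>Y\<close> below.\<close>
  define val where "val J y c = (if c \<in> J then lie_val K g y c else root_ind K g y c)" for J y c
  have step: "(\<Sum>y\<in>Z g. \<Prod>c\<in>mins y g. val J y c) = (\<Sum>y\<in>Z g. \<Prod>c\<in>mins y g. val (insert a J) y c)"
    if aJ: "a \<notin> J" and a: "a \<in> S" for a J
  proof -
    define Y where "Y = {y \<in> Z g. a \<in> mins y g}"
    define R where "R y = (\<Prod>c\<in>mins y g - {a}. val J y c)" for y
    let ?M = "least_power g a"
    define tau where "tau i y = y \<circ> twist g a ^^ i" for i and y :: "int \<Rightarrow> int"
    have fm: "finite (mins y g)" for y using fin by (simp add: mins_def)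
    have tZ: "tau i y \<in> Z g" if "y \<in> Z g" for y i
      unfolding tau_def by (rule Z_comp[OF that Z_pow[OF twist_Z[OF g a]]])
    have blk: "block (tau i y) g c = block y g c" if y: "y \<in> Z g" and c: "c \<in> S" for y i c
    proof (induction i)
      case 0 show ?case by (simp add: tau_def)
    next
      case (Suc i)
      have "tau (Suc i) y = tau i y \<circ> twist g a" by (simp add: tau_def comp_assoc funpow_Suc_right del: funpow.simps)
      moreover have "signed_perm (tau i y)" using tZ[OF y, of i] by (simp add: Z_iff)
      ultimately show ?case using block_twist[OF g _ a c, of "tau i y"] Suc by (simp only:)
    qed
    have mn: "mins (tau i y) g = mins y g" if "y \<in> Z g" for y i
      using blk[OF that] by (auto simp: mins_def)
    have RY: "R (tau i y) = R y" if "y \<in> Y" for y i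
    proof -
      have y: "y \<in> Z g" "signed_perm y" "a \<in> mins y g" using that by (auto simp: Y_def Z_iff)
      have "val J (tau i y) c = val J y c" if "c \<in> mins y g - {a}" for c
        using twist_local[OF g y(2,3), where c = c and i = i] that
        by (simp add: val_def root_ind_def lie_val_def tau_def)
      then show ?thesis unfolding R_def mn[OF y(1)] by (intro prod.cong) auto
    qed
    have finY: "finite Y" using finite_Z by (simp add: Y_def)
    have bij: "bij_betw (tau i) Y Y" for i
    proof -
      have "tau i ` Y \<subseteq> Y" using tZ mn by (auto simp: Y_def)
      moreover have "inj_on (tau i) Y"
      proof (rule inj_onI)
        fix y z assume "tau i y = tau i z"
        moreover have "surj (twist g a ^^ i)"
          using sp_pow[of "twist g a" i] twist_Z[OF g a] permutes_surj[of "twist g a ^^ i" S] by (simp add: Z_iff signed_perm_def)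
        ultimately show "y = z" unfolding tau_def by (metis fun.map_id surj_iff o_assoc comp_id)
      qed
      ultimately show ?thesis using finY by (simp add: bij_betw_def endo_inj_surj)
    qed
    have avg: "of_nat ?M * (\<Sum>y\<in>Y. f y * R y) = (\<Sum>y\<in>Y. (\<Sum>i<?M. f (tau i y)) * R y)" for f
    proof -
      have "of_nat ?M * (\<Sum>y\<in>Y. f y * R y) = (\<Sum>i<?M. \<Sum>y\<in>Y. f y * R y)" by simp
      also have "\<dots> = (\<Sum>i<?M. \<Sum>y\<in>Y. f (tau i y) * R (tau i y))"
        by (rule sum.cong[OF refl], rule sum.reindex_bij_betw[OF bij, symmetric])
      also have "\<dots> = (\<Sum>y\<in>Y. \<Sum>i<?M. f (tau i y) * R (tau i y))" by (rule sum.swap)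
      also have "\<dots> = (\<Sum>y\<in>Y. (\<Sum>i<?M. f (tau i y)) * R y)"
        by (rule sum.cong[OF refl]) (simp add: RY sum_distrib_right)
      finally show ?thesis .
    qed
    have "of_nat ?M * (\<Sum>y\<in>Y. root_ind K g y a * R y) = of_nat ?M * (\<Sum>y\<in>Y. lie_val K g y a * R y)"
      unfolding avg by (rule sum.cong[OF refl]) (simp add: tau_def local_sum[OF g _ a] Y_def)
    then have eqY: "(\<Sum>y\<in>Y. root_ind K g y a * R y) = (\<Sum>y\<in>Y. lie_val K g y a * R y)"
      using lp_pos[OF g, of a] by simp
    have split: "(\<Sum>y\<in>Z g. f y) = (\<Sum>y\<in>Y. f y) + (\<Sum>y\<in>Z g - Y. f y)" for f :: "_ \<Rightarrow> complex"
      using finite_Z by (subst sum.subset_diff[of Y]) (auto simp: Y_def add.commute)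
    have "(\<Prod>c\<in>mins y g. val J y c) = root_ind K g y a * R y"
      "(\<Prod>c\<in>mins y g. val (insert a J) y c) = lie_val K g y a * R y" if "y \<in> Y" for y
      using that aJ fm[of y] unfolding Y_def R_def
      by (auto simp: prod.remove[of _ a] val_def intro!: prod.cong)
    moreover have "(\<Prod>c\<in>mins y g. val J y c) = (\<Prod>c\<in>mins y g. val (insert a J) y c)" if "y \<in> Z g - Y" for y
      using that by (intro prod.cong) (auto simp: Y_def val_def)
    ultimately show ?thesis unfolding split using eqY by simp
  qed
  have "(\<Sum>y\<in>Z g. \<Prod>c\<in>mins y g. val {} y c) = (\<Sum>y\<in>Z g. \<Prod>c\<in>mins y g. val J y c)" if "J \<subseteq> S" for J
    using finite_subset[OF that fin] that
  proof (induction J rule: finite_induct)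
    case (insert a J)
    then show ?case using step[of a J] by simp
  qed simp
  from this[OF order_refl]
  have "(\<Sum>y\<in>Z g. \<Prod>c\<in>mins y g. val {} y c) = (\<Sum>y\<in>Z g. \<Prod>c\<in>mins y g. val S y c)" .
  moreover have "(\<Prod>c\<in>mins y g. val S y c) = (\<Prod>c\<in>mins y g. lie_val K g y c)" for y
    by (rule prod.cong) (auto simp: val_def mins_def)
  ultimately show ?thesis by (simp add: val_def)
qed

lemma mins_cover:
  assumes "signed_perm y" "signed_perm g" "a \<in> S"
  obtains c where "c \<in> mins y g" "a \<in> block y g c"
proof -
  let ?c = "Min (block y g a)"
  have "finite (block y g a)" using finite_subset[OF block_subset[OF assms] fin] .
  then have c: "?c \<in> block y g a" using block_refl by (intro Min_in) auto
  then have "block y g ?c = block y g a" by (rule block_eq[OF assms])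
  then show thesis using that[of ?c] c block_subset[OF assms] block_refl by (auto simp: mins_def subset_iff)
qed

text \<open>A signed permutation commuting with \<open>y\<close> and \<open>g\<close> is determined
  on a whole block by its value at one point. Thus \<open>y^K = g\<close> and
  \<open>y^K = id\<close> can be tested at the minima, which turns their indicators into products of
  local factors.\<close>

lemma sp_eq_on_mins:
  assumes y: "signed_perm y" and g: "signed_perm g" and u: "signed_perm u" "signed_perm v"
    and comm: "\<And>a. u (y a) = y (u a)" "\<And>a. v (y a) = y (v a)" "\<And>a. u (g a) = g (u a)" "\<And>a. v (g a) = g (v a)"
  shows "u = v \<longleftrightarrow> (\<forall>c\<in>mins y g. u c = v c)"
proof
  assume *: "\<forall>c\<in>mins y g. u c = v c"
  show "u = v"
  proof
    fix a show "u a = v a"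
    proof (cases "a \<in> S")
      case True
      obtain c where c: "c \<in> mins y g" "a \<in> block y g c" using mins_cover[OF y g True] .
      from c(2) show ?thesis unfolding block_def
      proof induction
        case (step b f)
        then show ?case using comm sp_neg[OF u(1)] sp_neg[OF u(2)] by auto
      qed (use c(1) * in blast)
    next
      case False
      then show ?thesis using u sp_permutes permutes_not_in by metis
    qed
  qed
qed auto

theorem roots_eq_sum_Omega:
  assumes g: "signed_perm g"
  shows "of_nat (card {h. signed_perm h \<and> h ^^ K = g}) = (\<Sum>y\<in>{y \<in> Z g. y ^^ K = id}. Omega y g)"
proof -
  have 1: "(\<Prod>c\<in>mins y g. root_ind K g y c) = (if y ^^ K = g then 1 else 0)" if "y \<in> Z g" for y
  proof -
    have y: "signed_perm y" "\<And>a. y (g a) = g (y a)" using that by (auto simp: Z_iff)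
    have "y ^^ K = g \<longleftrightarrow> (\<forall>c\<in>mins y g. (y ^^ K) c = g c)"
      using y(2) funpow_commute[of y g K 1, OF y(2)] sp_pow[OF y(1)]
      by (intro sp_eq_on_mins[OF y(1) g _ g]) (auto simp: funpow_swap1)
    moreover have "finite (mins y g)" using fin by (simp add: mins_def)
    ultimately show ?thesis by (auto simp: root_ind_def prod_zero_iff)
  qed
  have 2: "(\<Prod>c\<in>mins y g. lie_val K g y c) = (if y ^^ K = id then Omega y g else 0)" if "y \<in> Z g" for y
  proof -
    have y: "signed_perm y" "\<And>a. y (g a) = g (y a)" using that by (auto simp: Z_iff)
    have "y ^^ K = id \<longleftrightarrow> (\<forall>c\<in>mins y g. (y ^^ K) c = id c)"
      using y(2) funpow_commute[of y g K 1, OF y(2)] sp_pow[OF y(1)]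
      by (intro sp_eq_on_mins[OF y(1) g _ sp_id]) (auto simp: funpow_swap1)
    moreover have "finite (mins y g)" using fin by (simp add: mins_def)
    ultimately show ?thesis by (auto simp: lie_val_def Omega_def prod_zero_iff)
  qed
  have "{h. signed_perm h \<and> h ^^ K = g} = {y \<in> Z g. y ^^ K = g}"
    by (auto simp: Z_iff funpow_swap1)
  then have "of_nat (card {h. signed_perm h \<and> h ^^ K = g}) = (\<Sum>y\<in>Z g. if y ^^ K = g then 1 else (0::complex))"
    using finite_Z by (simp add: sum.inter_filter[symmetric])
  also have "\<dots> = (\<Sum>y\<in>Z g. if y ^^ K = id then Omega y g else 0)"
    using sum_root_ind_eq_sum_lie_val[OF g, of K] 1 2 by simp
  also have "\<dots> = (\<Sum>y\<in>{y \<in> Z g. y ^^ K = id}. Omega y g)"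
    using finite_Z by (simp add: sum.inter_filter)
  finally show ?thesis .
qed

section \<open>Evaluation of the linear character\<close>

text \<open>\<open>c\<close> arises from \<open>b\<close> by a power of \<open>x\<close> and
  possibly a sign, and both commute with all powers of \<open>x\<close>. This supplies the last two
  hypotheses of \<open>extension\<close> when a base point is moved inside its signed cycle.\<close>

lemma supp_pow_eq_iff:
  assumes x: "signed_perm x" and c: "c \<in> cyc_supp x b"
  shows "(x ^^ i) b = (x ^^ j) b \<longleftrightarrow> (x ^^ i) c = (x ^^ j) c"
    and "(x ^^ i) b = - (x ^^ j) b \<longleftrightarrow> (x ^^ i) c = - (x ^^ j) c"
proof -
  obtain k where k: "c = (x ^^ k) b \<or> c = - (x ^^ k) b" using assms by (auto simp: supp_iff)
  have comm: "(x ^^ i) ((x ^^ k) b) = (x ^^ k) ((x ^^ i) b)" for i by (rule funpow_commute) simp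
  have "(x ^^ i) c = (x ^^ k) ((x ^^ i) b) \<and> (x ^^ j) c = (x ^^ k) ((x ^^ j) b) \<or>
    (x ^^ i) c = - (x ^^ k) ((x ^^ i) b) \<and> (x ^^ j) c = - (x ^^ k) ((x ^^ j) b)"
    using k comm sp_pow_neg[OF x] by auto
  then show "(x ^^ i) b = (x ^^ j) b \<longleftrightarrow> (x ^^ i) c = (x ^^ j) c"
    "(x ^^ i) b = - (x ^^ j) b \<longleftrightarrow> (x ^^ i) c = - (x ^^ j) c"
    using sp_inj[OF sp_pow[OF x], of k] sp_pow_neg[OF x, of k "(x ^^ j) b", symmetric] by auto
qed

lemma restrict_supp_Z:
  assumes "signed_perm x" "a \<in> S" "z \<in> Z x" "z a \<in> cyc_supp x a"
  shows "perm_restrict z (cyc_supp x a) \<in> Z x"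
proof (rule restrict_Z[OF assms(1,3)])
  show "b \<in> cyc_supp x a \<Longrightarrow> b \<in> S" for b using supp_subset assms by blast
  show "b \<in> cyc_supp x a \<Longrightarrow> z b \<in> cyc_supp x a" for b
    using supp_Z[OF assms(1,3), of b a] supp_eq[OF assms(1,2,4)] by simp
  show "b \<in> cyc_supp x a \<Longrightarrow> cyc_supp x b \<subseteq> cyc_supp x a" for b using supp_eq assms by blast
qed

lemma restrict_uminus_Z:
  assumes "signed_perm x" "a \<in> S"
  shows "perm_restrict uminus (cyc_supp x a) \<in> Z x"
proof -
  let ?U = "cyc_supp x a"
  have n: "- b \<in> ?U \<longleftrightarrow> b \<in> ?U" for b
    using supp_step(2)[OF assms(1), of b a] supp_step(2)[OF assms(1), of "- b" a] by auto
  have "signed_perm (perm_restrict uminus ?U)"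
    by (rule sp_intro) (use n neg supp_subset[OF assms] in \<open>auto simp: perm_restrict_def split: if_splits\<close>)
  then show ?thesis
    using g_supp_iff[OF assms] sp_neg[OF assms(1)] by (auto simp: Z_iff perm_restrict_def)
qed

end

text \<open>Kept apart from faithfulness because it is instantiated a second time at
  \<open>x_std\<close>, with the same \<omega> and \<open>B\<close>.\<close>

locale stabilizer_trivial_character = signed_set +
  fixes x :: "int \<Rightarrow> int" and \<omega> :: "(int \<Rightarrow> int) \<Rightarrow> complex" and B :: "int set"
  assumes x: "signed_perm x"
    and mult: "\<And>z w. z \<in> Z x \<Longrightarrow> w \<in> Z x \<Longrightarrow> \<omega> (z \<circ> w) = \<omega> z * \<omega> w"
    and nonzero: "\<And>z. z \<in> Z x \<Longrightarrow> \<omega> z \<noteq> 0"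
    and B: "transversal x B"
    and stab: "\<And>z. z \<in> Z x \<Longrightarrow> z ` B = B \<Longrightarrow> \<omega> z = 1"
begin

lemma id_Z: "id \<in> Z x"
  by (simp add: Z_iff sp_id)

lemma omega_id: "\<omega> id = 1"
  by (rule stab[OF id_Z]) simp

lemma omega_pow: "z \<in> Z x \<Longrightarrow> \<omega> (z ^^ i) = \<omega> z ^ i"
proof (induction i)
  case 0 show ?case unfolding funpow.simps(1) power_0 by (rule omega_id)
next
  case (Suc i)
  then show ?case unfolding funpow.simps(2) power_Suc mult[OF Suc.prems Z_pow[OF Suc.prems]] by simp
qed

lemma pinv_comp: "z \<in> Z x \<Longrightarrow> z \<circ> (pinv z \<circ> w) = w"
  using sp_inv(3) by (auto simp: Z_iff)

text \<open>Some \<open>t\<close> in the centralizer carries \<open>B\<close> to \<open>B'\<close>,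
  so conjugation by \<open>t\<close> relates the two stabilizers, and a multiplicative function with
  nonzero complex values does not see conjugation.\<close>

lemma stab_any:
  assumes B': "transversal x B'" and z: "z \<in> Z x" "z ` B' = B'"
  shows "\<omega> z = 1"
proof -
  define f where "f b = (THE c. c \<in> B' \<inter> cyc_supp x b)" for b
  have f: "f b \<in> B' \<inter> cyc_supp x b" if "b \<in> S" for b
    unfolding f_def by (rule theI') (use B' that in \<open>auto simp: transversal_def\<close>)
  have BS: "b \<in> S" if "b \<in> B" for b using that B by (auto simp: transversal_def)
  have B'S: "b \<in> S" if "b \<in> B'" for b using that B' by (auto simp: transversal_def)
  obtain t where t: "signed_perm t" "\<And>a. t (x a) = x (t a)" "\<And>b. b \<in> B \<Longrightarrow> t b = f b"
  proof (rule extension[OF x x B])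
    show "f ` B \<subseteq> S" using f BS B'S by blast
    fix b c assume bc: "b \<in> B" "c \<in> B" "f b \<in> cyc_supp x (f c)"
    have "b \<in> cyc_supp x (f b)" using f BS bc supp_sym[OF x] by blast
    moreover have "f c \<in> cyc_supp x c" using f BS bc by blast
    ultimately have "b \<in> cyc_supp x c" using bc(3) supp_trans[OF x] by blast
    then show "b = c" using transversal_unique[OF x B] bc by blast
  next
    fix b i j assume "b \<in> B"
    then have "f b \<in> cyc_supp x b" using f BS by blast
    then show "(x ^^ i) b = (x ^^ j) b \<longleftrightarrow> (x ^^ i) (f b) = (x ^^ j) (f b)"
      "(x ^^ i) b = - (x ^^ j) b \<longleftrightarrow> (x ^^ i) (f b) = - (x ^^ j) (f b)"
      by (rule supp_pow_eq_iff[OF x])+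
  qed (use that in blast)
  have tZ: "t \<in> Z x" using t by (simp add: Z_iff)
  have "B' \<subseteq> f ` B"
  proof
    fix b' assume b': "b' \<in> B'"
    then obtain b where b: "b \<in> B" "b \<in> cyc_supp x b'" using B B'S unfolding transversal_def by blast
    then have "b' \<in> cyc_supp x b" using supp_sym[OF x] B'S[OF b'] by blast
    then have "b' \<in> cyc_supp x (f b)" using f[OF BS[OF b(1)]] supp_sym[OF x BS[OF b(1)]] supp_trans[OF x] by blast
    then show "b' \<in> f ` B" using transversal_unique[OF x B' b'] f[OF BS[OF b(1)]] b(1) by blast
  qed
  then have tB: "t ` B = B'" using t(3) f BS by auto
  let ?w = "pinv t \<circ> (z \<circ> t)"
  have w: "?w \<in> Z x" by (intro Z_comp Z_inv tZ z)
  have "?w ` B = pinv t ` z ` t ` B" by (simp add: image_image)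
  also have "\<dots> = pinv t ` t ` B" using tB z by simp
  also have "\<dots> = B" using sp_inv(2)[OF t(1)] by (simp add: image_image)
  finally have "\<omega> ?w = 1" by (rule stab[OF w])
  then have "\<omega> (z \<circ> t) = \<omega> t"
    using mult[OF tZ w] unfolding pinv_comp[OF tZ] by (simp only: mult_1_right)
  then show ?thesis using mult[OF z(1) tZ] nonzero[OF tZ] by simp
qed

text \<open>
  The points $z^t c$ with $c$ a minimum and $t$ below its return time form a transversal. On it $z$
  agrees, up to a permutation of the transversal, with the element $w$ of the base group that acts as
  the return map on the cycle of each $c$ and trivially elsewhere; hence $\omega(z) = \omega(w)$.
\<close>

lemma omega_eq_Omega:
  assumes val: "\<And>a. a \<in> S \<Longrightarrow> \<omega> (twist x a) = cis (2 * pi / real (least_power x a))"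
    and sgn: "\<And>a. a \<in> S \<Longrightarrow> (\<forall>i. (x ^^ i) a \<noteq> - a) \<Longrightarrow> \<omega> (perm_restrict uminus (cyc_supp x a)) = 1"
    and z: "z \<in> Z x"
  shows "\<omega> z = Omega x z"
proof -
  define M where "M = mins x z"
  define s where "s c = return_time (\<lambda>i. (x ^^ i) c) (\<lambda>i. (z ^^ i) c)" for c
  define U where "U c = cyc_supp x c" for c
  define k where "k c = perm_restrict (z ^^ s c) (U c)" for c
  have zs: "signed_perm z" using z by (simp add: Z_iff)
  have MS: "c \<in> S" if "c \<in> M" for c using that by (simp add: M_def mins_def)
  have finM: "finite M" using fin by (simp add: M_def mins_def)
  have s: "s c > 0" "\<And>t. 0 < t \<Longrightarrow> (z ^^ t) c \<in> U c \<Longrightarrow> s c \<le> t" "(z ^^ s c) c \<in> U c" for c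
    using Cval_spec[OF x z, of c] unfolding s_def U_def by metis+
  have Usub: "U c \<subseteq> block x z c" if "c \<in> M" for c
    unfolding U_def supp_reach[OF x] block_def
    by (rule reach_mono[of _ S]) (use MS[OF that] gens_S[OF _ x zs] in \<open>auto intro: reach.intros\<close>)
  have Uz: "(z ^^ t) c \<in> block x z c" for t c by (rule block_pow(2)[OF block_refl])
  have uniq: "c = c'" if "c \<in> M" "c' \<in> M" "b \<in> block x z c" "b \<in> block x z c'" for b c c'
    using mins_block_unique[OF x zs] that unfolding M_def by blast
  have kZ: "k c \<in> Z x" if "c \<in> M" for c
    unfolding k_def U_def by (rule restrict_supp_Z[OF x MS[OF that] Z_pow[OF z]]) (use s in \<open>simp add: U_def\<close>)
  have "\<omega> (k c) = Cval x z c" if c: "c \<in> M" for c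
  proof -
    obtain j where j: "(z ^^ s c) c = (x ^^ j) c \<or> (z ^^ s c) c = - (x ^^ j) c \<and> (\<forall>i. (x ^^ i) c \<noteq> - c)"
      and L: "Cval x z c = cis (2 * pi / real (least_power x c)) ^ j"
      using Cval_spec[OF x z, of c] unfolding s_def by metis
    note tw = twist_Z[OF x MS[OF c]]
    have comm: "(z ^^ s c) ((x ^^ i) b) = (x ^^ i) ((z ^^ s c) b)" for i b
      by (rule funpow_commute) (use z in \<open>simp add: Z_iff\<close>)
    have comm2: "(x ^^ j) ((x ^^ i) b) = (x ^^ i) ((x ^^ j) b)" for i b
      by (rule funpow_commute) simp
    have tL: "\<omega> (twist x c ^^ j) = Cval x z c" using omega_pow[OF tw] val[OF MS[OF c]] L by simp
    from j show ?thesis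
    proof
      assume eq: "(z ^^ s c) c = (x ^^ j) c"
      have "(z ^^ s c) d = (x ^^ j) d" if "d \<in> U c" for d
        using that x comm comm2 eq sp_pow_neg[OF x] sp_pow_neg[OF zs] by (auto simp: U_def supp_iff)
      then have "k c = twist x c ^^ j"
        by (auto simp: fun_eq_iff k_def perm_restrict_def twist_pow[OF x MS[OF c]] U_def)
      then show ?thesis using tL by simp
    next
      assume eq: "(z ^^ s c) c = - (x ^^ j) c \<and> (\<forall>i. (x ^^ i) c \<noteq> - c)"
      have "(z ^^ s c) d = - (x ^^ j) d" if "d \<in> U c" for d
        using that x comm comm2 eq sp_pow_neg[OF x] sp_pow_neg[OF zs] by (auto simp: U_def supp_iff)
      then have "k c = perm_restrict uminus (U c) \<circ> twist x c ^^ j"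
        using supp_pow[OF x] by (auto simp: fun_eq_iff k_def perm_restrict_def twist_pow[OF x MS[OF c]] U_def)
      then show ?thesis
        using tL sgn[OF MS[OF c]] eq mult[OF restrict_uminus_Z[OF x MS[OF c]] Z_pow[OF tw]] by (simp add: U_def)
    qed
  qed
  then have Om: "Omega x z = (\<Prod>c\<in>M. \<omega> (k c))" by (simp add: Omega_def M_def)
  \<comment> \<open>\<open>w\<close> is the product of the \<open>k c\<close>, built one factor at a
    time; different minima have disjoint signed cycles, so each factor survives unchanged.\<close>
  have "\<exists>w\<in>Z x. (\<forall>c\<in>F. \<forall>d\<in>U c. w d = (z ^^ s c) d) \<and> (\<forall>d. (\<forall>c\<in>F. d \<notin> U c) \<longrightarrow> w d = d) \<and>
      \<omega> w = (\<Prod>c\<in>F. \<omega> (k c))" if "F \<subseteq> M" for F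
    using finite_subset[OF that finM] that
  proof (induction F rule: finite_induct)
    case empty
    show ?case by (rule bexI[OF _ id_Z]) (simp add: omega_id[unfolded id_def])
  next
    case (insert c F)
    then obtain w where w: "w \<in> Z x" "\<And>c d. c \<in> F \<Longrightarrow> d \<in> U c \<Longrightarrow> w d = (z ^^ s c) d"
      "\<And>d. (\<forall>c\<in>F. d \<notin> U c) \<Longrightarrow> w d = d" "\<omega> w = (\<Prod>c\<in>F. \<omega> (k c))" by auto
    have c: "c \<in> M" using insert by simp
    have disj: "d \<notin> U c'" if "c' \<in> F" "d \<in> U c" for c' d
      using uniq[OF c, of c' d] Usub[OF c] Usub[of c'] that insert by blast
    have UU: "(z ^^ s c') d \<in> U c'" if "c' \<in> F" "d \<in> U c'" for c' d
      using supp_Z[OF x Z_pow[OF z], of "s c'" d c'] that s(3)[of c'] supp_eq[OF x, of c'] MS insert.prems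
      unfolding U_def by blast
    have 1: "(k c \<circ> w) d = (z ^^ s c) d" if "d \<in> U c" for d
      using w(3)[of d] disj that by (auto simp: k_def perm_restrict_def)
    have 2: "(k c \<circ> w) d = (z ^^ s c') d" if "c' \<in> F" "d \<in> U c'" for c' d
      using w(2)[OF that] UU[OF that] disj[OF that(1)] by (auto simp: k_def perm_restrict_def)
    have 3: "(k c \<circ> w) d = d" if "\<forall>c\<in>insert c F. d \<notin> U c" for d
      using w(3)[of d] that by (auto simp: k_def perm_restrict_def)
    show ?case
    proof (intro bexI conjI ballI allI impI)
      show "k c \<circ> w \<in> Z x" by (rule Z_comp[OF kZ[OF c] w(1)])
      show "\<omega> (k c \<circ> w) = (\<Prod>c\<in>insert c F. \<omega> (k c))"
        using insert.hyps w(4) mult[OF kZ[OF c] w(1)] by simp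
    qed (use 1 2 3 in blast)+
  qed
  from this[OF order_refl] obtain w where w: "w \<in> Z x" "\<And>c d. c \<in> M \<Longrightarrow> d \<in> U c \<Longrightarrow> w d = (z ^^ s c) d"
      "\<And>d. (\<forall>c\<in>M. d \<notin> U c) \<Longrightarrow> w d = d" "\<omega> w = Omega x z" unfolding Om by blast
  define B' where "B' = {(z ^^ t) c | c t. c \<in> M \<and> t < s c}"
  have Umul: "(z ^^ (s c * m)) c \<in> U c" if "c \<in> M" for c m
  proof (induction m)
    case (Suc m)
    have "(z ^^ (s c * Suc m)) c = (z ^^ s c) ((z ^^ (s c * m)) c)" by (simp add: funpow_add)
    also have "\<dots> \<in> cyc_supp x ((z ^^ s c) c)" using supp_Z[OF x Z_pow[OF z]] Suc by (simp add: U_def)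
    also have "\<dots> = U c" using s(3)[of c] supp_eq[OF x MS[OF that]] by (simp add: U_def)
    finally show ?case .
  qed (simp add: U_def supp_refl[OF x])
  have B'S: "B' \<subseteq> S" using MS sp_in[OF sp_pow[OF zs]] by (auto simp: B'_def)
  have trans: "transversal x B'"
    unfolding transversal_def
  proof (intro conjI ballI B'S)
    fix a assume a: "a \<in> S"
    obtain c where c: "c \<in> M" "a \<in> block x z c" using mins_cover[OF x zs a] unfolding M_def .
    obtain i j where ij: "a = (x ^^ i) ((z ^^ j) c) \<or> a = - (x ^^ i) ((z ^^ j) c)"
      using block_explicit[OF x zs z c(2)] by blast
    then have "a \<in> cyc_supp x ((z ^^ j) c)" using x by (auto simp: supp_iff)
    moreover have "(z ^^ j) c \<in> cyc_supp x ((z ^^ (j mod s c)) c)"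
    proof -
      have "(z ^^ j) c = (z ^^ (j mod s c)) ((z ^^ (s c * (j div s c))) c)"
        by (metis add.commute funpow_add mult_div_mod_eq o_apply)
      then show ?thesis using supp_Z[OF x Z_pow[OF z]] Umul[OF c(1)] by (simp add: U_def)
    qed
    ultimately have "a \<in> cyc_supp x ((z ^^ (j mod s c)) c)" by (rule supp_trans[OF x])
    then have 1: "(z ^^ (j mod s c)) c \<in> cyc_supp x a"
      using supp_sym[OF x] sp_in[OF sp_pow[OF zs]] MS[OF c(1)] by blast
    show "\<exists>!b. b \<in> B' \<inter> cyc_supp x a"
    proof (rule ex_ex1I)
      show "\<exists>b. b \<in> B' \<inter> cyc_supp x a" 
        using 1 c(1) mod_less_divisor[OF s(1)[of c]] unfolding B'_def by blast
      have aux: "t = t'" if "c \<in> M" "t \<le> t'" "t' < s c" "(z ^^ t) c \<in> cyc_supp x a" "(z ^^ t') c \<in> cyc_supp x a" for t t' c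
      proof (rule ccontr)
        assume "t \<noteq> t'"
        have "(z ^^ t') c \<in> cyc_supp x ((z ^^ t) c)" using that supp_eq[OF x a] by blast
        moreover have "(z ^^ t') c = (z ^^ t) ((z ^^ (t' - t)) c)"
          using that(2) by (metis funpow_add le_add_diff_inverse o_apply)
        ultimately have "(z ^^ (t' - t)) c \<in> U c" using supp_Z[OF x Z_pow[OF z]] by (simp add: U_def)
        then show False using s(2)[of "t' - t" c] \<open>t \<noteq> t'\<close> that(2,3) by simp
      qed
      fix b b' assume "b \<in> B' \<inter> cyc_supp x a" "b' \<in> B' \<inter> cyc_supp x a"
      then obtain c t c' t' where ct: "b = (z ^^ t) c" "c \<in> M" "t < s c" "b' = (z ^^ t') c'" "c' \<in> M" "t' < s c'"
        and ba: "b \<in> cyc_supp x a" "b' \<in> cyc_supp x a" unfolding B'_def by blast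
      have "b' \<in> cyc_supp x b" using ba supp_eq[OF x a] by blast
      moreover have "cyc_supp x b \<subseteq> block x z b" 
        unfolding supp_reach[OF x] block_def
        by (rule reach_mono[of _ S]) (use B'S ct gens_S[OF _ x zs] MS sp_in[OF sp_pow[OF zs]] in \<open>auto intro: reach.intros\<close>)
      ultimately have "b' \<in> block x z c" using Uz[of t c] block_trans ct(1) by blast
      then have "c = c'" using uniq[OF ct(2,5)] Uz[of t' c'] ct(4) by blast
      then show "b = b'" using aux[of c t t'] aux[of c t' t] ct ba by (metis nat_le_linear)
    qed
  qed
  have wB: "w ((z ^^ t) c) = (if t = 0 then (z ^^ s c) c else (z ^^ t) c)" if "c \<in> M" "t < s c" for c t
  proof (cases "t = 0")
    case True
    then show ?thesis using w(2)[OF that(1), of c] supp_refl[OF x] by (simp add: U_def)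
  next
    case False
    have "(z ^^ t) c \<notin> U c'" if "c' \<in> M" for c'
    proof
      assume "(z ^^ t) c \<in> U c'"
      then have "c = c'" using uniq[OF \<open>c \<in> M\<close> that Uz[of t c]] Usub[OF that] by blast
      then show False using s(2)[of t c] \<open>t < s c\<close> False \<open>(z ^^ t) c \<in> U c'\<close> by simp
    qed
    then show ?thesis using w(3) False by simp
  qed
  \<comment> \<open>Both images consist of the points \<open>z^t c\<close> with
    \<open>1 \<le> t \<le> s c\<close>: \<open>z\<close> advances every point by one place, whereas
    \<open>w\<close> moves only \<open>c\<close>, straight to the return point.\<close>
  have "z ` B' = w ` B'"
  proof (intro equalityI subsetI)
    fix b assume "b \<in> z ` B'"
    then obtain c t where ct: "b = (z ^^ Suc t) c" "c \<in> M" "t < s c" by (auto simp: B'_def)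
    show "b \<in> w ` B'"
    proof (cases "Suc t < s c")
      case True
      then have "w ((z ^^ Suc t) c) = b" using wB[OF ct(2) True] ct by simp
      then show ?thesis using True ct(2) unfolding B'_def by blast
    next
      case False
      then have "Suc t = s c" using ct by simp
      then have "w ((z ^^ 0) c) = b" using wB[OF ct(2), of 0] s(1)[of c] ct by simp
      then show ?thesis using s(1)[of c] ct(2) unfolding B'_def by blast
    qed
  next
    fix b assume "b \<in> w ` B'"
    then obtain c t where ct: "b = w ((z ^^ t) c)" "c \<in> M" "t < s c" by (auto simp: B'_def)
    obtain u where u: "b = (z ^^ Suc u) c" "u < s c"
    proof (cases "t = 0")
      case True
      then show ?thesis using that[of "s c - 1"] wB[OF ct(2,3)] ct(1) s(1)[of c] by simp
    next
      case False
      then show ?thesis using that[of "t - 1"] wB[OF ct(2,3)] ct by simp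
    qed
    then have "b = z ((z ^^ u) c)" by simp
    then show "b \<in> z ` B'" using u ct(2) unfolding B'_def by blast
  qed
  then have "(pinv w \<circ> z) ` B' = pinv w ` w ` B'" by (metis image_comp)
  also have "\<dots> = B'" using sp_inv(2)[of w] w(1) by (simp add: image_image Z_iff)
  finally have "\<omega> (pinv w \<circ> z) = 1" by (intro stab_any[OF trans] Z_comp Z_inv w z)
  then have "\<omega> z = \<omega> w"
    using mult[OF w(1) Z_comp[OF Z_inv[OF w(1)] z]] unfolding pinv_comp[OF w(1)] by (simp only: mult_1_right)
  then show ?thesis using w(4) by simp
qed

end

lemma primitive_root_generates:
  fixes w u :: complex
  assumes w: "\<And>l. w ^ l = 1 \<longleftrightarrow> N dvd l" and N: "N > 0" and u: "u ^ N = 1"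
  shows "\<exists>j. u = w ^ j"
proof -
  have w0: "w \<noteq> 0" using w[of N] N by (auto simp: power_0_left)
  have "inj_on (\<lambda>j. w ^ j) {..<N}"
    by (rule inj_onI) (simp add: primitive_root_pow_eq_iff[OF w w0] cong_def)
  then have "card ((\<lambda>j. w ^ j) ` {..<N}) = N" by (simp add: card_image)
  moreover have "(\<lambda>j. w ^ j) ` {..<N} \<subseteq> {z. z ^ N = 1}" using w by (auto simp flip: power_mult)
  moreover have "finite {z::complex. z ^ N = 1}" by (rule finite_roots_unity) (use N in simp)
  ultimately have "(\<lambda>j. w ^ j) ` {..<N} = {z. z ^ N = 1}"
    using card_roots_unity_eq[OF N] by (metis card_subset_eq)
  then show ?thesis using u by blast
qed

section \<open>Conjugation invariance of \<open>Omega\<close> and the induced character at a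
  standard element\<close>

context signed_set
begin

lemma block_intertwine:
  assumes "\<And>a. t (x a) = x' (t a)" "\<And>a. t (z a) = z' (t a)" "\<And>a. t (- a) = - t a" "b \<in> block x z a"
  shows "t b \<in> block x' z' (t a)"
  using assms(4) unfolding block_def
proof induction
  case (step b f)
  have "x' (t b) \<in> reach {x', z', uminus} (t a)" "z' (t b) \<in> reach {x', z', uminus} (t a)"
    "- t b \<in> reach {x', z', uminus} (t a)"
    using reach.step[OF step.IH] by auto
  then show ?case using step(2) assms by auto
qed (rule reach.base)

lemma Min_block_mem:
  assumes "signed_perm x" "signed_perm z" "a \<in> S"
  shows "Min (block x z a) \<in> block x z a" "Min (block x z a) \<in> mins x z"
proof -
  have "finite (block x z a)" using finite_subset[OF block_subset[OF assms] fin] .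
  then show c: "Min (block x z a) \<in> block x z a" using block_refl by (intro Min_in) auto
  show "Min (block x z a) \<in> mins x z"
    using block_eq[OF assms c] c block_subset[OF assms] by (auto simp: mins_def)
qed

text \<open>An intertwiner maps blocks to blocks but ignores the order of the integers.
  Representatives are therefore matched by transporting a minimum and taking the minimum of the new
  block; this is the round trip that makes the matching a bijection.\<close>

lemma Min_block_transport:
  assumes t: "signed_perm t" and x: "signed_perm x" "signed_perm x'" and z: "signed_perm z" "signed_perm z'"
    and tx: "\<And>a. t (x a) = x' (t a)" and tz: "\<And>a. t (z a) = z' (t a)"
    and c: "c \<in> mins x z"
  shows "Min (block x z (pinv t (Min (block x' z' (t c))))) = c"
proof -
  have cS: "c \<in> S" using c by (simp add: mins_def)
  have tc: "t c \<in> S" using cS sp_in[OF t] by blast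
  let ?i = "pinv t"
  have i: "signed_perm ?i" "\<And>a. ?i (t a) = a" "\<And>a. t (?i a) = a" using sp_inv[OF t] by auto
  have ix: "?i (x' a) = x (?i a)" "?i (z' a) = z (?i a)" for a
    using tx[of "?i a"] tz[of "?i a"] i by metis+
  have "?i (Min (block x' z' (t c))) \<in> block x z (?i (t c))"
    by (rule block_intertwine[of ?i x' x z' z]) (use ix sp_neg[OF i(1)] Min_block_mem[OF x(2) z(2) tc] in auto)
  then have "?i (Min (block x' z' (t c))) \<in> block x z c" unfolding i .
  then show ?thesis using block_eq[OF x(1) z(1) cS] c by (simp add: mins_def)
qed

lemma Omega_conj:
  assumes t: "signed_perm t" and x: "signed_perm x" "signed_perm x'" and z: "z \<in> Z x" "z' \<in> Z x'"
    and tx: "\<And>a. t (x a) = x' (t a)" and tz: "\<And>a. t (z a) = z' (t a)"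
  shows "Omega x' z' = Omega x z"
proof -
  have zs: "signed_perm z" "signed_perm z'" using z by (auto simp: Z_iff)
  let ?i = "pinv t"
  have i: "signed_perm ?i" "\<And>a. ?i (t a) = a" "\<And>a. t (?i a) = a" using sp_inv[OF t] by auto
  have ix: "?i (x' a) = x (?i a)" "?i (z' a) = z (?i a)" for a
    using tx[of "?i a"] tz[of "?i a"] i by metis+
  have ii: "pinv ?i = t" using i by (intro inv_equality) auto
  have S: "c \<in> mins u v \<Longrightarrow> c \<in> S" for c u v by (simp add: mins_def)
  have "(\<Prod>a\<in>mins x z. Cval x z a) = (\<Prod>a\<in>mins x' z'. Cval x' z' a)"
  proof (rule prod.reindex_bij_witness[where i = "\<lambda>c. Min (block x z (?i c))" and j = "\<lambda>c. Min (block x' z' (t c))"])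
    fix c assume c: "c \<in> mins x z"
    have tc: "t c \<in> S" using S[OF c] sp_in[OF t] by blast
    show "Min (block x z (?i (Min (block x' z' (t c))))) = c"
      by (rule Min_block_transport[OF t x zs tx tz c])
    show "Min (block x' z' (t c)) \<in> mins x' z'" by (rule Min_block_mem(2)[OF x(2) zs(2) tc])
    have "Cval x' z' (Min (block x' z' (t c))) = Cval x' z' (t c)"
      by (rule Cval_block[OF x(2) z(2) Min_block_mem(1)[OF x(2) zs(2) tc]])
    also have "\<dots> = Cval x z c"
      by (rule Cval_intertwine) (use tx tz sp_neg[OF t] sp_inj[OF t] in \<open>auto simp: inj_def\<close>)
    finally show "Cval x' z' (Min (block x' z' (t c))) = Cval x z c" .
  next
    fix c assume c: "c \<in> mins x' z'"
    have ic: "?i c \<in> S" using S[OF c] sp_in[OF i(1)] by blast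
    show "Min (block x z (?i c)) \<in> mins x z" by (rule Min_block_mem(2)[OF x(1) zs(1) ic])
    show "Min (block x' z' (t (Min (block x z (?i c))))) = c"
      using Min_block_transport[OF i(1) x(2,1) zs(2,1) ix c] unfolding ii .
  qed
  then show ?thesis by (simp add: Omega_def)
qed

lemma inv_G: "signed_perm t \<Longrightarrow> inv\<^bsub>G\<^esub> t = pinv t"
  using sp_inv[of t] carrier_G by (intro G.inv_equality) (auto simp: fun_eq_iff)

text \<open>Substitute \<open>u = \<phi> t\<close>, the conjugate of \<open>y\<close> by
  \<open>t\<close>: the conjugate of \<open>g\<close> under the inverse of \<open>t\<close>
  centralizes \<open>y\<close> iff \<open>u\<close> centralizes \<open>g\<close>, and
  \<open>Omega_conj\<close> identifies the values. The fibres of \<open>\<phi>\<close> are cosets of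
  \<open>Z y\<close>, so their size cancels the denominator.\<close>

lemma induced_char_Omega:
  assumes y: "signed_perm y" and g: "signed_perm g" and \<omega>: "\<And>z. z \<in> Z y \<Longrightarrow> \<omega> z = Omega y z"
  shows "induced_char G (Z y) \<omega> g = (\<Sum>u\<in>{u \<in> Z g. u \<in> conj_class G y}. Omega u g)"
proof -
  define \<phi> where "\<phi> t = t \<circ> y \<circ> pinv t" for t
  define T where "T = {t. signed_perm t \<and> \<phi> t \<in> Z g}"
  let ?c = "\<lambda>t. pinv t \<circ> g \<circ> t"
  have phi_sp: "signed_perm (\<phi> t)" if "signed_perm t" for t unfolding \<phi>_def using that y sp_inv(1) by (intro sp_comp)
  have c_sp: "signed_perm (?c t)" if "signed_perm t" for t using that g sp_inv(1) by (intro sp_comp)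
  have c_iff: "?c t \<in> Z y \<longleftrightarrow> \<phi> t \<in> Z g" if t: "signed_perm t" for t
  proof -
    have i: "\<And>a. pinv t (t a) = a" "\<And>a. t (pinv t a) = a" using sp_inv[OF t] by auto
    have "(\<forall>a. pinv t (g (t (y a))) = y (pinv t (g (t a)))) \<longleftrightarrow> (\<forall>a. t (y (pinv t (g a))) = g (t (y (pinv t a))))"
      using i by metis
    then show ?thesis using phi_sp[OF t] c_sp[OF t] by (simp add: Z_iff \<phi>_def comp_def)
  qed
  have om: "\<omega> (?c t) = Omega (\<phi> t) g" if "t \<in> T" for t
  proof -
    have t: "signed_perm t" "\<phi> t \<in> Z g" using that by (auto simp: T_def)
    then have c: "?c t \<in> Z y" using c_iff by blast
    have "Omega (\<phi> t) g = Omega y (?c t)"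
      by (rule Omega_conj[OF t(1) y phi_sp[OF t(1)] c Z_sym[OF g t(2)]]) (use sp_inv[OF t(1)] in \<open>auto simp: \<phi>_def\<close>)
    then show ?thesis using \<omega>[OF c] by simp
  qed
  have finT: "finite T" by (rule finite_subset[OF _ finite_sp]) (auto simp: T_def)
  have conj: "conj_class G y = \<phi> ` Collect signed_perm"
    unfolding conj_class_def carrier_G by (rule image_cong) (auto simp: \<phi>_def inv_G)
  have fib: "card {t \<in> T. \<phi> t = u} = card (Z y)" if u: "u \<in> Z g" "u \<in> conj_class G y" for u
  proof -
    obtain t0 where t0: "signed_perm t0" "u = \<phi> t0" using u(2) unfolding conj by blast
    have i: "\<And>a. pinv t0 (t0 a) = a" "\<And>a. t0 (pinv t0 a) = a" using sp_inv[OF t0(1)] by auto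
    have "{t \<in> T. \<phi> t = u} = (\<lambda>z. t0 \<circ> z) ` Z y"
    proof (intro equalityI subsetI)
      fix t assume "t \<in> {t \<in> T. \<phi> t = u}"
      then have t: "signed_perm t" "\<phi> t = \<phi> t0" by (auto simp: T_def t0)
      have "t (y a) = t0 (y (pinv t0 (t a)))" for a
        using fun_cong[OF t(2), of "t a"] sp_inv(2)[OF t(1)] by (simp add: \<phi>_def)
      then have "pinv t0 \<circ> t \<in> Z y" using sp_comp[OF sp_inv(1)[OF t0(1)] t(1)] i by (simp add: Z_iff)
      moreover have "t = t0 \<circ> (pinv t0 \<circ> t)" using i by (simp add: fun_eq_iff)
      ultimately show "t \<in> (\<lambda>z. t0 \<circ> z) ` Z y" by blast
    next
      fix t assume "t \<in> (\<lambda>z. t0 \<circ> z) ` Z y"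
      then obtain z where z: "z \<in> Z y" "t = t0 \<circ> z" by blast
      have zs: "signed_perm z" "\<And>a. z (y a) = y (z a)" using z by (auto simp: Z_iff)
      have t: "signed_perm t" using z(2) t0 zs sp_comp by simp
      have "\<phi> t a = u a" for a
      proof -
        obtain b where b: "a = t b" using sp_inv(3)[OF t] by metis
        have "\<phi> t a = t (y b)" using sp_inv(2)[OF t] by (simp add: \<phi>_def b)
        also have "\<dots> = u a" using zs i by (simp add: z t0 \<phi>_def b)
        finally show ?thesis .
      qed
      then have "\<phi> t = u" by blast
      then show "t \<in> {t \<in> T. \<phi> t = u}" using t u by (simp add: T_def)
    qed
    moreover have "inj_on (\<lambda>z. t0 \<circ> z) (Z y)"
      by (rule inj_onI) (use i in \<open>metis ext o_apply\<close>)
    ultimately show ?thesis by (simp add: card_image)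
  qed
  have "(\<Sum>t\<in>T. Omega (\<phi> t) g) = (\<Sum>u\<in>\<phi> ` T. \<Sum>t\<in>{t \<in> T. \<phi> t = u}. Omega (\<phi> t) g)"
    by (rule sum.image_gen[OF finT])
  also have "\<phi> ` T = {u \<in> Z g. u \<in> conj_class G y}" by (auto simp: conj T_def)
  also have "(\<Sum>u\<in>{u \<in> Z g. u \<in> conj_class G y}. \<Sum>t\<in>{t \<in> T. \<phi> t = u}. Omega (\<phi> t) g) =
    (\<Sum>u\<in>{u \<in> Z g. u \<in> conj_class G y}. of_nat (card (Z y)) * Omega u g)"
    by (rule sum.cong[OF refl]) (simp add: fib)
  finally have main: "(\<Sum>t\<in>T. Omega (\<phi> t) g) = of_nat (card (Z y)) * (\<Sum>u\<in>{u \<in> Z g. u \<in> conj_class G y}. Omega u g)"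
    by (simp add: sum_distrib_left)
  have TT: "{t \<in> carrier G. inv\<^bsub>G\<^esub> t \<otimes>\<^bsub>G\<^esub> g \<otimes>\<^bsub>G\<^esub> t \<in> Z y} = T"
    unfolding carrier_G using c_iff by (auto simp: T_def inv_G)
  have "(\<Sum>t\<in>T. \<omega> (inv\<^bsub>G\<^esub> t \<otimes>\<^bsub>G\<^esub> g \<otimes>\<^bsub>G\<^esub> t)) = (\<Sum>t\<in>T. Omega (\<phi> t) g)"
    by (rule sum.cong[OF refl]) (use om in \<open>auto simp: inv_G T_def\<close>)
  moreover have "card (Z y) > 0" using Z_self[OF y] finite_Z by (metis card_gt_0_iff empty_iff)
  ultimately show ?thesis unfolding induced_char_def TT using main by simp
qed

end

section \<open>Induced characters as sums over commuting elements\<close>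

text \<open>\<open>ord\<close> states faithfulness at the level of points. Together with
  multiplicativity it makes the value on the cycle through \<open>a\<close> a primitive root of
  unity whose order is the period of \<open>a\<close>.\<close>

locale faithful_character = stabilizer_trivial_character +
  assumes ord: "\<And>a l. a \<in> S \<Longrightarrow> \<omega> (twist x a) ^ l = 1 \<Longrightarrow> (x ^^ l) a = a"
    and sgn: "\<And>a. a \<in> S \<Longrightarrow> (\<forall>i. (x ^^ i) a \<noteq> - a) \<Longrightarrow> \<omega> (perm_restrict uminus (cyc_supp x a)) = 1"
begin

lemma omega_twist_pow_eq_1: "a \<in> S \<Longrightarrow> \<omega> (twist x a) ^ l = 1 \<longleftrightarrow> least_power x a dvd l"
proof -
  assume a: "a \<in> S"
  have "twist x a ^^ l = id" if "(x ^^ l) a = a"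
  proof
    fix b
    have "(x ^^ l) b = b" if "b \<in> cyc_supp x a"
      using supp_pow_eq_iff(1)[OF x that, of l 0] \<open>(x ^^ l) a = a\<close> by simp
    then show "(twist x a ^^ l) b = id b" by (simp add: twist_pow[OF x a])
  qed
  then have "\<omega> (twist x a) ^ l = 1" if "(x ^^ l) a = a"
    using omega_pow[OF twist_Z[OF x a], of l] omega_id that by metis
  then show ?thesis using ord[OF a] lp_dvd[OF x] by blast
qed

lemma omega_twist_pow_eq_iff:
  assumes a: "a \<in> S"
  shows "\<omega> (twist x a) ^ i = \<omega> (twist x a) ^ j \<longleftrightarrow> (x ^^ i) a = (x ^^ j) a"
  using primitive_root_pow_eq_iff[OF omega_twist_pow_eq_1[OF a] nonzero[OF twist_Z[OF x a]]]
    pow_eq_iff[OF x] by (simp add: cong_def)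

lemma lp_Z: 
  assumes "z \<in> Z x" shows "least_power x (z a) = least_power x a"
proof -
  have z: "signed_perm z" "\<And>a. z (x a) = x (z a)" using assms by (auto simp: Z_iff)
  have "(x ^^ r) (z a) = z a \<longleftrightarrow> (x ^^ r) a = a" for r
    using funpow_intertwine[of z x x, OF z(2)] sp_inj[OF z(1)] by metis
  then show ?thesis by (simp add: least_power_def)
qed

text \<open>\<open>z\<close> conjugates the cycle through \<open>a\<close> to the one through
  \<open>z a\<close>. Consequently \<open>std_exp\<close> is constant along the centralizer, which
  keeps every \<open>z\<close> commuting with \<open>x_std\<close>.\<close>

lemma omega_twist_Z:
  assumes z: "z \<in> Z x" and a: "a \<in> S"
  shows "\<omega> (twist x (z a)) = \<omega> (twist x a)"
proof -
  have zs: "signed_perm z" "\<And>a. z (x a) = x (z a)" using z by (auto simp: Z_iff)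
  have za: "z a \<in> S" using a sp_in[OF zs(1)] by blast
  have "twist x (z a) \<circ> z = z \<circ> twist x a"
    using supp_Z[OF x z] zs(2) by (simp add: fun_eq_iff twist_def perm_restrict_def)
  then have "\<omega> (twist x (z a)) * \<omega> z = \<omega> z * \<omega> (twist x a)"
    using mult[OF twist_Z[OF x za] z] mult[OF z twist_Z[OF x a]] by metis
  then show ?thesis using nonzero[OF z] by simp
qed

definition "std_exp a = (SOME j. \<omega> (twist x a) ^ j = cis (2 * pi / real (least_power x a)))"

lemma std_exp: "a \<in> S \<Longrightarrow> \<omega> (twist x a) ^ std_exp a = cis (2 * pi / real (least_power x a))"
proof -
  assume a: "a \<in> S"
  have N: "least_power x a > 0" by (rule lp_pos[OF x])
  have "\<exists>j. cis (2 * pi / real (least_power x a)) = \<omega> (twist x a) ^ j"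
    by (rule primitive_root_generates[OF omega_twist_pow_eq_1[OF a] N]) (simp add: cis_primitive[OF N])
  then show ?thesis unfolding std_exp_def by (metis (mono_tags, lifting) someI_ex)
qed

text \<open>The actual and the standard value are primitive roots of the same order, so each is a
  power of the other; \<open>j\<close> inverts the exponent modulo the period. Hence
  \<open>x\<close> is recovered from \<open>x_std\<close> on each cycle.\<close>

lemma std_exp_inverse:
  assumes a: "a \<in> S"
  obtains j where "\<And>i. (x ^^ (std_exp a * (j * i))) a = (x ^^ i) a"
proof -
  have N: "least_power x a > 0" by (rule lp_pos[OF x])
  have "\<exists>j. \<omega> (twist x a) = cis (2 * pi / real (least_power x a)) ^ j"
    by (rule primitive_root_generates[OF cis_primitive[OF N] N]) (simp add: omega_twist_pow_eq_1[OF a])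
  then obtain j where "\<omega> (twist x a) = cis (2 * pi / real (least_power x a)) ^ j" by blast
  then have "\<omega> (twist x a) ^ (std_exp a * (j * i)) = \<omega> (twist x a) ^ i" for i
    using std_exp[OF a] by (simp add: power_mult)
  then show thesis using that omega_twist_pow_eq_iff[OF a] by blast
qed

lemma std_exp_Z: "z \<in> Z x \<Longrightarrow> a \<in> S \<Longrightarrow> std_exp (z a) = std_exp a"
  by (simp add: std_exp_def omega_twist_Z lp_Z)

lemma std_exp_uminus: "a \<in> S \<Longrightarrow> std_exp (- a) = std_exp a"
proof -
  assume a: "a \<in> S"
  have "cyc_supp x (- a) = cyc_supp x a"
    by (rule supp_eq[OF x a]) (rule supp_step(2)[OF x supp_refl[OF x]])
  then have "twist x (- a) = twist x a" by (simp add: twist_def)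
  moreover have "least_power x (- a) = least_power x a"
    by (simp add: least_power_def sp_pow_neg[OF x])
  ultimately show ?thesis by (simp add: std_exp_def)
qed

lemma std_exp_pow: "a \<in> S \<Longrightarrow> std_exp ((x ^^ i) a) = std_exp a"
  using std_exp_Z[OF Z_pow[OF Z_self[OF x]]] by blast

text \<open>
  The faithful characters may be chosen differently for each cycle type and class. Raising the
  cycles of $x$ to suitable powers gives a conjugate element with the same centralizer for
  which the value on each cycle is the standard primitive root of unity.
\<close>

definition "x_std a = (x ^^ std_exp a) a"

lemma sp_x_std: "signed_perm x_std"
proof (rule sp_intro)
  show "a \<in> S \<Longrightarrow> x_std a \<in> S" for a using sp_in[OF sp_pow[OF x]] by (simp add: x_std_def)
  fix a b assume ab: "a \<in> S" "b \<in> S" "x_std a = x_std b"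
  then have "std_exp a = std_exp b" using std_exp_pow[of a "std_exp a"] std_exp_pow[of b "std_exp b"] by (simp add: x_std_def)
  then show "a = b" using ab(3) sp_inj[OF sp_pow[OF x]] by (simp add: x_std_def)
next
  fix a assume "a \<notin> S"
  then show "x_std a = a" using sp_pow[OF x] sp_permutes permutes_not_in unfolding x_std_def by metis
next
  show "a \<in> S \<Longrightarrow> x_std (- a) = - x_std a" for a by (simp add: x_std_def std_exp_uminus sp_pow_neg[OF x])
qed

lemma x_std_pow: "a \<in> S \<Longrightarrow> (x_std ^^ l) a = (x ^^ (std_exp a * l)) a"
proof (induction l)
  case (Suc l)
  then show ?case using std_exp_pow[of a "std_exp a * l"] by (simp add: x_std_def funpow_add)
qed simp

lemma x_pow:
  assumes a: "a \<in> S"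
  obtains j where "\<And>i. (x ^^ i) a = (x_std ^^ (j * i)) a"
  using std_exp_inverse[OF a] x_std_pow[OF a] by metis

lemma supp_x_std: "a \<in> S \<Longrightarrow> cyc_supp x_std a = cyc_supp x a"
proof -
  assume a: "a \<in> S"
  obtain j where j: "\<And>i. (x ^^ i) a = (x_std ^^ (j * i)) a" using x_pow[OF a] by blast
  show ?thesis unfolding set_eq_iff supp_iff[OF x] supp_iff[OF sp_x_std] using j x_std_pow[OF a] by metis
qed

lemma x_std_pow_eq_iff: 
  assumes a: "a \<in> S" 
  shows "(x_std ^^ i) a = (x_std ^^ j) a \<longleftrightarrow> (x ^^ i) a = (x ^^ j) a"
proof
  assume "(x ^^ i) a = (x ^^ j) a"
  then have "\<omega> (twist x a) ^ i = \<omega> (twist x a) ^ j" using omega_twist_pow_eq_iff[OF a] by blast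
  then have "\<omega> (twist x a) ^ (std_exp a * i) = \<omega> (twist x a) ^ (std_exp a * j)"
    by (metis mult.commute power_mult)
  then show "(x_std ^^ i) a = (x_std ^^ j) a" using omega_twist_pow_eq_iff[OF a] x_std_pow[OF a] by simp
next
  assume eq: "(x_std ^^ i) a = (x_std ^^ j) a"
  obtain k where k: "\<And>i. (x ^^ i) a = (x_std ^^ (k * i)) a" using x_pow[OF a] by blast
  have "[i = j] (mod least_power x_std a)" using pow_eq_iff[OF sp_x_std] eq by (simp add: cong_def)
  then have "[k * i = k * j] (mod least_power x_std a)" by (rule cong_scalar_left)
  then show "(x ^^ i) a = (x ^^ j) a" using k pow_eq_iff[OF sp_x_std] by (simp add: cong_def)
qed

text \<open>The parity of \<open>l\<close> is deliberately not tracked. In the application the plus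
  sign is excluded afterwards, since no point of \<open>S\<close> is its own negative.\<close>

lemma pow_neg_mult:
  assumes w: "signed_perm w" and eq: "(w ^^ i) a = - (w ^^ j) a"
  shows "(w ^^ (l * i)) a = (w ^^ (l * j)) a \<or> (w ^^ (l * i)) a = - (w ^^ (l * j)) a"
proof (induction l)
  case (Suc l)
  have comm: "(w ^^ j) ((w ^^ k) a) = (w ^^ k) ((w ^^ j) a)" for k by (rule funpow_commute) simp
  have "(w ^^ (Suc l * i)) a = (w ^^ (l * i)) ((w ^^ i) a)" by (simp add: funpow_add add.commute[of i])
  also have "\<dots> = - (w ^^ j) ((w ^^ (l * i)) a)" unfolding eq sp_pow_neg[OF w] comm ..
  finally show ?case using Suc sp_pow_neg[OF w] by (auto simp: funpow_add)
qed simp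

lemma x_std_pow_neg_iff:
  assumes a: "a \<in> S" 
  shows "(x_std ^^ i) a = - (x_std ^^ j) a \<longleftrightarrow> (x ^^ i) a = - (x ^^ j) a"
proof
  assume eq: "(x ^^ i) a = - (x ^^ j) a"
  have "(x_std ^^ i) a \<noteq> (x_std ^^ j) a"
    unfolding x_std_pow_eq_iff[OF a] using eq neq_neg[of "(x ^^ j) a"] sp_in[OF sp_pow[OF x]] a by metis
  then show "(x_std ^^ i) a = - (x_std ^^ j) a"
    using pow_neg_mult[OF x eq, of "std_exp a"] x_std_pow[OF a] by simp
next
  assume eq: "(x_std ^^ i) a = - (x_std ^^ j) a"
  obtain k where k: "\<And>i. (x ^^ i) a = (x_std ^^ (k * i)) a" using x_pow[OF a] by blast
  have "(x ^^ i) a \<noteq> (x ^^ j) a"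
    unfolding x_std_pow_eq_iff[OF a, symmetric] using eq neq_neg[of "(x_std ^^ j) a"] sp_in[OF sp_pow[OF sp_x_std]] a by metis
  then show "(x ^^ i) a = - (x ^^ j) a"
    using pow_neg_mult[OF sp_x_std eq, of k] k by simp
qed

lemma x_std_conj: obtains t where "signed_perm t" "\<And>a. t (x a) = x_std (t a)"
proof (rule extension[OF x sp_x_std B, of "\<lambda>b. b"])
  have BS: "b \<in> S" if "b \<in> B" for b using that B by (auto simp: transversal_def)
  then show "(\<lambda>b. b) ` B \<subseteq> S" by blast
  show "b = c" if "b \<in> B" "c \<in> B" "b \<in> cyc_supp x_std c" for b c
    using that transversal_unique[OF x B] supp_x_std[OF BS] by blast
  show "b \<in> B \<Longrightarrow> (x ^^ i) b = (x ^^ j) b \<longleftrightarrow> (x_std ^^ i) b = (x_std ^^ j) b"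
    "b \<in> B \<Longrightarrow> (x ^^ i) b = - (x ^^ j) b \<longleftrightarrow> (x_std ^^ i) b = - (x_std ^^ j) b" for b i j
    using x_std_pow_eq_iff x_std_pow_neg_iff BS by blast+
qed (use that in blast)

text \<open>One inclusion holds because \<open>std_exp\<close> is constant along the centralizer of
  \<open>x\<close>. Equality follows by counting, as conjugate elements have centralizers of equal
  size.\<close>

lemma Z_x_std: "Z x_std = Z x"
proof -
  have "Z x \<subseteq> Z x_std"
  proof
    fix z assume z: "z \<in> Z x"
    then have zs: "signed_perm z" "\<And>a. z (x a) = x (z a)" by (auto simp: Z_iff)
    have "z (x_std a) = x_std (z a)" for a
    proof (cases "a \<in> S")
      case True
      then show ?thesis using std_exp_Z[OF z] funpow_intertwine[of z x x, OF zs(2)] by (simp add: x_std_def)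
    next
      case False
      then have "x_std a = a" "z a = a" using sp_permutes[OF sp_x_std] sp_permutes[OF zs(1)] permutes_not_in by metis+
      then show ?thesis by simp
    qed
    then show "z \<in> Z x_std" using zs by (simp add: Z_iff)
  qed
  moreover have "card (Z x_std) \<le> card (Z x)"
  proof -
    obtain t where t: "signed_perm t" "\<And>a. t (x a) = x_std (t a)" using x_std_conj by blast
    have i: "\<And>a. pinv t (t a) = a" "\<And>a. t (pinv t a) = a" using sp_inv[OF t(1)] by auto
    show ?thesis
    proof (rule card_inj_on_le[OF _ _ finite_Z])
      show "inj_on (\<lambda>z. pinv t \<circ> z \<circ> t) (Z x_std)"
        by (rule inj_onI) (use i in \<open>metis ext o_apply\<close>)
      have "pinv t \<circ> z \<circ> t \<in> Z x" if "z \<in> Z x_std" for z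
      proof -
        have z: "signed_perm z" "\<And>a. z (x_std a) = x_std (z a)" using that by (auto simp: Z_iff)
        have "pinv t (z (t (x a))) = x (pinv t (z (t a)))" for a
          using t(2) z(2) i by metis
        moreover have "signed_perm (pinv t \<circ> z \<circ> t)" using sp_inv(1) t(1) z(1) by (intro sp_comp)
        ultimately show ?thesis by (simp add: Z_iff)
      qed
      then show "(\<lambda>z. pinv t \<circ> z \<circ> t) ` Z x_std \<subseteq> Z x" by blast
    qed
  qed
  ultimately show ?thesis using card_seteq[OF finite_Z] by blast
qed

lemma lp_x_std: "a \<in> S \<Longrightarrow> least_power x_std a = least_power x a"
  using x_std_pow_eq_iff[of a _ 0] by (simp add: least_power_def)

lemma omega_Omega_x_std:
  assumes "z \<in> Z x_std"
  shows "\<omega> z = Omega x_std z"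
proof -
  have tr: "transversal x_std B" using B supp_x_std by (simp add: transversal_def)
  interpret Y: stabilizer_trivial_character S x_std \<omega> B
    by unfold_locales (use sp_x_std mult nonzero tr stab in \<open>auto simp: Z_x_std\<close>)
  show ?thesis
  proof (rule Y.omega_eq_Omega[OF _ _ assms])
    fix a assume a: "a \<in> S"
    have "twist x_std a = twist x a ^^ std_exp a"
    proof
      fix b
      have "std_exp b = std_exp a" if "b \<in> cyc_supp x a"
        using that std_exp_pow[OF a] std_exp_uminus sp_in[OF sp_pow[OF x]] a by (auto simp: supp_iff[OF x])
      then show "twist x_std a b = (twist x a ^^ std_exp a) b"
        using supp_x_std[OF a] unfolding twist_pow[OF x a] by (simp add: twist_def perm_restrict_def x_std_def)
    qed
    then show "\<omega> (twist x_std a) = cis (2 * pi / real (least_power x_std a))"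
      using omega_pow[OF twist_Z[OF x a]] std_exp[OF a] lp_x_std[OF a] by simp
    show "\<omega> (perm_restrict uminus (cyc_supp x_std a)) = 1" if "\<forall>i. (x_std ^^ i) a \<noteq> - a"
      using that sgn[OF a] x_std_pow_neg_iff[OF a, of _ 0] by (simp add: supp_x_std[OF a])
  qed
qed

text \<open>\<open>x\<close> and \<open>x_std\<close> share both the centralizer and the conjugacy
  class, so the formula at \<open>x_std\<close>, where \<omega> is \<open>Omega\<close>, is already
  the formula at \<open>x\<close>.\<close>

lemma induced_char_eq:
  assumes "signed_perm g"
  shows "induced_char G (Z x) \<omega> g = (\<Sum>u\<in>{u \<in> Z g. u \<in> conj_class G x}. Omega u g)"
proof -
  obtain t where t: "signed_perm t" "\<And>a. t (x a) = x_std (t a)" using x_std_conj by blast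
  have i: "\<And>a. pinv t (t a) = a" "\<And>a. t (pinv t a) = a" "signed_perm (pinv t)" using sp_inv[OF t(1)] by auto
  have c: "conj_class G v = {s \<circ> v \<circ> pinv s | s. signed_perm s}" for v
    unfolding conj_class_def carrier_G by (auto simp: inv_G)
  have inv_comp: "pinv (s \<circ> r) = pinv r \<circ> pinv s" if "signed_perm s" "signed_perm r" for s r
    using sp_inv[OF that(1)] sp_inv[OF that(2)] by (intro inv_equality) auto
  have ii: "pinv (pinv t) = t" using i by (intro inv_equality) auto
  have "s \<circ> x_std \<circ> pinv s = (s \<circ> t) \<circ> x \<circ> pinv (s \<circ> t)" if "signed_perm s" for s
    unfolding inv_comp[OF that t(1)] using t(2) i by (simp add: fun_eq_iff)
  moreover have "s \<circ> x \<circ> pinv s = (s \<circ> pinv t) \<circ> x_std \<circ> pinv (s \<circ> pinv t)" if "signed_perm s" for s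
  proof -
    have "pinv t (x_std (t a)) = x a" for a using t(2) i by metis
    then show ?thesis unfolding inv_comp[OF that i(3)] ii by (simp add: fun_eq_iff)
  qed
  ultimately have "conj_class G x = conj_class G x_std"
    unfolding c using sp_comp t(1) i(3) by (auto; metis)
  then show ?thesis using induced_char_Omega[OF sp_x_std assms omega_Omega_x_std] by (simp add: Z_x_std)
qed

end

section \<open>Lengths and classes of signed cycles\<close>

context signed_set
begin

lemma orbit_in_S: "signed_perm x \<Longrightarrow> a \<in> S \<Longrightarrow> orbit x a \<subseteq> S"
  using sp_in[OF sp_pow] by (auto simp: orbit_iff)

lemma orbit_self: "signed_perm x \<Longrightarrow> a \<in> orbit x a"
  by (auto simp: orbit_iff intro: exI[of _ 0])

lemma orbit_eqI: "signed_perm x \<Longrightarrow> b \<in> orbit x a \<Longrightarrow> orbit x b = orbit x a"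
  using orbit_trans[of _ x] orbit_swap[OF orbit_self] by blast

lemma cyc_type_transport:
  assumes "inj f" "\<And>a. f (- a) = - f a" "orbit x (f a) = f ` orbit x a"
  shows "cyc_length x (f a) = cyc_length x a" "cyc_class x (f a) = cyc_class x a"
proof -
  have "uminus ` f ` A = f ` uminus ` A" for A using assms(2) by (force simp: image_iff)
  then have "uminus ` f ` orbit x a = f ` orbit x a \<longleftrightarrow> uminus ` orbit x a = orbit x a"
    using assms(1) by (simp add: inj_image_eq_iff)
  moreover have "card (f ` orbit x a) = card (orbit x a)"
    using assms(1) by (meson card_image inj_on_subset subset_UNIV)
  ultimately show "cyc_length x (f a) = cyc_length x a" "cyc_class x (f a) = cyc_class x a"
    by (simp_all add: cyc_length_def cyc_class_def assms(3))
qed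

lemma cyc_type_Z:
  assumes "signed_perm x" "z \<in> Z x"
  shows "cyc_length x (z a) = cyc_length x a" "cyc_class x (z a) = cyc_class x a"
proof -
  have z: "signed_perm z" "\<And>a. z (x a) = x (z a)" using assms(2) by (auto simp: Z_iff)
  have "orbit x (z a) = z ` orbit x a"
    unfolding set_eq_iff image_iff Bex_def orbit_iff[OF assms(1)]
    using funpow_intertwine[of z x x, OF z(2)] by metis
  then show "cyc_length x (z a) = cyc_length x a" "cyc_class x (z a) = cyc_class x a"
    using sp_inj[OF z(1)] sp_neg[OF z(1)] by (intro cyc_type_transport; simp add: inj_def)+
qed

lemma cyc_type_uminus:
  assumes "signed_perm x"
  shows "cyc_length x (- a) = cyc_length x a" "cyc_class x (- a) = cyc_class x a"
  by (intro cyc_type_transport[of uminus]; simp add: orbit_uminus[OF assms])+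

lemma cyc_class_cases: "cyc_class x a = 1 \<or> cyc_class x a = -1"
  by (simp add: cyc_class_def)

lemma cyc_class_eq_1: "(\<And>i. (x ^^ i) a \<noteq> - a) \<Longrightarrow> signed_perm x \<Longrightarrow> cyc_class x a = 1"
  using orbit_self[of x a] unfolding cyc_class_def by (force simp: orbit_iff)

text \<open>An orbit of class -1 contains both \<open>a\<close> and \<open>-a\<close>, and one of
  class +1 is disjoint from its negative. Since \<open>card S\<close> is \<open>2 * n\<close> in the
  application, every point falls into a part indexed by \<open>{1..n}\<close> and the product
  defining \<omega> covers all cycles.\<close>

lemma cyc_length_bounds:
  assumes x: "signed_perm x" and a: "a \<in> S"
  shows "1 \<le> cyc_length x a" "2 * cyc_length x a \<le> card S"
proof -
  let ?O = "orbit x a"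
  have O: "finite ?O" "?O \<subseteq> S" "a \<in> ?O"
    using orbit_in_S[OF x a] finite_subset[OF _ fin] orbit_self[OF x] by auto
  have "1 \<le> cyc_length x a \<and> 2 * cyc_length x a \<le> card S"
  proof (cases "uminus ` ?O = ?O")
    case True
    then have "{a, - a} \<subseteq> ?O" using O by blast
    then have "card {a, - a} \<le> card ?O" by (rule card_mono[OF O(1)])
    then have "2 \<le> card ?O" using neq_neg[OF a] by simp
    moreover have "card ?O \<le> card S" by (rule card_mono[OF fin O(2)])
    ultimately have "1 \<le> card ?O div 2 \<and> 2 * (card ?O div 2) \<le> card S" by linarith
    then show ?thesis using True by (simp add: cyc_length_def)
  next
    case False
    have "?O \<inter> uminus ` ?O = {}"
    proof (rule ccontr)
      assume "?O \<inter> uminus ` ?O \<noteq> {}"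
      then obtain b where b: "b \<in> ?O" "- b \<in> ?O" by auto
      then have "uminus ` ?O = ?O" using orbit_eqI[OF x] orbit_uminus[OF x] by metis
      then show False using False by blast
    qed
    moreover have "uminus ` ?O \<subseteq> S" using O neg by blast
    ultimately have "card ?O + card (uminus ` ?O) \<le> card S"
      using O fin by (metis Un_subset_iff card_Un_disjoint card_mono finite_imageI)
    moreover have "card (uminus ` ?O) = card ?O" by (rule card_image) simp
    moreover have "card ?O > 0" using O by (auto simp: card_gt_0_iff)
    ultimately show ?thesis using False by (simp add: cyc_length_def)
  qed
  then show "1 \<le> cyc_length x a" "2 * cyc_length x a \<le> card S" by auto
qed

end

section \<open>Higher Lie characters\<close>

abbreviation "pm_points n \<equiv> {- int n..int n} - {0}"

lemma signed_set_pm_points: "signed_set (pm_points n)"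
  by unfold_locales auto

lemma card_pm_points: "card (pm_points n) = 2 * n"
  by (simp add: card_Diff_subset)

context signed_set
begin

lemma signed_set_subset:
  assumes "P \<subseteq> S" "\<And>a. a \<in> P \<Longrightarrow> - a \<in> P"
  shows "signed_set P"
  using assms finite_subset[OF _ fin] nz by unfold_locales auto

lemma sp_restrict:
  assumes z: "signed_perm z" and P: "P \<subseteq> S" "\<And>a. a \<in> P \<Longrightarrow> - a \<in> P" "\<And>a. a \<in> P \<Longrightarrow> z a \<in> P"
  shows "signed_set.signed_perm P (perm_restrict z P)"
proof -
  interpret P: signed_set P by (rule signed_set_subset[OF P(1,2)])
  show ?thesis
    by (rule P.sp_intro) (use P sp_inj[OF z] sp_neg[OF z] in \<open>auto simp: perm_restrict_def\<close>)
qed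

end

locale omega_data = signed_set "pm_points n" for n :: nat +
  fixes x :: "int \<Rightarrow> int" and \<omega> :: "(int \<Rightarrow> int) \<Rightarrow> complex"
    and \<theta> :: "nat \<Rightarrow> int \<Rightarrow> (int \<Rightarrow> int) \<Rightarrow> complex"
  assumes x: "signed_perm x"
    and wreath: "\<And>i \<epsilon>. i \<in> {1..n} \<Longrightarrow> \<epsilon> \<in> {1, -1} \<Longrightarrow>
      wreath_char \<epsilon> (cyc_part n x i \<epsilon>) (perm_restrict x (cyc_part n x i \<epsilon>)) (\<theta> i \<epsilon>)"
    and omega: "\<And>z. z \<in> Z x \<Longrightarrow>
      \<omega> z = (\<Prod>i\<in>{1..n}. \<Prod>\<epsilon>\<in>{1, -1}. \<theta> i \<epsilon> (perm_restrict z (cyc_part n x i \<epsilon>)))"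
begin

abbreviation "P \<equiv> cyc_part n x"
abbreviation "xP i \<epsilon> \<equiv> perm_restrict x (P i \<epsilon>)"
abbreviation "len \<equiv> cyc_length x"
abbreviation "cls \<equiv> cyc_class x"

lemma P_iff: "a \<in> P i \<epsilon> \<longleftrightarrow> a \<in> pm_points n \<and> len a = i \<and> cls a = \<epsilon>"
  by (simp add: cyc_part_def)

lemma P_sub: "P i \<epsilon> \<subseteq> pm_points n" and P_neg: "a \<in> P i \<epsilon> \<Longrightarrow> - a \<in> P i \<epsilon>"
  and P_Z: "z \<in> Z x \<Longrightarrow> a \<in> P i \<epsilon> \<Longrightarrow> z a \<in> P i \<epsilon>"
  using neg cyc_type_uminus[OF x] cyc_type_Z[OF x] sp_in by (auto simp: P_iff Z_iff)

lemma index: "a \<in> pm_points n \<Longrightarrow> len a \<in> {1..n} \<and> cls a \<in> {1, -1} \<and> a \<in> P (len a) (cls a)"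
  using cyc_length_bounds[OF x] card_pm_points[of n] cyc_class_cases[of x a] by (auto simp: P_iff)

lemma signed_P: "signed_set (P i \<epsilon>)"
  by (rule signed_set_subset[OF P_sub P_neg])

lemma restrict_ZP:
  assumes z: "z \<in> Z x"
  shows "perm_restrict z (P i \<epsilon>) \<in> centralizer (signed_perm_group (P i \<epsilon>)) (xP i \<epsilon>)"
proof -
  interpret P: signed_set "P i \<epsilon>" by (rule signed_P)
  have zs: "signed_perm z" "\<And>a. z (x a) = x (z a)" using z by (auto simp: Z_iff)
  have "P.signed_perm (perm_restrict z (P i \<epsilon>))"
    by (rule sp_restrict[OF zs(1) P_sub P_neg P_Z[OF z]])
  then show ?thesis
    unfolding P.Z_iff using P_Z[OF z] P_Z[OF Z_self[OF x]] zs(2) by (simp add: perm_restrict_def)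
qed

lemma restrict_comp:
  assumes "w \<in> Z x"
  shows "perm_restrict (z \<circ> w) (P i \<epsilon>) = perm_restrict z (P i \<epsilon>) \<circ> perm_restrict w (P i \<epsilon>)"
  using P_Z[OF assms] by (auto simp: fun_eq_iff perm_restrict_def)

lemma theta_hom:
  assumes "i \<in> {1..n}" "\<epsilon> \<in> {1, -1}"
    and "z \<in> centralizer (signed_perm_group (P i \<epsilon>)) (xP i \<epsilon>)"
  shows "\<theta> i \<epsilon> z \<noteq> 0"
    and "w \<in> centralizer (signed_perm_group (P i \<epsilon>)) (xP i \<epsilon>) \<Longrightarrow> \<theta> i \<epsilon> (z \<circ> w) = \<theta> i \<epsilon> z * \<theta> i \<epsilon> w"
proof -
  let ?C = "centralizer (signed_perm_group (P i \<epsilon>)) (xP i \<epsilon>)"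
  have h: "\<theta> i \<epsilon> \<in> hom (signed_perm_group (P i \<epsilon>)\<lparr>carrier := ?C\<rparr>) complex_units"
    using wreath[OF assms(1,2)] by (simp add: wreath_char_def linear_character_def)
  show "\<theta> i \<epsilon> z \<noteq> 0" using hom_in_carrier[OF h, of z] assms(3) by (simp add: complex_units_def)
  show "w \<in> ?C \<Longrightarrow> \<theta> i \<epsilon> (z \<circ> w) = \<theta> i \<epsilon> z * \<theta> i \<epsilon> w"
    using hom_mult[OF h, of z w] assms(3) unfolding complex_units_def by (simp add: o_def)
qed

lemma theta_id:
  assumes "i \<in> {1..n}" "\<epsilon> \<in> {1, -1}"
  shows "\<theta> i \<epsilon> id = 1"
proof -
  interpret P: signed_set "P i \<epsilon>" by (rule signed_P)
  have "id \<in> P.Z (xP i \<epsilon>)" by (simp add: P.Z_iff P.sp_id)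
  then show ?thesis using theta_hom[OF assms, of id] unfolding id_comp by (metis mult_cancel_left2)
qed

lemma supp_xP:
  assumes a: "a \<in> P i \<epsilon>"
  shows "cyc_supp (xP i \<epsilon>) a = cyc_supp x a" "cyc_supp x a \<subseteq> P i \<epsilon>"
proof -
  have *: "(xP i \<epsilon> ^^ r) a = (x ^^ r) a \<and> (x ^^ r) a \<in> P i \<epsilon>" for r
    by (induction r) (use a P_Z[OF Z_self[OF x]] in \<open>auto simp: perm_restrict_def\<close>)
  then have "orbit (xP i \<epsilon>) a = orbit x a" by (simp add: orbit_altdef)
  then show "cyc_supp (xP i \<epsilon>) a = cyc_supp x a" by (simp add: cyc_supp_def)
  show "cyc_supp x a \<subseteq> P i \<epsilon>" using * P_neg by (auto simp: supp_iff[OF x])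
qed

text \<open>An element supported on one signed cycle restricts to the identity on every other part,
  where the corresponding factor is 1.\<close>

lemma omega_local:
  assumes a: "a \<in> pm_points n" and v: "v \<in> Z x" "\<And>d. d \<notin> cyc_supp x a \<Longrightarrow> v d = d"
  shows "\<omega> v = \<theta> (len a) (cls a) v"
proof -
  let ?i = "len a" and ?e = "cls a"
  have ie: "?i \<in> {1..n}" "?e \<in> {1, -1}" "a \<in> P ?i ?e" using index[OF a] by auto
  have D: "cyc_supp x a \<subseteq> P ?i ?e" by (rule supp_xP(2)[OF ie(3)])
  have 1: "perm_restrict v (P ?i ?e) = v"
    by (rule ext) (use v(2) D in \<open>metis perm_restrict_def subsetD\<close>)
  have 2: "perm_restrict v (P i \<epsilon>) = id" if "(i, \<epsilon>) \<noteq> (?i, ?e)" for i \<epsilon>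
  proof
    fix b
    have "b \<notin> cyc_supp x a" if "b \<in> P i \<epsilon>"
      using that \<open>(i, \<epsilon>) \<noteq> (?i, ?e)\<close> D by (auto simp: P_iff)
    then show "perm_restrict v (P i \<epsilon>) b = id b" using v(2) by (simp add: perm_restrict_def)
  qed
  have e: "(\<Prod>\<epsilon>\<in>{1, -1}. \<theta> i \<epsilon> (perm_restrict v (P i \<epsilon>))) = (if i = ?i then \<theta> ?i ?e v else 1)"
    if i: "i \<in> {1..n}" for i
  proof -
    have *: "\<theta> i \<epsilon> (perm_restrict v (P i \<epsilon>)) = (if (i, \<epsilon>) = (?i, ?e) then \<theta> ?i ?e v else 1)"
      if "\<epsilon> \<in> {1, -1}" for \<epsilon>
      using 1 2[of i \<epsilon>] theta_id[OF i that] by auto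
    show ?thesis using ie(2) *[of 1] *[of "-1"] by auto
  qed
  show ?thesis unfolding omega[OF v(1)] using e ie(1) by simp
qed

text \<open>The union of the base-point sets of all parts is a transversal for \<open>x\<close>. The
  centralizer preserves cycle length and class, so an element stabilizing the union stabilizes the
  base points of each part, and every factor of \<omega> is 1.\<close>

lemma stabilizer_trivial: "\<exists>B. stabilizer_trivial_character (pm_points n) x \<omega> B"
proof -
  define Q where "Q i \<epsilon> B \<longleftrightarrow> B \<subseteq> P i \<epsilon> \<and>
      (\<forall>a\<in>P i \<epsilon>. \<exists>!b. b \<in> B \<inter> cyc_supp (xP i \<epsilon>) a) \<and>
      (\<forall>z\<in>centralizer (signed_perm_group (P i \<epsilon>)) (xP i \<epsilon>). z ` B = B \<longrightarrow> \<theta> i \<epsilon> z = 1)" for i \<epsilon> B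
  define B where "B i \<epsilon> = (SOME B. Q i \<epsilon> B)" for i \<epsilon>
  have ex: "\<exists>B. Q i \<epsilon> B" if "i \<in> {1..n}" "\<epsilon> \<in> {1, -1}" for i \<epsilon>
    unfolding Q_def by (rule conjunct2[OF conjunct2[OF wreath[OF that, unfolded wreath_char_def]]])
  have Q: "Q i \<epsilon> (B i \<epsilon>)" if "i \<in> {1..n}" "\<epsilon> \<in> {1, -1}" for i \<epsilon>
    unfolding B_def by (rule someI_ex[OF ex[OF that]])
  have B: "B i \<epsilon> \<subseteq> P i \<epsilon>"
    "a \<in> P i \<epsilon> \<Longrightarrow> \<exists>!b. b \<in> B i \<epsilon> \<inter> cyc_supp (xP i \<epsilon>) a"
    "z \<in> centralizer (signed_perm_group (P i \<epsilon>)) (xP i \<epsilon>) \<Longrightarrow> z ` B i \<epsilon> = B i \<epsilon> \<Longrightarrow> \<theta> i \<epsilon> z = 1"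
    if "i \<in> {1..n}" "\<epsilon> \<in> {1, -1}" for i \<epsilon> a z
  proof -
    note q = Q[OF that, unfolded Q_def]
    show "B i \<epsilon> \<subseteq> P i \<epsilon>" using q by (rule conjunct1)
    show "a \<in> P i \<epsilon> \<Longrightarrow> \<exists>!b. b \<in> B i \<epsilon> \<inter> cyc_supp (xP i \<epsilon>) a"
      by (rule bspec[OF conjunct1[OF conjunct2[OF q]]])
    show "z \<in> centralizer (signed_perm_group (P i \<epsilon>)) (xP i \<epsilon>) \<Longrightarrow> z ` B i \<epsilon> = B i \<epsilon> \<Longrightarrow> \<theta> i \<epsilon> z = 1"
      by (rule mp[OF bspec[OF conjunct2[OF conjunct2[OF q]]]])
  qed
  define BB where "BB = {b. b \<in> pm_points n \<and> b \<in> B (len b) (cls b)}"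
  have BP: "BB \<inter> P i \<epsilon> = B i \<epsilon>" if "i \<in> {1..n}" "\<epsilon> \<in> {1, -1}" for i \<epsilon>
    using B(1)[OF that] by (auto simp: BB_def P_iff)
  have tr: "transversal x BB"
    unfolding transversal_def
  proof (intro conjI ballI)
    show "BB \<subseteq> pm_points n" by (auto simp: BB_def)
    fix a assume "a \<in> pm_points n"
    then have ie: "len a \<in> {1..n}" "cls a \<in> {1, -1}" "a \<in> P (len a) (cls a)" using index by auto
    have "BB \<inter> cyc_supp x a = B (len a) (cls a) \<inter> cyc_supp (xP (len a) (cls a)) a"
      using BP[OF ie(1,2)] supp_xP[OF ie(3)] by blast
    then show "\<exists>!b. b \<in> BB \<inter> cyc_supp x a" using B(2)[OF ie] by simp
  qed
  have "\<omega> z = 1" if z: "z \<in> Z x" "z ` BB = BB" for z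
  proof -
    have "\<theta> i \<epsilon> (perm_restrict z (P i \<epsilon>)) = 1" if ie: "i \<in> {1..n}" "\<epsilon> \<in> {1, -1}" for i \<epsilon>
    proof (rule B(3)[OF ie restrict_ZP[OF z(1)]])
      have "perm_restrict z (P i \<epsilon>) ` B i \<epsilon> = z ` B i \<epsilon>"
        using B(1)[OF ie] by (intro image_cong) (auto simp: perm_restrict_def)
      also have "\<dots> \<subseteq> B i \<epsilon>" unfolding BP[OF ie, symmetric] using z P_Z[OF z(1)] by blast
      finally have sub: "perm_restrict z (P i \<epsilon>) ` B i \<epsilon> \<subseteq> B i \<epsilon>" .
      have fB: "finite (B i \<epsilon>)" by (rule finite_subset[OF _ fin]) (use B(1)[OF ie] P_sub in blast)
      have "inj_on (perm_restrict z (P i \<epsilon>)) (B i \<epsilon>)"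
      proof (rule inj_onI)
        fix b c assume bc: "b \<in> B i \<epsilon>" "c \<in> B i \<epsilon>"
          "perm_restrict z (P i \<epsilon>) b = perm_restrict z (P i \<epsilon>) c"
        then have "z b = z c" using subsetD[OF B(1)[OF ie]] by (simp add: perm_restrict_def)
        then show "b = c" using sp_inj[of z] z(1) by (simp add: Z_iff)
      qed
      then show "perm_restrict z (P i \<epsilon>) ` B i \<epsilon> = B i \<epsilon>" by (rule endo_inj_surj[OF fB sub])
    qed
    then show ?thesis unfolding omega[OF z(1)] by (intro prod.neutral ballI) blast
  qed
  moreover have "\<omega> (z \<circ> w) = \<omega> z * \<omega> w" if "z \<in> Z x" "w \<in> Z x" for z w
    unfolding omega[OF that(1)] omega[OF that(2)] omega[OF Z_comp[OF that]] restrict_comp[OF that(2)]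
      prod.distrib[symmetric]
    by (intro prod.cong refl theta_hom(2) restrict_ZP that)
  moreover have "\<omega> z \<noteq> 0" if "z \<in> Z x" for z
    unfolding omega[OF that] using theta_hom(1)[OF _ _ restrict_ZP[OF that]] by (simp add: prod_zero_iff)
  ultimately show ?thesis using x tr by (intro exI[of _ BB] stabilizer_trivial_character.intro signed_set_axioms
        stabilizer_trivial_character_axioms.intro)
qed

text \<open>The powers of a single cycle lie where the corresponding \<theta> is injective: in the
  subgroup generated by the cycle for class +1, in its whole centralizer for class -1. So a power of
  the cycle with value 1 is the identity.\<close>

lemma faithful: "\<exists>B. faithful_character (pm_points n) x \<omega> B"
proof -
  obtain B where stc: "stabilizer_trivial_character (pm_points n) x \<omega> B" using stabilizer_trivial by blast
  interpret stabilizer_trivial_character "pm_points n" x \<omega> B by (rule stc)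
  have W: "if cls a = 1
        then \<theta> (len a) (cls a) (perm_restrict uminus (cyc_supp x a)) = 1 \<and>
          inj_on (\<theta> (len a) (cls a)) (generate (signed_perm_group (cyc_supp x a)) {twist x a})
        else inj_on (\<theta> (len a) (cls a)) (centralizer (signed_perm_group (cyc_supp x a)) (twist x a))"
    if a: "a \<in> pm_points n" for a
  proof -
    have ie: "len a \<in> {1..n}" "cls a \<in> {1, -1}" "a \<in> P (len a) (cls a)" using index[OF a] by auto
    have "perm_restrict (xP (len a) (cls a)) (cyc_supp x a) = twist x a"
      using supp_xP(2)[OF ie(3)] by (auto simp: fun_eq_iff perm_restrict_def twist_def)
    then show ?thesis
      using wreath[OF ie(1,2)] ie(3) supp_xP(1)[OF ie(3)] unfolding wreath_char_def Let_def by metis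
  qed
  have "(x ^^ l) a = a" if a: "a \<in> pm_points n" and l: "\<omega> (twist x a) ^ l = 1" for a l
  proof -
    let ?D = "cyc_supp x a" and ?c = "twist x a"
    interpret D: signed_set ?D
      using supp_subset[OF x a] supp_step(2)[OF x] by (rule signed_set_subset)
    have c: "D.signed_perm ?c" unfolding twist_def
      using x supp_subset[OF x a] supp_step[OF x] by (intro sp_restrict) auto
    have "\<theta> (len a) (cls a) (?c ^^ l) = \<omega> (?c ^^ l)"
      by (rule omega_local[symmetric, OF a Z_pow[OF twist_Z[OF x a]]]) (simp add: twist_pow[OF x a])
    also have "\<dots> = 1" using omega_pow[OF twist_Z[OF x a]] l by simp
    finally have 1: "\<theta> (len a) (cls a) (?c ^^ l) = \<theta> (len a) (cls a) id" 
      using theta_id index[OF a] by simp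
    have "?c ^^ l = id"
    proof (cases "cls a = 1")
      case True
      have "?c ^^ l \<in> generate (signed_perm_group ?D) {?c}" for l
      proof (induction l)
        case 0
        show ?case using generate.one[of "signed_perm_group ?D" "{?c}"] unfolding funpow.simps(1) signed_perm_group_simps .
      next
        case (Suc l)
        have "?c \<in> generate (signed_perm_group ?D) {?c}" by (rule generate.incl) simp
        then show ?case using generate.eng[OF _ Suc]
          unfolding funpow.simps(2) signed_perm_group_simps by blast
      qed
      moreover from this[of 0] have "id \<in> generate (signed_perm_group ?D) {?c}" unfolding funpow.simps(1) .
      moreover have "inj_on (\<theta> (len a) (cls a)) (generate (signed_perm_group ?D) {?c})"
        using W[OF a] True by simp
      ultimately show ?thesis using 1 by (blast dest: inj_onD)
    next
      case False
      have "?c ^^ l \<in> D.Z ?c" "id \<in> D.Z ?c"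
        using D.Z_pow[OF D.Z_self[OF c]] D.sp_id by (simp_all add: D.Z_iff)
      moreover have "inj_on (\<theta> (len a) (cls a)) (D.Z ?c)"
        using W[OF a] False by simp
      ultimately show ?thesis using 1 by (blast dest: inj_onD)
    qed
    then have "(?c ^^ l) a = a" by simp
    then show ?thesis using twist_pow[OF x a, of l a] supp_refl[OF x] by simp
  qed
  moreover have "\<omega> (perm_restrict uminus (cyc_supp x a)) = 1"
    if a: "a \<in> pm_points n" and "\<forall>i. (x ^^ i) a \<noteq> - a" for a
  proof -
    have "cls a = 1" using that x by (intro cyc_class_eq_1) auto
    then have "\<theta> (len a) (cls a) (perm_restrict uminus (cyc_supp x a)) = 1" using W[OF a] by simp
    moreover have "\<omega> (perm_restrict uminus (cyc_supp x a)) = \<theta> (len a) (cls a) (perm_restrict uminus (cyc_supp x a))"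
      by (rule omega_local[OF a restrict_uminus_Z[OF x a]]) (simp add: perm_restrict_def)
    ultimately show ?thesis by simp
  qed
  ultimately show ?thesis
    using stc by (intro exI[of _ B] faithful_character.intro faithful_character_axioms.intro)
qed

end

section \<open>Integer powers, conjugacy classes, and the summation over classes\<close>

context signed_set
begin

lemma nat_pow_G: "signed_perm u \<Longrightarrow> u [^]\<^bsub>G\<^esub> (m::nat) = u ^^ m"
  by (induction m) (simp_all add: G.nat_pow_Suc fun_eq_iff funpow_swap1)

text \<open>In a finite group a possibly negative exponent may be replaced by its residue modulo the
  group order. The residue depends only on \<open>k\<close>, so one natural number serves both for
  the roots of \<open>g\<close> and for the condition on the classes.\<close>

lemma int_pow_G:
  assumes "signed_perm u"
  shows "u [^]\<^bsub>G\<^esub> (k::int) = u ^^ nat (k mod int (order G))"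
proof -
  have u: "u \<in> carrier G" using assms carrier_G by blast
  have "finite (carrier G)" using carrier_G finite_sp by simp
  then have ord: "order G > 0" using G.order_gt_0_iff_finite by blast
  define m where "m = nat (k mod int (order G))"
  have k: "k = int (order G) * (k div int (order G)) + int m" using ord by (simp add: m_def)
  have "u [^]\<^bsub>G\<^esub> (int (order G) * (k div int (order G))) = \<one>\<^bsub>G\<^esub>"
    using G.int_pow_pow[OF u, of "int (order G)" "k div int (order G)", symmetric] G.pow_order_eq_1[OF u] by (simp only: int_pow_int G.int_pow_one)
  then have "u [^]\<^bsub>G\<^esub> k = u [^]\<^bsub>G\<^esub> int m"
    using G.int_pow_mult[OF u, of "int (order G) * (k div int (order G))" "int m"] k
      G.l_one[OF G.int_pow_closed[OF u, of "int m"]] by metis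
  then show ?thesis unfolding int_pow_int nat_pow_G[OF assms] unfolding m_def .
qed

lemma conj_class_eq: "conj_class G v = {s \<circ> v \<circ> pinv s | s. signed_perm s}"
  unfolding conj_class_def carrier_G by (auto simp: inv_G)

lemma conj_class_sp: "signed_perm v \<Longrightarrow> u \<in> conj_class G v \<Longrightarrow> signed_perm u"
  unfolding conj_class_eq using sp_comp sp_inv(1) by blast

lemma conj_class_refl: "v \<in> conj_class G v"
  unfolding conj_class_eq using sp_id by (fastforce intro: exI[of _ id])

lemma conj_class_mono:
  assumes "u \<in> conj_class G v" shows "conj_class G u \<subseteq> conj_class G v"
proof
  fix w assume "w \<in> conj_class G u"
  then obtain s r where s: "signed_perm s" "w = s \<circ> u \<circ> pinv s" "signed_perm r" "u = r \<circ> v \<circ> pinv r"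
    using assms unfolding conj_class_eq by blast
  have "pinv (s \<circ> r) = pinv r \<circ> pinv s"
    using sp_inv[OF s(1)] sp_inv[OF s(3)] by (intro inv_equality) auto
  then have "w = (s \<circ> r) \<circ> v \<circ> pinv (s \<circ> r)" using s by (simp add: fun_eq_iff)
  then show "w \<in> conj_class G v" unfolding conj_class_eq using sp_comp[OF s(1,3)] by blast
qed

lemma conj_class_sym:
  assumes "u \<in> conj_class G v" shows "v \<in> conj_class G u"
proof -
  obtain r where r: "signed_perm r" "u = r \<circ> v \<circ> pinv r" using assms unfolding conj_class_eq by blast
  have "pinv (pinv r) = r" using sp_inv[OF r(1)] by (intro inv_equality) auto
  then have "v = pinv r \<circ> u \<circ> pinv (pinv r)" using sp_inv[OF r(1)] r by (simp add: fun_eq_iff)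
  then show ?thesis unfolding conj_class_eq using sp_inv(1)[OF r(1)] by blast
qed

lemma conj_class_eqI: "u \<in> conj_class G v \<Longrightarrow> conj_class G u = conj_class G v"
  using conj_class_mono conj_class_sym by blast

lemma conj_class_pow_id:
  assumes "u \<in> conj_class G v" "v ^^ K = id" shows "u ^^ K = id"
proof -
  obtain r where r: "signed_perm r" "u = r \<circ> v \<circ> pinv r" using assms unfolding conj_class_eq by blast
  have ur: "r (v a) = u (r a)" for a using sp_inv(2)[OF r(1)] by (simp add: r)
  have "(u ^^ K) a = a" for a
    using funpow_intertwine[of r v u K "pinv r a", OF ur] sp_inv(3)[OF r(1)] assms(2) by simp
  then show ?thesis by (simp add: fun_eq_iff)
qed

end

text \<open>\<psi> is an arbitrary family satisfying the defining predicate, so no representative,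
  faithful character or base point is fixed. Each member is evaluated at \<open>g\<close> as the sum
  of \<open>Omega u g\<close> over the \<open>u\<close> in its class that commute with
  \<open>g\<close>. The condition on a class holds as soon as it holds at one element, so the sum
  over classes collects each commuting \<open>u\<close> with \<open>u^K = id\<close> exactly
  once.\<close>

theorem theorem1p5:
  fixes k :: int and n :: nat
    and \<psi> :: "(int \<Rightarrow> int) set \<Rightarrow> (int \<Rightarrow> int) \<Rightarrow> complex"
  assumes "n > 0"
    and "\<And>C. C \<in> conj_classes (hyperoctahedral_group n) \<Longrightarrow> higher_lie_char n C (\<psi> C)"
  shows "\<forall>g \<in> carrier (hyperoctahedral_group n).
    of_nat (roots (hyperoctahedral_group n) k g) =
      (\<Sum>C \<in> {C \<in> conj_classes (hyperoctahedral_group n).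
               (\<lambda>x. x [^]\<^bsub>hyperoctahedral_group n\<^esub> k) ` C = {\<one>\<^bsub>hyperoctahedral_group n\<^esub>}}. \<psi> C g)"
proof
  interpret signed_set "pm_points n" by (rule signed_set_pm_points)
  have H: "hyperoctahedral_group n = G" by (simp add: hyperoctahedral_group_def)
  fix g assume "g \<in> carrier (hyperoctahedral_group n)"
  then have g: "signed_perm g" using carrier_G by (simp add: H)
  define K where "K = nat (k mod int (order G))"
  have psi: "\<psi> C g = (\<Sum>u\<in>{u \<in> Z g. u \<in> C}. Omega u g)" if C: "C \<in> conj_classes G" for C
  proof -
    obtain x \<omega> where x: "x \<in> C" and o: "omega_char n x \<omega>" and p: "\<psi> C g = induced_char G (Z x) \<omega> g"
      using assms(2)[of C] C g carrier_G unfolding higher_lie_char_def H by blast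
    obtain v where v: "signed_perm v" "C = conj_class G v"
      using C unfolding conj_classes_def carrier_G by blast
    then have xs: "signed_perm x" "C = conj_class G x" using conj_class_sp conj_class_eqI x by auto
    obtain \<theta> where "omega_data n x \<omega> \<theta>"
      using o xs(1) signed_set_axioms unfolding omega_char_def H omega_data_def omega_data_axioms_def by blast
    then obtain B where "faithful_character (pm_points n) x \<omega> B" using omega_data.faithful by blast
    from faithful_character.induced_char_eq[OF this g] show ?thesis using p xs(2) by simp
  qed
  let ?CC = "{C \<in> conj_classes G. (\<lambda>x. x [^]\<^bsub>G\<^esub> k) ` C = {\<one>\<^bsub>G\<^esub>}}"
  let ?U = "{u \<in> Z g. u ^^ K = id}"
  have CC: "conj_class G u \<in> ?CC \<longleftrightarrow> u ^^ K = id" if u: "signed_perm u" for u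
  proof -
    have "(\<lambda>x. x [^]\<^bsub>G\<^esub> k) ` conj_class G u = (\<lambda>x. x ^^ K) ` conj_class G u"
      using int_pow_G[OF conj_class_sp[OF u]] by (intro image_cong) (auto simp: K_def)
    moreover have "(\<lambda>x. x ^^ K) ` conj_class G u = {id} \<longleftrightarrow> u ^^ K = id"
    proof
      assume "(\<lambda>x. x ^^ K) ` conj_class G u = {id}"
      then show "u ^^ K = id" using conj_class_refl[of u] by (metis imageI singletonD)
    next
      assume "u ^^ K = id"
      then have "v ^^ K = id" if "v \<in> conj_class G u" for v using conj_class_pow_id[OF that] by blast
      then show "(\<lambda>x. x ^^ K) ` conj_class G u = {id}" using conj_class_refl[of u]
        by (intro equalityI image_subsetI subsetI) (metis singletonI, metis imageI singletonD)
    qed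
    moreover have "conj_class G u \<in> conj_classes G" using u carrier_G by (auto simp: conj_classes_def)
    ultimately show ?thesis by simp
  qed
  have fU: "finite ?U" using finite_Z by simp
  have "finite (conj_classes G)" unfolding conj_classes_def carrier_G using finite_sp by blast
  then have fC: "finite ?CC" by simp
  have sub: "conj_class G ` ?U \<subseteq> ?CC" using CC by (auto simp: Z_iff)
  have "(\<Sum>C\<in>?CC. \<psi> C g) = (\<Sum>C\<in>?CC. \<Sum>u\<in>{u \<in> ?U. conj_class G u = C}. Omega u g)"
  proof (rule sum.cong[OF refl])
    fix C assume C: "C \<in> ?CC"
    then obtain v where v: "signed_perm v" "C = conj_class G v" unfolding conj_classes_def carrier_G by blast
    have vK: "v ^^ K = id" using CC[OF v(1)] C v(2) by blast
    have "{u \<in> ?U. conj_class G u = C} = {u \<in> Z g. u \<in> C}"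
      using conj_class_refl conj_class_eqI conj_class_pow_id[OF _ vK] unfolding v(2) by blast
    then show "\<psi> C g = (\<Sum>u\<in>{u \<in> ?U. conj_class G u = C}. Omega u g)" using psi[of C] C by simp
  qed
  also have "\<dots> = (\<Sum>u\<in>?U. Omega u g)" by (rule sum.group[OF fU fC sub])
  also have "\<dots> = of_nat (card {h. signed_perm h \<and> h ^^ K = g})" by (rule roots_eq_sum_Omega[OF g, symmetric])
  also have "{h. signed_perm h \<and> h ^^ K = g} = {h \<in> carrier G. h [^]\<^bsub>G\<^esub> k = g}"
    unfolding carrier_G using int_pow_G[of _ k] by (auto simp: K_def)
  finally show "of_nat (roots (hyperoctahedral_group n) k g) =
      (\<Sum>C \<in> {C \<in> conj_classes (hyperoctahedral_group n).
               (\<lambda>x. x [^]\<^bsub>hyperoctahedral_group n\<^esub> k) ` C = {\<one>\<^bsub>hyperoctahedral_group n\<^esub>}}. \<psi> C g)"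
    unfolding H roots_def ..
qed

end
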